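(* Let $p$ be a polynomial on $\mathbb{R}^m$ and put $K(iy,z):=e^{-\Delta_{(y)}/2}E_\kappa(iy,z)$. Then for every $z\in\mathbb{R}^m$, $$V_\kappa(p)(z)=\frac{1}{(2\pi)^{m/2}}\int_{\mathbb{R}^m}K(iy,z)\,\mathcal F\big(p(\cdot)e^{-|\cdot|^2/2}\big)(y)\,dy =\frac{1}{(2\pi)^{m/2}}\int_{\mathbb{R}^m}\mathcal F\big(e^{-|\cdot|^2/2}E_\kappa(\cdot,-z)\big)(y)\,\mathcal F\big(e^{-|\cdot|^2/2}p(\cdot)\big)(y)\,e^{|y|^2/2}\,dy,$$ the integrals being absolutely convergent.
   Context: Let $G\subset O(m)$ be a finite reflection group with root system $R$, fixed positive subsystem $R_+$, and let $\kappa:R\to[0,\infty)$ be a $G$-invariant multiplicity function. For $\alpha\in R$, $\sigma_\alpha x=x-2\langle x,\alpha\rangle\alpha/\|\alpha\|^2$. The Dunkl operators are $T_jf(x)=\partial_jf(x)+\sum_{\alpha\in R_+}\kappa(\alpha)\alpha_j\frac{f(x)-f(\sigma_\alpha x)}{\langle \alpha,x\rangle}$, $j=1,\dots,m$. The intertwining operator $V_\kappa$ is the unique linear isomorphism of the space $\mathcal P$ of polynomials on $\mathbb{R}^m$ that maps homogeneous polynomials of degree $n$ to homogeneous polynomials of degree $n$, satisfies $V_\kappa1=1$ and $T_jV_\kappa=V_\kappa\partial_j$ for all $j$. The Dunkl kernel $E_\kappa(x,y)$ (extended holomorphically to $\mathbb{C}^m\times\mathbb{C}^m$) is the unique function with $T^{(x)}_jE_\kappa(x,y)=y_jE_\kappa(x,y)$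 for all $j$ and $E_\kappa(0,y)=1$; equivalently $E_\kappa(x,y)=V_\kappa(e^{\langle\cdot,y\rangle})(x)$. $\Delta_{(y)}$ is the ordinary Laplacian in $y$ and $e^{-\Delta_{(y)}/2}F(y)=\sum_{n\ge0}\frac{(-1)^n}{2^nn!}\Delta_{(y)}^nF(y)$; for $F(y)=E_\kappa(iy,z)$ this converges and equals $V_\kappa$ applied in $z$ to $x\mapsto e^{|x|^2/2}e^{i\langle y,x\rangle}$. The Fourier transform is $\mathcal Ff(y)=(2\pi)^{-m/2}\int_{\mathbb{R}^m}e^{-i\langle x,y\rangle}f(x)\,dx$. *)

theory Defs
  imports "HOL-Analysis.Analysis"
begin

definition refl_vec :: "real^'n \<Rightarrow> real^'n \<Rightarrow> real^'n" where
  "refl_vec \<alpha> x = x - (2 * (x \<bullet> \<alpha>) / (\<alpha> \<bullet> \<alpha>)) *\<^sub>R \<alpha>"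

definition root_system :: "(real^'n) set \<Rightarrow> bool" where
  "root_system R \<longleftrightarrow> finite R \<and> 0 \<notin> R \<and>
     (\<forall>\<alpha>\<in>R. \<forall>\<beta>\<in>R. refl_vec \<alpha> \<beta> \<in> R) \<and>
     (\<forall>\<alpha>\<in>R. \<forall>c::real. c *\<^sub>R \<alpha> \<in> R \<longrightarrow> c = 1 \<or> c = -1)"

inductive_set refl_group :: "(real^'n) set \<Rightarrow> (real^'n \<Rightarrow> real^'n) set" for R where
  id_in: "id \<in> refl_group R"
| step: "g \<in> refl_group R \<Longrightarrow> \<alpha> \<in> R \<Longrightarrow> refl_vec \<alpha> \<circ> g \<in> refl_group R"

definition positive_subsystem :: "(real^'n) set \<Rightarrow> (real^'n) set \<Rightarrow> bool" where
  "positive_subsystem R Rp \<longleftrightarrow>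
     (\<exists>\<beta>. (\<forall>\<alpha>\<in>R. \<alpha> \<bullet> \<beta> \<noteq> 0) \<and> Rp = {\<alpha>\<in>R. \<alpha> \<bullet> \<beta> > 0})"

definition multiplicity :: "(real^'n) set \<Rightarrow> (real^'n \<Rightarrow> real) \<Rightarrow> bool" where
  "multiplicity R \<kappa> \<longleftrightarrow> (\<forall>\<alpha>\<in>R. \<kappa> \<alpha> \<ge> 0) \<and>
     (\<forall>g\<in>refl_group R. \<forall>\<alpha>\<in>R. \<kappa> (g \<alpha>) = \<kappa> \<alpha>)"

definition cvec :: "real^'n \<Rightarrow> complex^'n" where
  "cvec x = (\<chi> i. complex_of_real (x $ i))"

definition partial_dir :: "'n::finite \<Rightarrow> (real^'n \<Rightarrow> complex) \<Rightarrow> real^'n \<Rightarrow> complex" where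
  "partial_dir j f x = vector_derivative (\<lambda>t. f (x + t *\<^sub>R axis j 1)) (at 0)"

definition laplacian :: "(real^'n::finite \<Rightarrow> complex) \<Rightarrow> real^'n \<Rightarrow> complex" where
  "laplacian f = (\<lambda>x. \<Sum>i\<in>UNIV. partial_dir i (partial_dir i f) x)"

text \<open>Dunkl operator T_j (formula valid off the reflecting hyperplanes).\<close>
definition dunkl_op :: "(real^'n) set \<Rightarrow> (real^'n \<Rightarrow> real) \<Rightarrow> 'n::finite
     \<Rightarrow> (real^'n \<Rightarrow> complex) \<Rightarrow> real^'n \<Rightarrow> complex" where
  "dunkl_op Rp \<kappa> j f x = partial_dir j f x +
     (\<Sum>\<alpha>\<in>Rp. complex_of_real (\<kappa> \<alpha> * \<alpha> $ j) * (f x - f (refl_vec \<alpha> x)) / complex_of_real (\<alpha> \<bullet> x))"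

definition fourier :: "(real^'n::finite \<Rightarrow> complex) \<Rightarrow> real^'n \<Rightarrow> complex" where
  "fourier f y = complex_of_real ((2 * pi) powr (- real CARD('n) / 2)) *
     (\<integral>x. exp (- \<i> * complex_of_real (x \<bullet> y)) * f x \<partial>lborel)"

type_synonym 'n mpoly_c = "('n \<Rightarrow> nat) \<Rightarrow> complex"

definition polys :: "'n mpoly_c set" where
  "polys = {c. finite {a. c a \<noteq> 0}}"

definition peval :: "'n::finite mpoly_c \<Rightarrow> complex^'n \<Rightarrow> complex" where
  "peval c w = (\<Sum>a\<in>{a. c a \<noteq> 0}. c a * (\<Prod>i\<in>UNIV. (w $ i) ^ a i))"

definition homog :: "nat \<Rightarrow> 'n::finite mpoly_c \<Rightarrow> bool" where
  "homog n c \<longleftrightarrow> (\<forall>a. c a \<noteq> 0 \<longrightarrow> (\<Sum>i\<in>UNIV. a i) = n)"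

definition poly_one :: "'n mpoly_c" where
  "poly_one = (\<lambda>a. if a = (\<lambda>_. 0) then 1 else 0)"

definition pdc :: "'n \<Rightarrow> 'n mpoly_c \<Rightarrow> 'n mpoly_c" where
  "pdc j c = (\<lambda>a. of_nat (Suc (a j)) * c (a(j := Suc (a j))))"

definition poly_fun :: "(real^'n::finite \<Rightarrow> complex) \<Rightarrow> bool" where
  "poly_fun p \<longleftrightarrow> (\<exists>c\<in>polys. \<forall>x. p x = peval c (cvec x))"

definition coeffs_of :: "(real^'n::finite \<Rightarrow> complex) \<Rightarrow> 'n mpoly_c" where
  "coeffs_of p = (THE c. c \<in> polys \<and> (\<forall>x. p x = peval c (cvec x)))"

definition intertwiner :: "(real^'n) set \<Rightarrow> (real^'n) set \<Rightarrow> (real^'n \<Rightarrow> real)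
     \<Rightarrow> ('n::finite mpoly_c \<Rightarrow> 'n mpoly_c) \<Rightarrow> bool" where
  "intertwiner R Rp \<kappa> V \<longleftrightarrow>
     bij_betw V polys polys \<and>
     (\<forall>c\<in>polys. \<forall>d\<in>polys. \<forall>s t. V (\<lambda>a. s * c a + t * d a) = (\<lambda>a. s * V c a + t * V d a)) \<and>
     (\<forall>n. \<forall>c\<in>polys. homog n c \<longrightarrow> homog n (V c)) \<and>
     V poly_one = poly_one \<and>
     (\<forall>j. \<forall>c\<in>polys. \<forall>x. (\<forall>\<alpha>\<in>R. \<alpha> \<bullet> x \<noteq> 0) \<longrightarrow>
        dunkl_op Rp \<kappa> j (\<lambda>y. peval (V c) (cvec y)) x = peval (V (pdc j c)) (cvec x))"

definition Vk :: "(real^'n) set \<Rightarrow> (real^'n) set \<Rightarrow> (real^'n \<Rightarrow> real)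
     \<Rightarrow> 'n::finite mpoly_c \<Rightarrow> 'n mpoly_c" where
  "Vk R Rp \<kappa> c = (THE d. \<exists>V. intertwiner R Rp \<kappa> V \<and> V c = d)"

definition Vfun :: "(real^'n) set \<Rightarrow> (real^'n) set \<Rightarrow> (real^'n \<Rightarrow> real)
     \<Rightarrow> (real^'n::finite \<Rightarrow> complex) \<Rightarrow> real^'n \<Rightarrow> complex" where
  "Vfun R Rp \<kappa> p = (\<lambda>x. peval (Vk R Rp \<kappa> (coeffs_of p)) (cvec x))"

text \<open>Dunkl kernel E(w,u) = V_\<kappa>(e^{<.,u>})(w) = \<Sum>_n V_\<kappa>(<.,u>^n/n!)(w), for w,u in C^m.\<close>
definition dunkl_kernel :: "(real^'n) set \<Rightarrow> (real^'n) set \<Rightarrow> (real^'n \<Rightarrow> real)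
     \<Rightarrow> complex^'n::finite \<Rightarrow> complex^'n \<Rightarrow> complex" where
  "dunkl_kernel R Rp \<kappa> w u = (\<Sum>n. peval (Vk R Rp \<kappa>
      (coeffs_of (\<lambda>x. (\<Sum>i\<in>UNIV. complex_of_real (x $ i) * u $ i) ^ n / of_nat (fact n)))) w)"

definition Kfun :: "(real^'n) set \<Rightarrow> (real^'n) set \<Rightarrow> (real^'n \<Rightarrow> real)
     \<Rightarrow> real^'n::finite \<Rightarrow> real^'n \<Rightarrow> complex" where
  "Kfun R Rp \<kappa> y z = (\<Sum>n. complex_of_real ((-1) ^ n / (2 ^ n * fact n)) *
      (laplacian ^^ n) (\<lambda>y'. dunkl_kernel R Rp \<kappa> (\<chi> i. \<i> * complex_of_real (y' $ i)) (cvec z)) y)"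

end

theory Submission
  imports Defs "HOL-Probability.Probability" "HOL-Library.Function_Algebras"
begin

text \<open>
  On homogeneous polynomials of degree \<open>n > 0\<close> the intertwining operator is forced by Euler's
  identity for the Dunkl operators: \<open>L\<^sub>n (V p) = \<Sum>\<^sub>j x\<^sub>j V (\<partial>\<^sub>j p)\<close>, where
  \<open>L\<^sub>n f = (n + \<gamma>) f - \<Sum>\<^sub>\<alpha> \<kappa>(\<alpha>) f \<circ> \<sigma>\<^sub>\<alpha>\<close> and \<open>\<gamma> = \<Sum>\<^sub>\<alpha> \<kappa>(\<alpha>)\<close>, sums over positive roots. Since
  \<open>\<kappa> \<ge> 0\<close>, evaluating at a point of a finite orbit where \<open>f\<close> is largest gives
  \<open>n max |f| \<le> max |L\<^sub>n f|\<close> over the orbit. This one maximum principle makes \<open>L\<^sub>n\<close> bijective (so \<open>V\<close>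
  exists and is unique; the commutation \<open>T\<^sub>i V = V \<partial>\<^sub>i\<close> follows by induction from the
  vector-valued version, without knowing that the Dunkl operators commute), bounds
  \<open>v\<^sub>a = V(x\<^sup>a)(z)\<close> by \<open>|z|\<^bsup>|a|\<^esup>\<close>, and gives the symmetry of the homogeneous parts of the Dunkl
  kernel, because \<open>L\<^sub>n E\<^sub>n(\<cdot>, u) = \<langle>\<cdot>, u\<rangle> E\<^sub>n\<^sub>-\<^sub>1(\<cdot>, u)\<close>.

  By symmetry \<open>E(iy, z) = \<Sum>\<^sub>a v\<^sub>a (iy)\<^sup>a / a!\<close>, and applying \<open>exp (- \<Delta> / 2)\<close> termwise turns the
  monomials into products of Hermite polynomials. These are also the Fourier transforms of
  \<open>(- x)\<^sup>a exp (- |x|\<^sup>2 / 2) / a!\<close>, so both integrals reduce to the same one, which is evaluated by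
  the orthogonality of the Hermite polynomials.
\<close>

subsection \<open>Multi-indices and polynomials in coefficient form\<close>

text \<open>The Dunkl operators contain difference quotients that are meaningful only off the
  reflecting hyperplanes. Identities between them are proved at regular points, and continuity
  supplies the remaining points where they are needed; the operator L_n has no quotients. Sums run
  over all roots with weight \<kappa>/2 instead of over the positive ones, because only the full
  root system is permuted by reflections.

  For p of degree n the residuals r_i = T_i(V p) - V(\<partial>_i p) satisfy (n + \<gamma>) r(y) =
  sum of \<kappa>(\<alpha>) \<sigma>_\<alpha> r(\<sigma>_\<alpha> y) over positive roots. The outer
  reflection is an isometry of the values, so the maximum principle still forces r = 0.

  The analytic obstacle is the exchange of sums and integrals. Both factors of the generating
  function exp(t^2/2 + i x t) have absolutely convergent majorants; with |v_a| <= |z|^|a| the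
  Hermite series grows in each coordinate at most like a constant times exp(|z| |x|), which a
  Gaussian absorbs.\<close>

definition mdeg :: "('n::finite \<Rightarrow> nat) \<Rightarrow> nat" where
  "mdeg a = (\<Sum>i\<in>UNIV. a i)"

definition midx :: "nat \<Rightarrow> ('n::finite \<Rightarrow> nat) set" where
  "midx n = {a. mdeg a = n}"

definition mon :: "('n::finite \<Rightarrow> nat) \<Rightarrow> complex^'n \<Rightarrow> complex" where
  "mon a w = (\<Prod>i\<in>UNIV. (w $ i) ^ a i)"

definition inc :: "'n \<Rightarrow> ('n \<Rightarrow> nat) \<Rightarrow> 'n \<Rightarrow> nat" where
  "inc j a = a(j := Suc (a j))"

definition dec :: "'n \<Rightarrow> ('n \<Rightarrow> nat) \<Rightarrow> 'n \<Rightarrow> nat" where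
  "dec j a = a(j := a j - 1)"

lemma inc_same [simp]: "inc j a j = Suc (a j)"
  by (simp add: inc_def)

lemma inj_inc: "inj (inc j)"
proof (rule injI)
  fix a b :: "'a \<Rightarrow> nat"
  assume "inc j a = inc j b"
  then have "inc j a i = inc j b i" for i by simp
  then have "a i = b i" for i
    by (cases "i = j") (metis inc_same nat.inject, metis inc_def fun_upd_other)
  then show "a = b" by blast
qed

lemma dec_inc [simp]: "dec j (inc j a) = a"
  by (auto simp: inc_def dec_def)

lemma inc_dec: "a j \<noteq> 0 \<Longrightarrow> inc j (dec j a) = a"
  by (auto simp: inc_def dec_def)

lemma range_inc: "range (inc j) = {a. a j \<noteq> 0}"
proof -
  have "a \<in> range (inc j)" if "a j \<noteq> 0" for a
    using inc_dec[of a j] that by (metis rangeI)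
  then show ?thesis by auto
qed

lemma pdc_inc: "pdc j c a = of_nat (Suc (a j)) * c (inc j a)"
  by (simp add: pdc_def inc_def)

lemma pdc_commute: "pdc i (pdc j c) = pdc j (pdc i c)"
  by (cases "i = j") (auto simp: pdc_def fun_eq_iff fun_upd_twist)

lemma mdeg_inc [simp]: "mdeg (inc j a) = Suc (mdeg a)"
proof -
  have "mdeg (inc j a) = Suc (a j) + (\<Sum>i\<in>UNIV - {j}. inc j a i)"
    unfolding mdeg_def by (subst sum.remove[of _ j]) auto
  also have "(\<Sum>i\<in>UNIV - {j}. inc j a i) = (\<Sum>i\<in>UNIV - {j}. a i)"
    by (rule sum.cong) (auto simp: inc_def)
  also have "Suc (a j) + \<dots> = Suc (mdeg a)"
    unfolding mdeg_def by (subst (2) sum.remove[of _ j]) auto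
  finally show ?thesis .
qed

lemma mdeg_zero [simp]: "mdeg (\<lambda>_. 0) = 0"
  by (simp add: mdeg_def)

lemma mdeg_eq_0_iff: "mdeg a = 0 \<longleftrightarrow> a = (\<lambda>_. 0)"
  by (auto simp: mdeg_def)

lemma midx_0: "midx 0 = {\<lambda>_. 0}"
  by (auto simp: midx_def mdeg_eq_0_iff)

lemma le_mdeg: "a i \<le> mdeg a"
  unfolding mdeg_def by (rule member_le_sum) auto

lemma finite_midx [simp]: "finite (midx n)"
proof (rule finite_subset)
  show "midx n \<subseteq> (PiE UNIV (\<lambda>_. {..n}))"
    using le_mdeg by (auto simp: midx_def PiE_UNIV_domain)
qed (auto intro: finite_PiE)

text \<open>The factor \<open>b j\<close> kills exactly the indices outside the range of
  \<open>inc j\<close>; the others are reindexed by their predecessors.\<close>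

lemma sum_midx_Suc_shift:
  fixes G :: "('n::finite \<Rightarrow> nat) \<Rightarrow> 'b::comm_semiring_1"
  shows "(\<Sum>b\<in>midx (Suc k). of_nat (b j) * G b) = (\<Sum>b\<in>midx k. of_nat (Suc (b j)) * G (inc j b))"
proof -
  have im: "inc j ` midx k = {b\<in>midx (Suc k). b j \<noteq> 0}"
  proof
    show "{b\<in>midx (Suc k). b j \<noteq> 0} \<subseteq> inc j ` midx k"
    proof
      fix b assume b: "b \<in> {b\<in>midx (Suc k). b j \<noteq> 0}"
      then have "b = inc j (dec j b)" by (simp add: inc_dec)
      moreover from this b have "dec j b \<in> midx k"
        by (metis (mono_tags, lifting) mdeg_inc mem_Collect_eq midx_def nat.inject)
      ultimately show "b \<in> inc j ` midx k" by blast
    qed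
  qed (auto simp: midx_def)
  have "(\<Sum>b\<in>midx (Suc k). of_nat (b j) * G b) = (\<Sum>b\<in>{b\<in>midx (Suc k). b j \<noteq> 0}. of_nat (b j) * G b)"
    by (rule sum.mono_neutral_right) auto
  also have "\<dots> = (\<Sum>b\<in>midx k. of_nat (Suc (b j)) * G (inc j b))"
    unfolding im[symmetric] by (subst sum.reindex) (auto intro: inj_on_subset[OF inj_inc])
  finally show ?thesis .
qed

text \<open>The degree of an index is the sum of its entries, so the sum splits into one shift per
  coordinate. This is the induction step for identities over all indices of one degree, such as the
  multinomial theorem.\<close>

lemma sum_midx_Suc:
  fixes G :: "('n::finite \<Rightarrow> nat) \<Rightarrow> 'b::comm_semiring_1"
  shows "of_nat (Suc k) * (\<Sum>b\<in>midx (Suc k). G b)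
    = (\<Sum>j\<in>UNIV. \<Sum>b\<in>midx k. of_nat (Suc (b j)) * G (inc j b))"
proof -
  have "of_nat (Suc k) * (\<Sum>b\<in>midx (Suc k). G b) = (\<Sum>b\<in>midx (Suc k). (\<Sum>j\<in>UNIV. of_nat (b j)) * G b)"
    unfolding sum_distrib_left
    by (rule sum.cong) (auto simp: midx_def mdeg_def simp flip: of_nat_sum)
  also have "\<dots> = (\<Sum>j\<in>UNIV. \<Sum>b\<in>midx (Suc k). of_nat (b j) * G b)"
    by (subst sum.swap) (simp add: sum_distrib_right)
  finally show ?thesis by (simp only: sum_midx_Suc_shift)
qed

lemma mon_zero [simp]: "mon (\<lambda>_. 0) w = 1"
  by (simp add: mon_def)

lemma mon_inc: "mon (inc j a) w = w $ j * mon a w"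
proof -
  have "mon (inc j a) w = (w $ j) ^ Suc (a j) * (\<Prod>i\<in>UNIV - {j}. (w $ i) ^ inc j a i)"
    unfolding mon_def by (subst prod.remove[of _ j]) auto
  also have "(\<Prod>i\<in>UNIV - {j}. (w $ i) ^ inc j a i) = (\<Prod>i\<in>UNIV - {j}. (w $ i) ^ a i)"
    by (rule prod.cong) (auto simp: inc_def)
  also have "(w $ j) ^ Suc (a j) * \<dots> = w $ j * mon a w"
    unfolding mon_def by (subst (2) prod.remove[of _ j]) auto
  finally show ?thesis .
qed

lemma mon_add: "mon (\<lambda>i. a i + b i) w = mon a w * mon b w"
  by (simp add: mon_def power_add prod.distrib)

lemma mon_scale: "mon a (s *s w) = s ^ mdeg a * mon a w"
  by (simp add: mon_def power_mult_distrib prod.distrib mdeg_def power_sum)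

lemma peval_eq_sum:
  assumes "finite A" "\<And>a. c a \<noteq> 0 \<Longrightarrow> a \<in> A"
  shows "peval c w = (\<Sum>a\<in>A. c a * mon a w)"
  unfolding peval_def mon_def using assms by (intro sum.mono_neutral_left) auto

lemma polysI: "finite A \<Longrightarrow> (\<And>a. c a \<noteq> 0 \<Longrightarrow> a \<in> A) \<Longrightarrow> c \<in> polys"
  unfolding polys_def by (auto intro: finite_subset)

lemma polys_bounded_degree:
  assumes "c \<in> polys" obtains N where "\<And>a. c a \<noteq> 0 \<Longrightarrow> mdeg a \<le> N"
proof -
  have "finite (mdeg ` {a. c a \<noteq> 0})" using assms by (simp add: polys_def)
  then obtain N where "\<forall>n\<in>mdeg ` {a. c a \<noteq> 0}. n \<le> N"
    using finite_nat_set_iff_bounded_le by blast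
  then show ?thesis using that by auto
qed

lemma homog_midx: "homog n c \<longleftrightarrow> (\<forall>a. c a \<noteq> 0 \<longrightarrow> a \<in> midx n)"
  by (simp add: homog_def midx_def mdeg_def)

lemma homog_polys: "homog n c \<Longrightarrow> c \<in> polys"
  by (rule polysI[of "midx n"]) (auto simp: homog_midx)

lemma peval_homog: "homog n c \<Longrightarrow> peval c w = (\<Sum>a\<in>midx n. c a * mon a w)"
  by (rule peval_eq_sum) (auto simp: homog_midx)

lemma polys_lincomb: "c \<in> polys \<Longrightarrow> d \<in> polys \<Longrightarrow> (\<lambda>a. s * c a + t * d a) \<in> polys"
  by (rule polysI[of "{a. c a \<noteq> 0} \<union> {a. d a \<noteq> 0}"]) (auto simp: polys_def)

lemma peval_lincomb:
  assumes "c \<in> polys" "d \<in> polys"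
  shows "peval (\<lambda>a. s * c a + t * d a) w = s * peval c w + t * peval d w"
proof -
  let ?A = "{a. c a \<noteq> 0} \<union> {a. d a \<noteq> 0}"
  have "finite ?A" using assms by (auto simp: polys_def)
  then show ?thesis
    by (subst (1 2 3) peval_eq_sum[of ?A])
      (auto simp: algebra_simps sum.distrib sum_distrib_left)
qed

lemma peval_pdc:
  assumes "finite A" "\<And>a. c a \<noteq> 0 \<Longrightarrow> a \<in> A"
  shows "peval (pdc j c) w = (\<Sum>a\<in>A. of_nat (a j) * c a * mon (dec j a) w)"
proof -
  have "(\<Sum>a\<in>A. of_nat (a j) * c a * mon (dec j a) w)
      = (\<Sum>a\<in>inc j ` (inc j -` A). of_nat (a j) * c a * mon (dec j a) w)"
    using assms(1) range_inc[of j] by (intro sum.mono_neutral_right) auto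
  also have "\<dots> = (\<Sum>a\<in>inc j -` A. pdc j c a * mon a w)"
    by (subst sum.reindex) (auto intro: inj_on_subset[OF inj_inc] simp: pdc_inc)
  also have "\<dots> = peval (pdc j c) w"
    using assms by (intro peval_eq_sum[symmetric]) (auto simp: pdc_inc intro: finite_vimageI inj_inc)
  finally show ?thesis by simp
qed

lemma pdc_polys: "c \<in> polys \<Longrightarrow> pdc j c \<in> polys"
  using finite_vimageI[OF _ inj_inc, of "{a. c a \<noteq> 0}" j]
  by (intro polysI[of "inc j -` {a. c a \<noteq> 0}"]) (auto simp: pdc_inc polys_def)

lemma pdc_homog: "homog (Suc n) c \<Longrightarrow> homog n (pdc j c)"
  by (auto simp: homog_midx pdc_inc midx_def)

lemma euler_homog:
  assumes "homog n c"
  shows "(\<Sum>j\<in>UNIV. w $ j * peval (pdc j c) w) = of_nat n * peval c w"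
proof -
  have "w $ j * (of_nat (a j) * c a * mon (dec j a) w) = of_nat (a j) * (c a * mon a w)" for j a
  proof (cases "a j = 0")
    case False
    then show ?thesis using mon_inc[of j "dec j a" w] by (simp add: inc_dec)
  qed simp
  then have "w $ j * peval (pdc j c) w = (\<Sum>a\<in>midx n. of_nat (a j) * (c a * mon a w))" for j
    using assms by (subst peval_pdc[of "midx n"]) (simp_all only: homog_midx sum_distrib_left finite_midx, blast?)
  then have "(\<Sum>j\<in>UNIV. w $ j * peval (pdc j c) w)
      = (\<Sum>a\<in>midx n. (\<Sum>j\<in>UNIV. of_nat (a j)) * (c a * mon a w))"
    by (simp add: sum_distrib_right) (rule sum.swap)
  also have "\<dots> = (\<Sum>a\<in>midx n. of_nat n * (c a * mon a w))"
    by (rule sum.cong) (auto simp: midx_def mdeg_def simp flip: of_nat_sum)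
  finally show ?thesis using assms by (simp add: peval_homog sum_distrib_left)
qed

lemma cvec_nth [simp]: "cvec x $ i = complex_of_real (x $ i)"
  by (simp add: cvec_def)

section \<open>Derivatives of polynomials and uniqueness of their coefficients\<close>

lemma has_derivative_mon:
  "((\<lambda>x. mon a (cvec x)) has_derivative
     (\<lambda>h. \<Sum>j\<in>UNIV. complex_of_real (h $ j) * (of_nat (a j) * mon (dec j a) (cvec x)))) (at x)"
proof -
  have nth: "((\<lambda>x. complex_of_real (x $ i)) has_derivative (\<lambda>h. complex_of_real (h $ i))) (at x)" for i
    by (auto intro!: derivative_eq_intros bounded_linear_imp_has_derivative
        bounded_linear_compose[OF bounded_linear_of_real bounded_linear_vec_nth])
  have p: "((\<lambda>x. complex_of_real (x $ i) ^ a i) has_derivative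
     (\<lambda>h. of_nat (a i) * complex_of_real (h $ i) * complex_of_real (x $ i) ^ (a i - 1))) (at x)" for i
    using has_derivative_power[OF nth[of i], of "a i"] by simp
  have e: "of_nat (a j) * complex_of_real (h $ j) * complex_of_real (x $ j) ^ (a j - 1)
         * (\<Prod>i\<in>UNIV - {j}. complex_of_real (x $ i) ^ a i)
       = complex_of_real (h $ j) * (of_nat (a j) * mon (dec j a) (cvec x))" for j h
  proof -
    have "mon (dec j a) (cvec x) = complex_of_real (x $ j) ^ (a j - 1)
         * (\<Prod>i\<in>UNIV - {j}. complex_of_real (x $ i) ^ dec j a i)"
      unfolding mon_def by (subst prod.remove[of _ j]) (auto simp: dec_def)
    also have "(\<Prod>i\<in>UNIV - {j}. complex_of_real (x $ i) ^ dec j a i)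
        = (\<Prod>i\<in>UNIV - {j}. complex_of_real (x $ i) ^ a i)"
      by (rule prod.cong) (auto simp: dec_def)
    finally show ?thesis by simp
  qed
  have "((\<lambda>x. \<Prod>i\<in>UNIV. complex_of_real (x $ i) ^ a i) has_derivative
     (\<lambda>h. \<Sum>j\<in>UNIV. of_nat (a j) * complex_of_real (h $ j) * complex_of_real (x $ j) ^ (a j - 1)
         * (\<Prod>i\<in>UNIV - {j}. complex_of_real (x $ i) ^ a i))) (at x)"
    by (rule has_derivative_prod) (rule p)
  then show ?thesis unfolding e by (simp only: mon_def cvec_nth)
qed

lemma has_derivative_peval:
  assumes "c \<in> polys"
  shows "((\<lambda>x. peval c (cvec x)) has_derivative
     (\<lambda>h. \<Sum>j\<in>UNIV. complex_of_real (h $ j) * peval (pdc j c) (cvec x))) (at x)"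
proof -
  let ?A = "{a. c a \<noteq> 0}"
  have A: "finite ?A" using assms by (simp add: polys_def)
  have "((\<lambda>x. \<Sum>a\<in>?A. c a * mon a (cvec x)) has_derivative
     (\<lambda>h. \<Sum>a\<in>?A. c a * (\<Sum>j\<in>UNIV. complex_of_real (h $ j) * (of_nat (a j) * mon (dec j a) (cvec x))))) (at x)"
    by (intro has_derivative_sum has_derivative_mult_right has_derivative_mon)
  moreover have "(\<Sum>a\<in>?A. c a * (\<Sum>j\<in>UNIV. complex_of_real (h $ j) * (of_nat (a j) * mon (dec j a) (cvec x))))
     = (\<Sum>j\<in>UNIV. complex_of_real (h $ j) * peval (pdc j c) (cvec x))" for h
    by (subst peval_pdc[OF A]) (auto simp: sum_distrib_left algebra_simps intro!: sum.swap)
  ultimately show ?thesis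
    by (subst peval_eq_sum[OF A]) auto
qed

lemma partial_dir_has_derivative:
  assumes "(f has_derivative f') (at x)"
  shows "partial_dir j f x = f' (axis j 1)"
proof -
  have "((\<lambda>t. x + t *\<^sub>R axis j 1) has_derivative (\<lambda>t. t *\<^sub>R axis j 1)) (at 0)"
    by (auto intro!: derivative_eq_intros)
  moreover have "(f has_derivative f') (at (x + 0 *\<^sub>R axis j 1))" using assms by simp
  ultimately have "((\<lambda>t. f (x + t *\<^sub>R axis j 1)) has_derivative (\<lambda>t. f' (t *\<^sub>R axis j 1))) (at 0)"
    by (rule has_derivative_compose)
  then have "((\<lambda>t. f (x + t *\<^sub>R axis j 1)) has_vector_derivative f' (axis j 1)) (at 0)"
    using has_derivative_bounded_linear[OF assms] 
    by (simp add: has_vector_derivative_def linear_simps)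
  then show ?thesis
    unfolding partial_dir_def by (rule vector_derivative_at)
qed

lemma sum_axis_mult: "(\<Sum>j\<in>UNIV. complex_of_real (axis i 1 $ j) * g j) = g (i::'n::finite)"
proof -
  have "(\<Sum>j\<in>UNIV. complex_of_real (axis i 1 $ j) * g j) = (\<Sum>j\<in>UNIV. if j = i then g j else 0)"
    by (rule sum.cong) (auto simp: axis_def)
  then show ?thesis by simp
qed

lemma partial_dir_peval:
  assumes "c \<in> polys"
  shows "partial_dir j (\<lambda>x. peval c (cvec x)) x = peval (pdc j c) (cvec x)"
  using partial_dir_has_derivative[OF has_derivative_peval[OF assms]] by (simp add: sum_axis_mult)

lemma peval_0: "peval c (cvec 0) = c (\<lambda>_. 0)" if "c \<in> polys" for c :: "'n::finite mpoly_c"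
proof -
  have z: "mon a (cvec 0) = (if a = (\<lambda>_. 0) then 1 else 0)" for a :: "'n \<Rightarrow> nat"
    by (auto simp: mon_def fun_eq_iff)
  have "finite {a. c a \<noteq> 0}" using that by (simp add: polys_def)
  then show ?thesis
    by (subst peval_eq_sum[of "{a. c a \<noteq> 0}"])
      (auto simp: z if_distrib[of "\<lambda>t. _ * t"] sum.If_cases Int_def cong: if_cong)
qed

text \<open>Differentiating in a direction j with \<open>a j \<noteq> 0\<close> lowers the degree of
  the index; repeated, this moves the coefficient at \<open>a\<close> to the constant term, which is
  the value at 0. Uniqueness of coefficients gives meaning to the description in
  \<open>coeffs_of\<close>.\<close>

lemma peval_eq_0_imp:
  fixes c :: "'n::finite mpoly_c"
  assumes "c \<in> polys" "\<And>x. peval c (cvec x) = 0"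
  shows "c = (\<lambda>_. 0)"
proof -
  have "c a = 0" if "c \<in> polys" "\<forall>x. peval c (cvec x) = 0" "mdeg a = n" for n a and c :: "'n mpoly_c"
    using that
  proof (induction n arbitrary: a c)
    case 0
    then show ?case using peval_0[of c] by (simp add: mdeg_eq_0_iff)
  next
    case (Suc n)
    then obtain j where j: "a j \<noteq> 0" by (metis mdeg_eq_0_iff nat.distinct(1))
    have fz: "(\<lambda>x. peval c (cvec x)) = (\<lambda>_. 0)" using Suc.prems by auto
    have d0: "peval (pdc j c) (cvec x) = 0" for x
      using partial_dir_peval[OF Suc.prems(1), of j x] partial_dir_has_derivative[of "\<lambda>_. 0" "\<lambda>_. 0" x j]
      unfolding fz by simp
    have deg: "mdeg (dec j a) = n"
      using mdeg_inc[of j "dec j a"] Suc.prems(3) j by (simp add: inc_dec)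
    have "pdc j c (dec j a) = 0"
      by (rule Suc.IH[OF pdc_polys[OF Suc.prems(1)] _ deg]) (simp add: d0)
    then have "of_nat (Suc (dec j a j)) * c (inc j (dec j a)) = 0"
      by (simp only: pdc_inc)
    then have "c (inc j (dec j a)) = 0" by (simp only: mult_eq_0_iff of_nat_eq_0_iff) simp
    then show ?case using inc_dec[of a j] j by metis
  qed
  with assms show ?thesis by (auto simp: fun_eq_iff)
qed

lemma peval_inject:
  assumes "c \<in> polys" "d \<in> polys" "\<And>x. peval c (cvec x) = peval d (cvec x)"
  shows "c = d"
proof -
  have "(\<lambda>a. 1 * c a + (-1) * d a) = (\<lambda>_. 0)"
    using assms by (intro peval_eq_0_imp polys_lincomb) (simp_all only: peval_lincomb, simp_all)
  then show ?thesis by (simp add: fun_eq_iff)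
qed

lemma coeffs_of_eq:
  assumes "c \<in> polys" "\<And>x. p x = peval c (cvec x)"
  shows "coeffs_of p = c"
  unfolding coeffs_of_def using assms peval_inject by (intro the_equality) auto

subsection \<open>Homogeneous polynomial functions\<close>

text \<open>Functions rather than coefficient families, since reflections act by composition. The
  body has literally the spanned form that \<open>linear_inj_imp_surj_fun\<close> expects.\<close>

definition hfun :: "nat \<Rightarrow> (real^'n::finite \<Rightarrow> complex) set" where
  "hfun n = {f. \<exists>c. f = (\<lambda>x. \<Sum>a\<in>midx n. c a * mon a (cvec x))}"

lemma hfun_iff: "f \<in> hfun n \<longleftrightarrow> (\<exists>c. homog n c \<and> f = (\<lambda>x. peval c (cvec x)))"
proof
  assume "f \<in> hfun n"
  then obtain c where f: "f = (\<lambda>x. \<Sum>a\<in>midx n. c a * mon a (cvec x))" by (auto simp: hfun_def)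
  define d where "d = (\<lambda>a. if a \<in> midx n then c a else 0)"
  have d: "homog n d" by (auto simp: d_def homog_midx)
  moreover have "f = (\<lambda>x. peval d (cvec x))"
    unfolding f peval_homog[OF d] by (auto simp: d_def)
  ultimately show "\<exists>c. homog n c \<and> f = (\<lambda>x. peval c (cvec x))" by blast
next
  assume "\<exists>c. homog n c \<and> f = (\<lambda>x. peval c (cvec x))"
  then show "f \<in> hfun n" by (auto simp: hfun_def peval_homog)
qed

lemma hfun_lincomb: "f \<in> hfun n \<Longrightarrow> g \<in> hfun n \<Longrightarrow> (\<lambda>x. s * f x + t * g x) \<in> hfun n"
proof -
  assume "f \<in> hfun n" "g \<in> hfun n"
  then obtain c d where f: "f = (\<lambda>x. \<Sum>a\<in>midx n. c a * mon a (cvec x))"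
    and g: "g = (\<lambda>x. \<Sum>a\<in>midx n. d a * mon a (cvec x))"
    by (auto simp: hfun_def)
  have "(\<lambda>x. s * f x + t * g x) = (\<lambda>x. \<Sum>a\<in>midx n. (s * c a + t * d a) * mon a (cvec x))"
    unfolding f g by (auto simp: sum_distrib_left sum.distrib algebra_simps)
  then show "(\<lambda>x. s * f x + t * g x) \<in> hfun n"
    unfolding hfun_def by (intro CollectI exI[of _ "\<lambda>a. s * c a + t * d a"])
qed

lemma hfun_zero: "(\<lambda>x. 0) \<in> hfun n"
  unfolding hfun_def by (auto intro!: exI[of _ "\<lambda>_. 0"])

lemma hfun_scale: "f \<in> hfun n \<Longrightarrow> (\<lambda>x. s * f x) \<in> hfun n"
  using hfun_lincomb[of f n "\<lambda>_. 0" s 0] hfun_zero by auto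

lemma hfun_add: "f \<in> hfun n \<Longrightarrow> g \<in> hfun n \<Longrightarrow> (\<lambda>x. f x + g x) \<in> hfun n"
  using hfun_lincomb[of f n g 1 1] by auto

lemma hfun_sum:
  "(\<And>i. i \<in> A \<Longrightarrow> f i \<in> hfun n) \<Longrightarrow> (\<lambda>x. \<Sum>i\<in>A. f i x) \<in> hfun n"
  by (induction A rule: infinite_finite_induct) (auto intro: hfun_zero hfun_add)

lemma mon_hfun: "a \<in> midx n \<Longrightarrow> (\<lambda>x. mon a (cvec x)) \<in> hfun n"
  unfolding hfun_def
  by (auto intro!: exI[of _ "\<lambda>b. if b = a then 1 else 0"]
      simp: if_distrib[of "\<lambda>t. t * _"] cong: if_cong)

lemma hfun_mult:
  assumes "f \<in> hfun m" "g \<in> hfun n"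
  shows "(\<lambda>x. f x * g x) \<in> hfun (m + n)"
proof -
  obtain c d where f: "f = (\<lambda>x. \<Sum>a\<in>midx m. c a * mon a (cvec x))"
    and g: "g = (\<lambda>x. \<Sum>a\<in>midx n. d a * mon a (cvec x))"
    using assms by (auto simp: hfun_def)
  have "(\<lambda>x. f x * g x) = (\<lambda>x. \<Sum>a\<in>midx m. \<Sum>b\<in>midx n. (c a * d b) * mon (\<lambda>i. a i + b i) (cvec x))"
    unfolding f g by (auto simp: sum_product mon_add algebra_simps)
  also have "\<dots> \<in> hfun (m + n)"
    by (intro hfun_sum hfun_scale mon_hfun) (auto simp: midx_def mdeg_def sum.distrib)
  finally show ?thesis .
qed

lemma hfun_const: "(\<lambda>x. s) \<in> hfun 0"
  unfolding hfun_def by (auto intro!: exI[of _ "\<lambda>_. s"] simp: midx_0)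

lemma hfun_coord: "(\<lambda>x. complex_of_real (x $ j)) \<in> hfun 1"
proof -
  have "(\<lambda>x. mon (inc j (\<lambda>_. 0)) (cvec x)) \<in> hfun 1"
    by (rule mon_hfun) (simp add: midx_def)
  then show ?thesis by (simp add: mon_inc)
qed

lemma hfun_power: "f \<in> hfun m \<Longrightarrow> (\<lambda>x. f x ^ k) \<in> hfun (k * m)"
proof (induction k)
  case (Suc k)
  then show ?case using hfun_mult[of f m "\<lambda>x. f x ^ k" "k * m"] by auto
qed (auto intro: hfun_const)

lemma hfun_prod:
  "finite A \<Longrightarrow> (\<And>i. i \<in> A \<Longrightarrow> f i \<in> hfun (e i)) \<Longrightarrow> (\<lambda>x. \<Prod>i\<in>A. f i x) \<in> hfun (\<Sum>i\<in>A. e i)"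
proof (induction A rule: finite_induct)
  case (insert i A)
  then show ?case using hfun_mult[of "f i" "e i" "\<lambda>x. \<Prod>i\<in>A. f i x" "\<Sum>i\<in>A. e i"] by auto
qed (auto intro: hfun_const)

lemma hfun_compose_linear:
  fixes f :: "real^'n::finite \<Rightarrow> complex"
  assumes "f \<in> hfun n" "linear g"
  shows "(\<lambda>x. f (g x)) \<in> hfun n"
proof -
  have lin: "(\<lambda>x. complex_of_real (g x $ i)) \<in> hfun 1" for i
  proof -
    have e: "g x $ i = (\<Sum>j\<in>UNIV. x $ j * (g (axis j 1) $ i))" for x
    proof -
      have "g x = g (\<Sum>j\<in>UNIV. (x $ j) *\<^sub>R axis j 1)"
        using basis_expansion[of x] by (simp add: scalar_mult_eq_scaleR)
      also have "\<dots> = (\<Sum>j\<in>UNIV. (x $ j) *\<^sub>R g (axis j 1))"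
        using assms(2) by (simp add: linear_sum linear_scale)
      finally show ?thesis by simp
    qed
    have "(\<lambda>x. complex_of_real (g x $ i))
        = (\<lambda>x. \<Sum>j\<in>UNIV. complex_of_real (g (axis j 1) $ i) * complex_of_real (x $ j))"
      by (rule ext, subst e) (simp add: mult.commute)
    also have "\<dots> \<in> hfun 1" by (intro hfun_sum hfun_scale hfun_coord)
    finally show ?thesis .
  qed
  obtain c where f: "f = (\<lambda>x. \<Sum>a\<in>midx n. c a * mon a (cvec x))"
    using assms by (auto simp: hfun_def)
  have "(\<lambda>x. mon a (cvec (g x))) \<in> hfun n" if "a \<in> midx n" for a
  proof -
    have "(\<lambda>x. \<Prod>i\<in>UNIV. complex_of_real (g x $ i) ^ a i) \<in> hfun (\<Sum>i\<in>UNIV. a i * 1)"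
      by (intro hfun_prod hfun_power lin) auto
    then show ?thesis using that by (simp add: mon_def midx_def mdeg_def)
  qed
  then show ?thesis unfolding f by (intro hfun_sum hfun_scale) auto
qed

lemma hfun_differentiable: "f \<in> hfun n \<Longrightarrow> \<exists>f'. (f has_derivative f') (at x)"
  unfolding hfun_iff using has_derivative_peval homog_polys by blast

lemma hfun_continuous: "f \<in> hfun n \<Longrightarrow> isCont f x"
  using hfun_differentiable has_derivative_continuous by blast

lemma hfun_euler:
  assumes "f \<in> hfun n"
  shows "(\<Sum>j\<in>UNIV. complex_of_real (x $ j) * partial_dir j f x) = of_nat n * f x"
proof -
  obtain c where c: "homog n c" and f: "f = (\<lambda>x. peval c (cvec x))"
    using assms by (auto simp: hfun_iff)
  show ?thesis
    unfolding f partial_dir_peval[OF homog_polys[OF c]] using euler_homog[OF c, of "cvec x"] by simp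
qed

subsection \<open>Linear algebra on finite-dimensional function spaces\<close>

lemma sum_fun_eq: "(\<Sum>i\<in>I. f i) = (\<lambda>x. \<Sum>i\<in>I. f i x)" for f :: "'i \<Rightarrow> 'a \<Rightarrow> complex"
  by (induction I rule: infinite_finite_induct) (auto simp: fun_eq_iff)

text \<open>A dimension count. The spanning family \<open>e\<close> may be dependent, so a basis B
  is extracted from it; its image is independent and equally large. An element of S outside the span
  of the image would give an independent set larger than B inside the span of B.\<close>

lemma linear_inj_imp_surj_fun:
  fixes F :: "('a \<Rightarrow> complex) \<Rightarrow> 'a \<Rightarrow> complex" and e :: "'i \<Rightarrow> 'a \<Rightarrow> complex"
  assumes lin: "\<And>s t f g. F (\<lambda>x. s * f x + t * g x) = (\<lambda>x. s * F f x + t * F g x)"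
    and I: "finite I" and S: "S = {f. \<exists>c. f = (\<lambda>x. \<Sum>i\<in>I. c i * e i x)}"
    and FS: "\<And>f. f \<in> S \<Longrightarrow> F f \<in> S"
    and inj: "\<And>f. f \<in> S \<Longrightarrow> F f = (\<lambda>_. 0) \<Longrightarrow> f = (\<lambda>_. 0)"
    and g: "g \<in> S"
  shows "\<exists>f\<in>S. F f = g"
proof -
  interpret vs: vector_space "\<lambda>s (f::'a \<Rightarrow> complex) x. s * f x"
    by unfold_locales (auto simp: fun_eq_iff algebra_simps)
  have subS: "vs.subspace S"
  proof (rule vs.subspaceI)
    show "0 \<in> S" unfolding S by (auto intro!: exI[of _ "\<lambda>_. 0"])
  next
    fix f g assume "f \<in> S" "g \<in> S"
    then obtain c d where "f = (\<lambda>x. \<Sum>i\<in>I. c i * e i x)" "g = (\<lambda>x. \<Sum>i\<in>I. d i * e i x)"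
      unfolding S by auto
    then show "f + g \<in> S" unfolding S
      by (auto intro!: exI[of _ "\<lambda>i. c i + d i"] simp: algebra_simps sum.distrib fun_eq_iff)
  next
    fix s f assume "f \<in> S"
    then obtain c where "f = (\<lambda>x. \<Sum>i\<in>I. c i * e i x)" unfolding S by auto
    then show "(\<lambda>x. s * f x) \<in> S" unfolding S
      by (auto intro!: exI[of _ "\<lambda>i. s * c i"] simp: algebra_simps sum_distrib_left)
  qed
  have eS: "e i \<in> S" if "i \<in> I" for i
    unfolding S using that I
    by (auto intro!: exI[of _ "\<lambda>j. if j = i then 1 else 0"] simp: if_distrib[of "\<lambda>t. t * _"] cong: if_cong)
  have "f \<in> vs.span (e ` I)" if "f \<in> S" for f
  proof -
    from that obtain c where "f = (\<lambda>x. \<Sum>i\<in>I. c i * e i x)" unfolding S by auto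
    then have "f = (\<Sum>i\<in>I. (\<lambda>x. c i * e i x))" by (simp add: sum_fun_eq)
    also have "\<dots> \<in> vs.span (e ` I)"
      by (intro vs.span_sum vs.span_scale vs.span_base) auto
    finally show ?thesis .
  qed
  moreover have "vs.span (e ` I) \<subseteq> S" using eS subS by (intro vs.span_minimal) auto
  ultimately have spanS: "vs.span (e ` I) = S" by auto
  obtain B where B: "B \<subseteq> e ` I" "vs.independent B" "e ` I \<subseteq> vs.span B"
    using vs.maximal_independent_subset by blast
  have finB: "finite B" using B(1) I finite_subset by blast
  have spanB: "vs.span B = S"
    using B spanS vs.span_mono vs.span_span by (metis subset_antisym)
  interpret F: Vector_Spaces.linear "\<lambda>s (f::'a \<Rightarrow> complex) x. s * f x" "\<lambda>s (f::'a \<Rightarrow> complex) x. s * f x" F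
  proof unfold_locales
    show "F (f + g) = F f + F g" for f g
      using lin[of 1 f 1 g] by (simp add: plus_fun_def)
    show "F (\<lambda>x. s * f x) = (\<lambda>x. s * F f x)" for s f
      using lin[of s f 0 f] by simp
  qed
  have injS: "inj_on F S"
    by (subst F.inj_on_iff_eq_0[OF subS]) (use inj in \<open>auto simp: zero_fun_def\<close>)
  have indF: "vs.independent (F ` B)"
    using F.independent_injective_image[OF B(2)] injS spanB by simp
  have cardF: "card (F ` B) = card B"
    by (rule card_image) (use injS spanB vs.span_superset in \<open>auto intro: inj_on_subset\<close>)
  have FB: "F ` B \<subseteq> S" using FS spanB vs.span_superset by blast
  have "g \<in> vs.span (F ` B)"
  proof (rule ccontr)
    assume n: "g \<notin> vs.span (F ` B)"
    then have "vs.independent (insert g (F ` B))" using indF by (rule vs.independent_insertI)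
    then have "card (insert g (F ` B)) \<le> card B"
      using vs.independent_span_bound[OF finB] g FB spanB by auto
    moreover have "g \<notin> F ` B" using n vs.span_base[of g "F ` B"] by auto
    ultimately show False using finB cardF by simp
  qed
  then show ?thesis using F.span_image[of B] spanB by auto
qed

subsection \<open>Reflections\<close>

lemma linear_refl_vec: "linear (refl_vec \<alpha>)"
  unfolding refl_vec_def
  by (rule linearI) (auto simp: inner_add_left add_divide_distrib distrib_left scaleR_add_left
      algebra_simps)

lemma refl_vec_self_adjoint: "refl_vec \<alpha> x \<bullet> y = x \<bullet> refl_vec \<alpha> y"
  by (simp add: refl_vec_def inner_diff_left inner_diff_right inner_commute[of y \<alpha>])

lemma refl_vec_refl_vec [simp]: "refl_vec \<alpha> (refl_vec \<alpha> x) = x"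
proof (cases "\<alpha> = 0")
  case False
  then show ?thesis
    by (simp add: refl_vec_def inner_diff_left field_simps scaleR_diff_left[symmetric])
qed (simp add: refl_vec_def)

lemma refl_vec_inner: "refl_vec \<alpha> x \<bullet> refl_vec \<alpha> y = x \<bullet> y"
  by (simp add: refl_vec_self_adjoint)

lemma norm_refl_vec [simp]: "norm (refl_vec \<alpha> x) = norm x"
  by (simp add: norm_eq_sqrt_inner refl_vec_inner)

text \<open>Reflections preserve inner products, so conjugation by one of them only moves the root.
  This is the source of the equivariance statements below.\<close>

lemma refl_vec_conj: "refl_vec \<beta> (refl_vec \<alpha> x) = refl_vec (refl_vec \<beta> \<alpha>) (refl_vec \<beta> x)"
  unfolding refl_vec_def[of \<alpha> x] refl_vec_def[of "refl_vec \<beta> \<alpha>"]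
  by (simp add: refl_vec_inner linear_diff[OF linear_refl_vec] linear_scale[OF linear_refl_vec])

lemma refl_vec_uminus: "refl_vec (- \<alpha>) = refl_vec \<alpha>"
  by (auto simp: refl_vec_def fun_eq_iff)

lemma refl_vec_self: "refl_vec \<alpha> \<alpha> = - \<alpha>"
proof (cases "\<alpha> = 0")
  case False
  then show ?thesis by (simp add: refl_vec_def scaleR_2)
qed (simp add: refl_vec_def)

section \<open>Finite orbits, density of regular points and the maximum principle\<close>

text \<open>\<open>w\<close> is later \<kappa>/2, so that a sum over all roots reproduces the sum
  over the positive ones. \<open>b0\<close> is later the vector that defines the positive subsystem;
  here it is a direction transversal to all reflecting hyperplanes.\<close>

locale dunkl =
  fixes R :: "(real^'n::finite) set" and w :: "real^'n \<Rightarrow> real" and b0 :: "real^'n"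
  assumes finite_R: "finite R"
    and refl_R: "\<alpha> \<in> R \<Longrightarrow> \<beta> \<in> R \<Longrightarrow> refl_vec \<alpha> \<beta> \<in> R"
    and w_nonneg: "\<alpha> \<in> R \<Longrightarrow> 0 \<le> w \<alpha>"
    and w_refl: "\<alpha> \<in> R \<Longrightarrow> \<beta> \<in> R \<Longrightarrow> w (refl_vec \<alpha> \<beta>) = w \<beta>"
    and b0: "\<alpha> \<in> R \<Longrightarrow> \<alpha> \<bullet> b0 \<noteq> 0"
begin

lemma sum_R_refl:
  assumes "\<beta> \<in> R"
  shows "(\<Sum>\<alpha>\<in>R. g (refl_vec \<beta> \<alpha>)) = (\<Sum>\<alpha>\<in>R. g \<alpha>)"
  by (rule sum.reindex_bij_witness[of _ "refl_vec \<beta>" "refl_vec \<beta>"]) (use assms refl_R in auto)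

text \<open>A finite set containing the orbit of \<open>x\<close> under the reflection group; it avoids the
  finiteness of the group itself.\<close>

definition orb :: "real^'n \<Rightarrow> (real^'n) set" where
  "orb x = {y. norm y = norm x \<and> y - x \<in> span R \<and> (\<forall>\<alpha>\<in>R. \<exists>\<beta>\<in>R. y \<bullet> \<alpha> = x \<bullet> \<beta>)}"

lemma orb_self: "x \<in> orb x"
  by (auto simp: orb_def span_zero)

lemma orb_norm: "y \<in> orb x \<Longrightarrow> norm y = norm x"
  by (simp add: orb_def)

lemma orb_span: "y \<in> orb x \<Longrightarrow> y - x \<in> span R"
  by (simp add: orb_def)

lemma orb_refl: "y \<in> orb x \<Longrightarrow> \<alpha> \<in> R \<Longrightarrow> refl_vec \<alpha> y \<in> orb x"
proof -
  assume y: "y \<in> orb x" and a: "\<alpha> \<in> R"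
  have "refl_vec \<alpha> y - x = (y - x) - (2 * (y \<bullet> \<alpha>) / (\<alpha> \<bullet> \<alpha>)) *\<^sub>R \<alpha>"
    by (simp add: refl_vec_def)
  also have "\<dots> \<in> span R"
    by (rule span_diff[OF orb_span[OF y] span_scale[OF span_base[OF a]]])
  finally show ?thesis
    using y a refl_R by (auto simp: orb_def refl_vec_self_adjoint)
qed

text \<open>A point of \<open>orb x\<close> is determined by its inner products with the roots: the
  difference of two points with equal products lies in the span of R and is orthogonal to it. Each
  product has only the finitely many values that x takes on R.\<close>

lemma finite_orb: "finite (orb x)"
proof (rule inj_on_finite)
  show "inj_on (\<lambda>y. restrict (\<lambda>\<alpha>. y \<bullet> \<alpha>) R) (orb x)"
  proof (rule inj_onI)
    fix y z assume y: "y \<in> orb x" and z: "z \<in> orb x"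
      and eq: "restrict (\<lambda>\<alpha>. y \<bullet> \<alpha>) R = restrict (\<lambda>\<alpha>. z \<bullet> \<alpha>) R"
    have orth: "\<alpha> \<in> R \<Longrightarrow> (y - z) \<bullet> \<alpha> = 0" for \<alpha>
      using fun_cong[OF eq, of \<alpha>] by (simp add: inner_diff_left)
    have "y - z = (y - x) - (z - x)" by simp
    also have "\<dots> \<in> span R" by (rule span_diff[OF orb_span[OF y] orb_span[OF z]])
    finally have yz: "y - z \<in> span R" .
    have "orthogonal (y - z) (y - z)"
      by (rule orthogonal_to_span[OF yz]) (simp add: orthogonal_def orth)
    then show "y = z" by (simp add: orthogonal_self)
  qed
  show "(\<lambda>y. restrict (\<lambda>\<alpha>. y \<bullet> \<alpha>) R) ` orb x \<subseteq> PiE R (\<lambda>_. (\<lambda>\<beta>. x \<bullet> \<beta>) ` R)"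
    by (auto simp: orb_def)
  show "finite (PiE R (\<lambda>_. (\<lambda>\<beta>. x \<bullet> \<beta>) ` R))"
    using finite_R by (intro finite_PiE) auto
qed

definition regular :: "real^'n \<Rightarrow> bool" where
  "regular x \<longleftrightarrow> (\<forall>\<alpha>\<in>R. \<alpha> \<bullet> x \<noteq> 0)"

lemma orb_regular: "y \<in> orb x \<Longrightarrow> regular x \<Longrightarrow> regular y"
  by (force simp: orb_def regular_def inner_commute)

text \<open>The line through x in direction \<open>b0\<close> meets each reflecting hyperplane at
  most once, so its points near x, apart from x itself, are regular.\<close>

lemma regular_dense:
  assumes "isCont f x" "\<And>y. regular y \<Longrightarrow> f y = (0::complex)"
  shows "f x = 0"
proof (rule tendsto_unique)
  have "((\<lambda>t::real. x + t *\<^sub>R b0) \<longlongrightarrow> x + 0 *\<^sub>R b0) (at 0)"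
    by (intro tendsto_intros)
  then show "((\<lambda>t. f (x + t *\<^sub>R b0)) \<longlongrightarrow> f x) (at (0::real))"
    using assms(1) by (intro isCont_tendsto_compose[of _ f]) auto
  let ?B = "\<Union>\<alpha>\<in>R. {t. \<alpha> \<bullet> (x + t *\<^sub>R b0) = 0}"
  have "{t. \<alpha> \<bullet> (x + t *\<^sub>R b0) = 0} \<subseteq> {- (\<alpha> \<bullet> x) / (\<alpha> \<bullet> b0)}" if "\<alpha> \<in> R" for \<alpha>
    using b0[OF that] by (auto simp: inner_add_right field_simps eq_neg_iff_add_eq_0)
  then have "finite ?B"
    using finite_R by (intro finite_UN_I) (auto intro: finite_subset)
  then have "\<forall>\<^sub>F t in at 0. t \<notin> ?B"
    using islimpt_finite[of ?B 0] unfolding islimpt_iff_eventually by blast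
  then show "((\<lambda>t. f (x + t *\<^sub>R b0)) \<longlongrightarrow> 0) (at (0::real))"
    by (intro tendsto_eventually) (auto elim!: eventually_mono intro!: assms(2) simp: regular_def)
qed simp

definition gam :: real where "gam = (\<Sum>\<alpha>\<in>R. w \<alpha>)"

text \<open>At a point y of the orbit where the norm of f is largest, the reflected terms contribute
  at most \<open>gam * norm (f y)\<close>, which cancels against the left side and leaves
  \<open>s * norm (f y) \<le> B\<close>. The functions \<open>h\<close> are only dominated by the
  reflected values of f, which leaves room for an isometry acting on the values of a vector
  field.\<close>

lemma max_principle:
  fixes f :: "real^'n \<Rightarrow> 'b::real_normed_vector"
  assumes "0 < s"
    and h: "\<And>y \<alpha>. y \<in> orb x \<Longrightarrow> \<alpha> \<in> R \<Longrightarrow> norm (h \<alpha> y) \<le> norm (f (refl_vec \<alpha> y))"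
    and B: "\<And>y. y \<in> orb x \<Longrightarrow> norm ((s + gam) *\<^sub>R f y - (\<Sum>\<alpha>\<in>R. w \<alpha> *\<^sub>R h \<alpha> y)) \<le> B"
  shows "norm (f x) \<le> B / s"
proof -
  have "finite ((\<lambda>y. norm (f y)) ` orb x)" "(\<lambda>y. norm (f y)) ` orb x \<noteq> {}"
    using finite_orb orb_self by auto
  then obtain y where y: "y \<in> orb x" and max: "\<And>z. z \<in> orb x \<Longrightarrow> norm (f z) \<le> norm (f y)"
    using Max_in[of "(\<lambda>y. norm (f y)) ` orb x"] Max_ge[of "(\<lambda>y. norm (f y)) ` orb x"] by fastforce
  have g0: "0 \<le> gam" unfolding gam_def by (intro sum_nonneg w_nonneg)
  have "(s + gam) * norm (f y) = norm ((s + gam) *\<^sub>R f y)" using assms(1) g0 by simp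
  also have "\<dots> \<le> B + norm (\<Sum>\<alpha>\<in>R. w \<alpha> *\<^sub>R h \<alpha> y)"
    using B[OF y] norm_triangle_sub[of "(s + gam) *\<^sub>R f y" "\<Sum>\<alpha>\<in>R. w \<alpha> *\<^sub>R h \<alpha> y"] by linarith
  also have "norm (\<Sum>\<alpha>\<in>R. w \<alpha> *\<^sub>R h \<alpha> y) \<le> (\<Sum>\<alpha>\<in>R. w \<alpha> * norm (f y))"
  proof (rule sum_norm_le)
    fix \<alpha> assume a: "\<alpha> \<in> R"
    have "norm (h \<alpha> y) \<le> norm (f y)" using h[OF y a] max[OF orb_refl[OF y a]] by linarith
    then show "norm (w \<alpha> *\<^sub>R h \<alpha> y) \<le> w \<alpha> * norm (f y)"
      using w_nonneg[OF a] by (simp add: mult_left_mono)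
  qed
  also have "\<dots> = gam * norm (f y)" by (simp add: gam_def sum_distrib_right)
  finally have "s * norm (f y) \<le> B" by (simp add: algebra_simps)
  then show ?thesis using max[OF orb_self] assms(1)
    by (simp add: field_simps) (meson mult_left_mono less_imp_le order_trans)
qed

text \<open>On homogeneous functions of degree n this is the operator sum_j x_j T_j with its
  denominators cancelled, see \<open>Tk_euler\<close>; in this form it makes sense at every
  point.\<close>

definition Lop :: "nat \<Rightarrow> (real^'n \<Rightarrow> complex) \<Rightarrow> real^'n \<Rightarrow> complex" where
  "Lop n f x = of_real (real n + gam) * f x - (\<Sum>\<alpha>\<in>R. of_real (w \<alpha>) * f (refl_vec \<alpha> x))"

lemma Lop_bound:
  assumes "0 < n" "\<And>y. y \<in> orb x \<Longrightarrow> norm (Lop n f y) \<le> B"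
  shows "norm (f x) \<le> B / real n"
  using assms by (intro max_principle[where h = "\<lambda>\<alpha> y. f (refl_vec \<alpha> y)"])
    (auto simp: Lop_def scaleR_conv_of_real)

lemma Lop_lincomb: "Lop n (\<lambda>x. s * f x + t * g x) = (\<lambda>x. s * Lop n f x + t * Lop n g x)"
  by (auto simp: Lop_def fun_eq_iff algebra_simps sum.distrib sum_distrib_left)

text \<open>The bound is applied to f - g with B = 0. Only values on one orbit enter, so pointwise
  identities can be proved without knowing that the functions are polynomials.\<close>

lemma Lop_inject:
  assumes "0 < n" "\<And>y. y \<in> orb x \<Longrightarrow> Lop n f y = Lop n g y"
  shows "f x = g x"
proof -
  have "norm (1 * f x + (-1) * g x) \<le> 0 / real n"
    by (rule Lop_bound[OF assms(1)]) (use assms(2) in \<open>simp only: Lop_lincomb, simp\<close>)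
  then show ?thesis by simp
qed

lemma Lop_hfun: "f \<in> hfun n \<Longrightarrow> Lop n f \<in> hfun n"
proof -
  assume f: "f \<in> hfun n"
  have "(\<lambda>x. 1 * (of_real (real n + gam) * f x) + (-1) * (\<Sum>\<alpha>\<in>R. of_real (w \<alpha>) * f (refl_vec \<alpha> x))) \<in> hfun n"
    by (intro hfun_lincomb hfun_scale hfun_sum f hfun_compose_linear linear_refl_vec)
  then show ?thesis by (simp add: Lop_def[abs_def])
qed

lemma Lop_surj:
  assumes "0 < n" "g \<in> hfun n"
  shows "\<exists>f\<in>hfun n. Lop n f = g"
proof (rule linear_inj_imp_surj_fun[OF Lop_lincomb finite_midx hfun_def Lop_hfun _ assms(2)])
  show "f = (\<lambda>_. 0)" if "Lop n f = (\<lambda>_. 0)" for f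
    using Lop_inject[OF assms(1), of _ f "\<lambda>_. 0"] that by (auto simp: Lop_def fun_eq_iff)
qed

text \<open>Conjugation turns \<sigma>_\<alpha> into the reflection in \<sigma>_\<beta> \<alpha>,
  and this change of root only permutes the weighted sum.\<close>

lemma Lop_compose_refl:
  assumes "\<beta> \<in> R"
  shows "Lop n (\<lambda>x. f (refl_vec \<beta> x)) x = Lop n f (refl_vec \<beta> x)"
proof -
  have "(\<Sum>\<alpha>\<in>R. of_real (w \<alpha>) * f (refl_vec \<beta> (refl_vec \<alpha> x)))
      = (\<Sum>\<alpha>\<in>R. of_real (w (refl_vec \<beta> \<alpha>)) * f (refl_vec (refl_vec \<beta> \<alpha>) (refl_vec \<beta> x)))"
    using assms by (intro sum.cong) (auto simp: w_refl refl_vec_conj[of \<beta>])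
  then show ?thesis
    using sum_R_refl[OF assms, of "\<lambda>\<alpha>. complex_of_real (w \<alpha>) * f (refl_vec \<alpha> (refl_vec \<beta> x))"]
    by (simp add: Lop_def)
qed

end

subsection \<open>Dunkl operators and construction of the intertwining operator\<close>

lemma partial_dir_add:
  "f differentiable (at x) \<Longrightarrow> g differentiable (at x) \<Longrightarrow>
    partial_dir j (\<lambda>x. f x + g x) x = partial_dir j f x + partial_dir j g x"
  using partial_dir_has_derivative[OF has_derivative_add]
  by (auto simp: differentiable_def partial_dir_has_derivative)

lemma partial_dir_scale:
  "f differentiable (at x) \<Longrightarrow> partial_dir j (\<lambda>x. s * f x) x = s * partial_dir j f x"
  using partial_dir_has_derivative[OF has_derivative_mult_right]
  by (auto simp: differentiable_def partial_dir_has_derivative)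

lemma linear_axis_expansion:
  fixes f :: "real^'n::finite \<Rightarrow> complex"
  assumes "linear f"
  shows "f h = (\<Sum>k\<in>UNIV. complex_of_real (h $ k) * f (axis k 1))"
proof -
  have "f h = f (\<Sum>k\<in>UNIV. (h $ k) *\<^sub>R axis k 1)"
    using basis_expansion[of h] by (simp add: scalar_mult_eq_scaleR)
  also have "\<dots> = (\<Sum>k\<in>UNIV. complex_of_real (h $ k) * f (axis k 1))"
    by (simp only: linear_sum[OF assms] linear_scale[OF assms]) (simp add: scaleR_conv_of_real)
  finally show ?thesis .
qed

lemma partial_dir_compose_linear:
  fixes f :: "real^'n::finite \<Rightarrow> complex"
  assumes "f differentiable (at (g x))" "linear g"
  shows "partial_dir i (\<lambda>x. f (g x)) x
    = (\<Sum>k\<in>UNIV. complex_of_real (g (axis i 1) $ k) * partial_dir k f (g x))"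
proof -
  obtain f' where f': "(f has_derivative f') (at (g x))"
    using assms by (auto simp: differentiable_def)
  have "((\<lambda>x. f (g x)) has_derivative (\<lambda>h. f' (g h))) (at x)"
    using linear_imp_has_derivative[OF assms(2)] f' by (rule has_derivative_compose)
  then have "partial_dir i (\<lambda>x. f (g x)) x = f' (g (axis i 1))"
    by (rule partial_dir_has_derivative)
  also have "\<dots> = (\<Sum>k\<in>UNIV. complex_of_real (g (axis i 1) $ k) * f' (axis k 1))"
    by (rule linear_axis_expansion[OF has_derivative_linear[OF f']])
  finally show ?thesis by (simp only: partial_dir_has_derivative[OF f'])
qed

lemma hfun_differentiable_at: "f \<in> hfun n \<Longrightarrow> f differentiable (at x)"
  using hfun_differentiable by (auto simp: differentiable_def)

lemma refl_vec_nth: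
  "refl_vec \<alpha> v $ i = v $ i - 2 * \<alpha> $ i / (\<alpha> \<bullet> \<alpha>) * (\<Sum>k\<in>UNIV. \<alpha> $ k * v $ k)"
proof -
  have "v \<bullet> \<alpha> = (\<Sum>k\<in>UNIV. \<alpha> $ k * v $ k)" by (simp add: inner_vec_def mult.commute)
  then show ?thesis by (simp add: refl_vec_def)
qed

lemma pdc_lincomb: "pdc j (\<lambda>a. s * c a + t * d a) = (\<lambda>a. s * pdc j c a + t * pdc j d a)"
  by (auto simp: pdc_inc fun_eq_iff algebra_simps)

context dunkl begin

definition Tk :: "'n \<Rightarrow> (real^'n \<Rightarrow> complex) \<Rightarrow> real^'n \<Rightarrow> complex" where
  "Tk i f x = partial_dir i f x +
     (\<Sum>\<alpha>\<in>R. complex_of_real (w \<alpha> * \<alpha> $ i) * (f x - f (refl_vec \<alpha> x)) / complex_of_real (\<alpha> \<bullet> x))"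

lemma Tk_add:
  "f differentiable (at x) \<Longrightarrow> g differentiable (at x) \<Longrightarrow>
    Tk i (\<lambda>x. f x + g x) x = Tk i f x + Tk i g x"
  by (simp add: Tk_def partial_dir_add sum.distrib[symmetric] add_divide_distrib[symmetric]
      distrib_left[symmetric] add.assoc) (simp add: algebra_simps)

lemma Tk_scale: "f differentiable (at x) \<Longrightarrow> Tk i (\<lambda>x. s * f x) x = s * Tk i f x"
  by (simp add: Tk_def partial_dir_scale sum_distrib_left algebra_simps)

lemma Tk_zero [simp]: "Tk i (\<lambda>x. s) x = 0"
  by (simp add: Tk_def partial_dir_has_derivative[of "\<lambda>_. s" "\<lambda>_. 0"])

lemma Tk_sum:
  "(\<And>k. k \<in> A \<Longrightarrow> f k differentiable (at x)) \<Longrightarrow> finite A \<Longrightarrow>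
    Tk i (\<lambda>x. \<Sum>k\<in>A. f k x) x = (\<Sum>k\<in>A. Tk i (f k) x)"
  by (induction A rule: infinite_finite_induct) (auto simp: Tk_add)

text \<open>The chain rule handles the derivative. In the difference part, replacing \<alpha> by
  \<sigma>_\<beta> \<alpha> leaves weights and inner products unchanged and turns the component in
  direction i into the one in direction \<sigma>_\<beta> e_i.\<close>

lemma Tk_refl:
  assumes b: "\<beta> \<in> R" and f: "f differentiable (at (refl_vec \<beta> x))"
  shows "Tk i (\<lambda>x. f (refl_vec \<beta> x)) x
    = (\<Sum>k\<in>UNIV. complex_of_real (refl_vec \<beta> (axis i 1) $ k) * Tk k f (refl_vec \<beta> x))"
proof -
  let ?s = "refl_vec \<beta>"
  define h where "h \<alpha> = complex_of_real (w \<alpha> * (\<alpha> \<bullet> ?s (axis i 1))) * (f (?s x) - f (refl_vec \<alpha> (?s x)))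
     / complex_of_real (\<alpha> \<bullet> ?s x)" for \<alpha>
  have "(\<Sum>\<alpha>\<in>R. complex_of_real (w \<alpha> * \<alpha> $ i) * (f (?s x) - f (?s (refl_vec \<alpha> x))) / complex_of_real (\<alpha> \<bullet> x))
      = (\<Sum>\<alpha>\<in>R. h (?s \<alpha>))"
    using b by (intro sum.cong)
      (auto simp: h_def w_refl refl_vec_inner refl_vec_conj[of \<beta>] inner_axis)
  also have "\<dots> = (\<Sum>\<alpha>\<in>R. h \<alpha>)" by (rule sum_R_refl[OF b])
  also have "\<dots> = (\<Sum>\<alpha>\<in>R. \<Sum>k\<in>UNIV. complex_of_real (?s (axis i 1) $ k) *
      (complex_of_real (w \<alpha> * \<alpha> $ k) * (f (?s x) - f (refl_vec \<alpha> (?s x))) / complex_of_real (\<alpha> \<bullet> ?s x)))"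
    by (intro sum.cong refl)
      (simp add: h_def inner_vec_def sum_distrib_left sum_distrib_right sum_divide_distrib algebra_simps)
  also have "\<dots> = (\<Sum>k\<in>UNIV. complex_of_real (?s (axis i 1) $ k) *
      (\<Sum>\<alpha>\<in>R. complex_of_real (w \<alpha> * \<alpha> $ k) * (f (?s x) - f (refl_vec \<alpha> (?s x))) / complex_of_real (\<alpha> \<bullet> ?s x)))"
    by (subst sum.swap) (simp only: sum_distrib_left)
  finally show ?thesis
    using partial_dir_compose_linear[of f ?s x i] f
    by (simp add: Tk_def linear_refl_vec distrib_left sum.distrib)
qed

text \<open>Besides the product rule, the difference x_j f - (\<sigma>_\<alpha> x)_j
  f(\<sigma>_\<alpha> x) equals x_j (f - f(\<sigma>_\<alpha> x)) + (x_j - (\<sigma>_\<alpha> x)_j)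
  f(\<sigma>_\<alpha> x), and the last bracket is a multiple of \<alpha> \<bullet> x, so it cancels
  the denominator.\<close>

lemma Tk_mult_coord:
  assumes f: "f differentiable (at x)" and x: "regular x"
  shows "Tk i (\<lambda>x. complex_of_real (x $ j) * f x) x
    = complex_of_real (x $ j) * Tk i f x + (if i = j then f x else 0)
      + (\<Sum>\<alpha>\<in>R. complex_of_real (w \<alpha> * (2 * \<alpha> $ i / (\<alpha> \<bullet> \<alpha>))) * (complex_of_real (\<alpha> $ j) * f (refl_vec \<alpha> x)))"
proof -
  obtain f' where f': "(f has_derivative f') (at x)" using f by (auto simp: differentiable_def)
  have nth: "((\<lambda>x. complex_of_real (x $ j)) has_derivative (\<lambda>h. complex_of_real (h $ j))) (at x)"
    by (auto intro!: bounded_linear_imp_has_derivative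
        bounded_linear_compose[OF bounded_linear_of_real bounded_linear_vec_nth])
  have pd: "partial_dir i (\<lambda>x. complex_of_real (x $ j) * f x) x
      = complex_of_real (x $ j) * partial_dir i f x + (if i = j then f x else 0)"
    using partial_dir_has_derivative[OF has_derivative_mult[OF nth f'], of i]
    by (auto simp: partial_dir_has_derivative[OF f'] axis_def)
  have "complex_of_real (w \<alpha> * \<alpha> $ i) * (complex_of_real (x $ j) * f x
        - complex_of_real (refl_vec \<alpha> x $ j) * f (refl_vec \<alpha> x)) / complex_of_real (\<alpha> \<bullet> x)
      = complex_of_real (x $ j) * (complex_of_real (w \<alpha> * \<alpha> $ i) * (f x - f (refl_vec \<alpha> x)) / complex_of_real (\<alpha> \<bullet> x))
      + complex_of_real (w \<alpha> * (2 * \<alpha> $ i / (\<alpha> \<bullet> \<alpha>))) * (complex_of_real (\<alpha> $ j) * f (refl_vec \<alpha> x))"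
    if "\<alpha> \<in> R" for \<alpha>
  proof -
    have a: "complex_of_real (\<alpha> \<bullet> x) \<noteq> 0" using x that by (auto simp: regular_def)
    have "refl_vec \<alpha> x $ j = x $ j - 2 * (\<alpha> \<bullet> x) / (\<alpha> \<bullet> \<alpha>) * \<alpha> $ j"
      by (simp add: refl_vec_def inner_commute)
    then have "complex_of_real (refl_vec \<alpha> x $ j) = complex_of_real (x $ j)
        - 2 * complex_of_real (\<alpha> \<bullet> x) / complex_of_real (\<alpha> \<bullet> \<alpha>) * complex_of_real (\<alpha> $ j)"
      by simp
    with a show ?thesis by (simp add: divide_simps) (simp add: algebra_simps)
  qed
  then have "(\<Sum>\<alpha>\<in>R. complex_of_real (w \<alpha> * \<alpha> $ i) * (complex_of_real (x $ j) * f x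
        - complex_of_real (refl_vec \<alpha> x $ j) * f (refl_vec \<alpha> x)) / complex_of_real (\<alpha> \<bullet> x))
     = complex_of_real (x $ j) * (\<Sum>\<alpha>\<in>R. complex_of_real (w \<alpha> * \<alpha> $ i) * (f x - f (refl_vec \<alpha> x)) / complex_of_real (\<alpha> \<bullet> x))
      + (\<Sum>\<alpha>\<in>R. complex_of_real (w \<alpha> * (2 * \<alpha> $ i / (\<alpha> \<bullet> \<alpha>))) * (complex_of_real (\<alpha> $ j) * f (refl_vec \<alpha> x)))"
    by (simp only: sum.distrib sum_distrib_left cong: sum.cong)
  then show ?thesis
    unfolding Tk_def pd by (simp add: algebra_simps)
qed

text \<open>Contracting with x turns the components of \<alpha> into \<alpha> \<bullet> x, which
  cancels the denominator; the derivative part is the classical Euler identity.\<close>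

lemma Tk_euler:
  assumes f: "f \<in> hfun n" and x: "regular x"
  shows "(\<Sum>j\<in>UNIV. complex_of_real (x $ j) * Tk j f x) = Lop n f x"
proof -
  have "(\<Sum>j\<in>UNIV. complex_of_real (x $ j) * (\<Sum>\<alpha>\<in>R. complex_of_real (w \<alpha> * \<alpha> $ j) * (f x - f (refl_vec \<alpha> x)) / complex_of_real (\<alpha> \<bullet> x)))
     = (\<Sum>\<alpha>\<in>R. complex_of_real (w \<alpha>) * (\<Sum>j\<in>UNIV. complex_of_real (\<alpha> $ j * x $ j)) * (f x - f (refl_vec \<alpha> x)) / complex_of_real (\<alpha> \<bullet> x))"
    unfolding sum_distrib_left sum_distrib_right sum_divide_distrib
    by (subst sum.swap) (simp add: algebra_simps)
  also have "\<dots> = (\<Sum>\<alpha>\<in>R. complex_of_real (w \<alpha>) * (f x - f (refl_vec \<alpha> x)))"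
  proof (intro sum.cong refl)
    fix \<alpha> assume "\<alpha> \<in> R"
    then have "complex_of_real (\<alpha> \<bullet> x) \<noteq> 0" using x by (auto simp: regular_def)
    moreover have "(\<Sum>j\<in>UNIV. complex_of_real (\<alpha> $ j * x $ j)) = complex_of_real (\<alpha> \<bullet> x)"
      by (simp add: inner_vec_def)
    ultimately show "complex_of_real (w \<alpha>) * (\<Sum>j\<in>UNIV. complex_of_real (\<alpha> $ j * x $ j)) * (f x - f (refl_vec \<alpha> x)) / complex_of_real (\<alpha> \<bullet> x)
       = complex_of_real (w \<alpha>) * (f x - f (refl_vec \<alpha> x))"
      by (simp del: of_real_mult)
  qed
  finally show ?thesis
    using hfun_euler[OF f, of x]
    by (simp add: Tk_def Lop_def distrib_left sum.distrib right_diff_distrib sum_subtractf gam_def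
        distrib_right sum_distrib_right)
qed

section \<open>Recursive solution of Euler's identity and commutation with the Dunkl
  operators\<close>

definition Linv :: "nat \<Rightarrow> (real^'n \<Rightarrow> complex) \<Rightarrow> real^'n \<Rightarrow> complex" where
  "Linv n g = (SOME f. f \<in> hfun n \<and> Lop n f = g)"

lemma Linv: "0 < n \<Longrightarrow> g \<in> hfun n \<Longrightarrow> Linv n g \<in> hfun n \<and> Lop n (Linv n g) = g"
proof -
  assume "0 < n" "g \<in> hfun n"
  then obtain f where "f \<in> hfun n \<and> Lop n f = g" using Lop_surj by blast
  then show "Linv n g \<in> hfun n \<and> Lop n (Linv n g) = g"
    unfolding Linv_def by (rule someI[of "\<lambda>f. f \<in> hfun n \<and> Lop n f = g"])
qed

text \<open>\<open>U n c\<close> is the intertwining operator applied to the part of degree n of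
  \<open>c\<close>, as a function. Nothing is assumed on the support of \<open>c\<close>: it is
  later used for the coefficients of an exponential.\<close>

primrec U :: "nat \<Rightarrow> 'n mpoly_c \<Rightarrow> real^'n \<Rightarrow> complex" where
  "U 0 c = (\<lambda>x. c (\<lambda>_. 0))"
| "U (Suc n) c = Linv (Suc n) (\<lambda>x. \<Sum>j\<in>UNIV. complex_of_real (x $ j) * U n (pdc j c) x)"

declare U.simps(2) [simp del]

lemma U_hfun: "U n c \<in> hfun n"
  and Lop_U: "Lop (Suc n) (U (Suc n) c) x = (\<Sum>j\<in>UNIV. complex_of_real (x $ j) * U n (pdc j c) x)"
proof -
  have step: "(\<And>c. U n c \<in> hfun n) \<Longrightarrow>
     (\<lambda>x. \<Sum>j\<in>UNIV. complex_of_real (x $ j) * U n (pdc j c) x) \<in> hfun (Suc n)" for n c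
    unfolding plus_1_eq_Suc[symmetric] by (intro hfun_sum hfun_mult[OF hfun_coord])
  have U: "U n c \<in> hfun n" for n c
  proof (induction n arbitrary: c)
    case (Suc n)
    show ?case using Linv[OF _ step[OF Suc]] by (simp add: U.simps(2))
  qed (simp add: hfun_const)
  then show "U n c \<in> hfun n" .
  show "Lop (Suc n) (U (Suc n) c) x = (\<Sum>j\<in>UNIV. complex_of_real (x $ j) * U n (pdc j c) x)"
    using Linv[OF _ step[OF U]] by (simp add: U.simps(2))
qed

lemma U_unique:
  assumes "\<And>y. y \<in> orb x \<Longrightarrow> Lop (Suc n) f y = (\<Sum>j\<in>UNIV. complex_of_real (y $ j) * U n (pdc j c) y)"
  shows "f x = U (Suc n) c x"
  by (rule Lop_inject[of "Suc n"]) (simp_all add: assms Lop_U)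

lemma U_lincomb: "U n (\<lambda>a. s * c a + t * d a) x = s * U n c x + t * U n d x"
proof (induction n arbitrary: c d x)
  case (Suc n)
  show ?case
    by (rule U_unique[symmetric])
      (simp only: Lop_lincomb Lop_U pdc_lincomb Suc, simp add: sum_distrib_left sum.distrib algebra_simps)
qed simp

lemma U_cong: "(\<And>a. a \<in> midx n \<Longrightarrow> c a = d a) \<Longrightarrow> U n c x = U n d x"
proof (induction n arbitrary: c d x)
  case (Suc n)
  have "U n (pdc j c) y = U n (pdc j d) y" for j y
    by (rule Suc.IH) (simp add: pdc_inc Suc.prems midx_def)
  then show ?case by (intro U_unique) (simp add: Lop_U)
qed (simp add: midx_0)

lemma U_zero: "U n (\<lambda>_. 0) x = 0"
  using U_lincomb[of n 0 "\<lambda>_. 0" 0 "\<lambda>_. 0"] by simp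

lemma U_sum: "finite A \<Longrightarrow> U n (\<lambda>b. \<Sum>a\<in>A. s a * c a b) x = (\<Sum>a\<in>A. s a * U n (c a) x)"
proof (induction A rule: finite_induct)
  case (insert a A)
  then show ?case using U_lincomb[of n "s a" "c a" 1 "\<lambda>b. \<Sum>a\<in>A. s a * c a b" x] by simp
qed (simp add: U_zero)

definition unit_at :: "('n \<Rightarrow> nat) \<Rightarrow> 'n mpoly_c" where
  "unit_at a b = (if b = a then 1 else 0)"

lemma U_expand: "U n c x = (\<Sum>a\<in>midx n. c a * U n (unit_at a) x)"
  by (subst U_sum[symmetric])
    (auto intro!: U_cong simp: unit_at_def if_distrib[of "\<lambda>t. _ * t"] cong: if_cong)

text \<open>T_i is applied to the Euler equation \<open>L\<close> in two ways: on the left by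
  equivariance, on the right by the product rule, where \<open>sym\<close> allows Euler's identity
  to be used for \<open>qs i\<close>. The results have the same shape, with T_i q in one and
  \<open>qs i\<close> in the other, so the difference solves a homogeneous equation to which the
  maximum principle applies.\<close>

lemma T_U_aux:
  fixes q :: "real^'n \<Rightarrow> complex" and qs :: "'n \<Rightarrow> real^'n \<Rightarrow> complex"
  assumes q: "q \<in> hfun (Suc n)" and qs: "\<And>j. qs j \<in> hfun n"
    and L: "\<And>y. Lop (Suc n) q y = (\<Sum>j\<in>UNIV. complex_of_real (y $ j) * qs j y)"
    and sym: "\<And>i j y. regular y \<Longrightarrow> Tk i (qs j) y = Tk j (qs i) y"
    and x: "regular x"
  shows "Tk i q x = qs i x"
proof -
  define r where "r i y = Tk i q y - qs i y" for i y
  let ?g = "complex_of_real (real (Suc n) + gam)"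
  have c: "complex_of_real (refl_vec \<alpha> (axis i 1) $ k)
      = (if i = k then 1 else 0) - complex_of_real (2 * \<alpha> $ i / (\<alpha> \<bullet> \<alpha>)) * complex_of_real (\<alpha> $ k)" for \<alpha> i k
  proof -
    have "axis i 1 \<bullet> \<alpha> = \<alpha> $ i" by (simp add: inner_axis')
    then have "refl_vec \<alpha> (axis i 1) $ k = axis i 1 $ k - 2 * \<alpha> $ i / (\<alpha> \<bullet> \<alpha>) * \<alpha> $ k"
      by (simp add: refl_vec_def)
    then show ?thesis by (auto simp: axis_def)
  qed
  \<comment> \<open>By self-adjointness of the reflection this is component i of the reflection
    applied to the vector v.\<close>
  have csum: "(\<Sum>k\<in>UNIV. complex_of_real (refl_vec \<alpha> (axis i 1) $ k) * v k)
      = v i - complex_of_real (2 * \<alpha> $ i / (\<alpha> \<bullet> \<alpha>)) * (\<Sum>k\<in>UNIV. complex_of_real (\<alpha> $ k) * v k)" for \<alpha> i v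
    unfolding c by (simp add: left_diff_distrib sum_subtractf sum_distrib_left if_distrib[of "\<lambda>t. t * _"]
        mult.assoc cong: if_cong)
  have eq: "?g * r i y = (\<Sum>\<alpha>\<in>R. complex_of_real (w \<alpha>) * (r i (refl_vec \<alpha> y)
      - complex_of_real (2 * \<alpha> $ i / (\<alpha> \<bullet> \<alpha>)) * (\<Sum>k\<in>UNIV. complex_of_real (\<alpha> $ k) * r k (refl_vec \<alpha> y))))"
    if y: "regular y" for i y
  proof -
    have dq: "q differentiable (at z)" for z by (rule hfun_differentiable_at[OF q])
    have dqs: "qs j differentiable (at z)" for j z by (rule hfun_differentiable_at[OF qs])
    have dr: "(\<lambda>x. q (refl_vec \<alpha> x)) differentiable (at z)" for \<alpha> z
      by (rule hfun_differentiable_at[OF hfun_compose_linear[OF q linear_refl_vec]])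
    have dc: "(\<lambda>x. complex_of_real (x $ j) * qs j x) differentiable (at z)" for j z
      by (rule hfun_differentiable_at[OF hfun_mult[OF hfun_coord qs]])
    have Lq: "Lop (Suc n) q = (\<lambda>y. ?g * q y + (\<Sum>\<alpha>\<in>R. - complex_of_real (w \<alpha>) * q (refl_vec \<alpha> y)))"
      by (auto simp: Lop_def sum_negf)
    have "Tk i (Lop (Suc n) q) y = ?g * Tk i q y
        - (\<Sum>\<alpha>\<in>R. complex_of_real (w \<alpha>) * Tk i (\<lambda>x. q (refl_vec \<alpha> x)) y)"
      unfolding Lq
      by (subst Tk_add, intro differentiable_mult differentiable_const dq,
          intro differentiable_sum differentiable_mult differentiable_const dr ballI finite_R,
          subst Tk_sum, intro differentiable_mult differentiable_const dr, rule finite_R)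
        (simp add: Tk_scale dq dr sum_negf Tk_scale[of _ _ _ "- _", simplified])
    also have "\<dots> = ?g * Tk i q y - (\<Sum>\<alpha>\<in>R. complex_of_real (w \<alpha>) * (Tk i q (refl_vec \<alpha> y)
       - complex_of_real (2 * \<alpha> $ i / (\<alpha> \<bullet> \<alpha>)) * (\<Sum>k\<in>UNIV. complex_of_real (\<alpha> $ k) * Tk k q (refl_vec \<alpha> y))))"
      by (simp only: Tk_refl dq csum cong: sum.cong)
    finally have 1: "Tk i (Lop (Suc n) q) y = \<dots>" .
    have "Tk i (Lop (Suc n) q) y = (\<Sum>j\<in>UNIV. Tk i (\<lambda>y. complex_of_real (y $ j) * qs j y) y)"
      using Tk_sum[of UNIV "\<lambda>j y. complex_of_real (y $ j) * qs j y" y i] dc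
      unfolding L[abs_def] by simp
    also have "\<dots> = (\<Sum>j\<in>UNIV. complex_of_real (y $ j) * Tk j (qs i) y + (if i = j then qs j y else 0)
      + (\<Sum>\<alpha>\<in>R. complex_of_real (w \<alpha> * (2 * \<alpha> $ i / (\<alpha> \<bullet> \<alpha>))) * (complex_of_real (\<alpha> $ j) * qs j (refl_vec \<alpha> y))))"
      by (simp only: Tk_mult_coord[OF dqs y] sym[OF y, of i])
    also have "\<dots> = Lop n (qs i) y + qs i y
      + (\<Sum>\<alpha>\<in>R. complex_of_real (w \<alpha> * (2 * \<alpha> $ i / (\<alpha> \<bullet> \<alpha>))) * (\<Sum>j\<in>UNIV. complex_of_real (\<alpha> $ j) * qs j (refl_vec \<alpha> y)))"
      unfolding sum.distrib Tk_euler[OF qs y] sum_distrib_left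
      by (subst sum.swap) simp
    \<comment> \<open>The diagonal term \<open>qs i y\<close> of the product rule raises n +
      \<gamma> to the factor of degree \<open>Suc n\<close> that stands on the left side.\<close>
    also have "\<dots> = ?g * qs i y - (\<Sum>\<alpha>\<in>R. complex_of_real (w \<alpha>) * (qs i (refl_vec \<alpha> y)
       - complex_of_real (2 * \<alpha> $ i / (\<alpha> \<bullet> \<alpha>)) * (\<Sum>k\<in>UNIV. complex_of_real (\<alpha> $ k) * qs k (refl_vec \<alpha> y))))"
      by (simp add: Lop_def right_diff_distrib sum_subtractf distrib_right mult.assoc)
    finally have 2: "Tk i (Lop (Suc n) q) y = \<dots>" .
    show ?thesis
      using 1[unfolded 2] unfolding r_def
      by (simp add: right_diff_distrib sum_subtractf sum.distrib algebra_simps)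
  qed
  \<comment> \<open>Reflections act on real vectors, so real and imaginary parts of the residual are
    treated separately.\<close>
  have part: "\<rho> (r i x) = 0" if \<rho>: "bounded_linear \<rho>" for \<rho> :: "complex \<Rightarrow> real"
  proof -
    interpret \<rho>: bounded_linear \<rho> by fact
    have \<rho>m: "\<rho> (complex_of_real t * u) = t * \<rho> u" for t u
      using \<rho>.scaleR[of t u] by (simp add: scaleR_conv_of_real)
    define f where "f y = (\<chi> i. \<rho> (r i y))" for y
    have "norm (f x) \<le> 0 / real (Suc n)"
    \<comment> \<open>The outer reflection in \<open>h\<close> acts on the values and preserves
      their norm; the equation is homogeneous, hence B = 0.\<close>
    proof (rule max_principle[where f = f and s = "real (Suc n)" and B = 0 and h = "\<lambda>\<alpha> y. refl_vec \<alpha> (f (refl_vec \<alpha> y))"])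
      fix y assume "y \<in> orb x"
      then have y: "regular y" using x orb_regular by blast
      have "(real (Suc n) + gam) *\<^sub>R f y = (\<Sum>\<alpha>\<in>R. w \<alpha> *\<^sub>R refl_vec \<alpha> (f (refl_vec \<alpha> y)))"
      proof (rule vec_eq_iff[THEN iffD2], rule allI)
        fix i
        have "((real (Suc n) + gam) *\<^sub>R f y) $ i = \<rho> (?g * r i y)"
          by (simp only: \<rho>m) (simp add: f_def)
        also have "\<dots> = (\<Sum>\<alpha>\<in>R. w \<alpha> * (\<rho> (r i (refl_vec \<alpha> y))
            - 2 * \<alpha> $ i / (\<alpha> \<bullet> \<alpha>) * (\<Sum>k\<in>UNIV. \<alpha> $ k * \<rho> (r k (refl_vec \<alpha> y)))))"
          unfolding eq[OF y] by (simp only: \<rho>.sum \<rho>m \<rho>.diff)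
        also have "\<dots> = (\<Sum>\<alpha>\<in>R. w \<alpha> *\<^sub>R refl_vec \<alpha> (f (refl_vec \<alpha> y))) $ i"
          by (simp only: sum_component vector_scaleR_component refl_vec_nth) (simp add: f_def)
        finally show "((real (Suc n) + gam) *\<^sub>R f y) $ i
            = (\<Sum>\<alpha>\<in>R. w \<alpha> *\<^sub>R refl_vec \<alpha> (f (refl_vec \<alpha> y))) $ i" .
      qed
      then show "norm ((real (Suc n) + gam) *\<^sub>R f y - (\<Sum>\<alpha>\<in>R. w \<alpha> *\<^sub>R refl_vec \<alpha> (f (refl_vec \<alpha> y)))) \<le> 0"
        by simp
    qed auto
    then have "f x = 0" by simp
    then have "f x $ i = 0" by simp
    then show ?thesis by (simp add: f_def)
  qed
  have "r i x = 0"
    using part[OF bounded_linear_Re] part[OF bounded_linear_Im] by (simp add: complex_eq_iff)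
  then show ?thesis by (simp add: r_def)
qed

text \<open>The symmetry hypothesis of \<open>T_U_aux\<close> is the induction hypothesis together
  with the commutation of ordinary partial derivatives.\<close>

lemma Tk_U:
  assumes "regular x"
  shows "Tk i (U (Suc n) c) x = U n (pdc i c) x"
  using assms
proof (induction n arbitrary: i c x)
  case 0
  show ?case
    by (rule T_U_aux[OF U_hfun U_hfun Lop_U _ 0]) simp
next
  case (Suc n)
  show ?case
    by (rule T_U_aux[OF U_hfun U_hfun Lop_U _ Suc.prems]) (simp add: Suc.IH pdc_commute)
qed

end

section \<open>The intertwining operator on coefficients: existence and uniqueness\<close>

lemma polysI_degree: "(\<And>a. c a \<noteq> 0 \<Longrightarrow> mdeg a \<le> N) \<Longrightarrow> c \<in> polys"
  by (rule polysI[of "\<Union>n\<le>N. midx n"]) (simp, simp add: midx_def)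

context dunkl begin

definition cf :: "nat \<Rightarrow> 'n mpoly_c \<Rightarrow> 'n mpoly_c" where
  "cf n c = coeffs_of (U n c)"

text \<open>Degrees do not mix, so each coefficient is read off from the image of the homogeneous
  part of its own degree.\<close>

definition Vop :: "'n mpoly_c \<Rightarrow> 'n mpoly_c" where
  "Vop c a = cf (mdeg a) c a"

lemma cf_homog: "homog n (cf n c)"
  and peval_cf: "peval (cf n c) (cvec x) = U n c x"
proof -
  obtain d where d: "homog n d" "U n c = (\<lambda>x. peval d (cvec x))"
    using U_hfun by (auto simp: hfun_iff)
  then have "cf n c = d"
    unfolding cf_def by (intro coeffs_of_eq homog_polys) auto
  with d show "homog n (cf n c)" "peval (cf n c) (cvec x) = U n c x" by auto
qed

lemma cf_polys: "cf n c \<in> polys"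
  using cf_homog by (rule homog_polys)

lemma cf_lincomb: "cf n (\<lambda>a. s * c a + t * d a) = (\<lambda>a. s * cf n c a + t * cf n d a)"
  by (intro peval_inject polys_lincomb cf_polys) (simp add: peval_lincomb cf_polys peval_cf U_lincomb)

lemma cf_cong: "(\<And>a. a \<in> midx n \<Longrightarrow> c a = d a) \<Longrightarrow> cf n c = cf n d"
  by (intro peval_inject cf_polys) (simp only: peval_cf, rule U_cong, simp)

lemma cf_zero: "cf n (\<lambda>_. 0) = (\<lambda>_. 0)"
  by (intro peval_eq_0_imp cf_polys) (simp add: peval_cf U_zero)

lemma cf_eq_0: "(\<And>a. a \<in> midx n \<Longrightarrow> c a = 0) \<Longrightarrow> cf n c = (\<lambda>_. 0)"
  using cf_cong[of n c "\<lambda>_. 0"] cf_zero by simp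

lemma Vop_degree:
  assumes "\<And>a. c a \<noteq> 0 \<Longrightarrow> mdeg a \<in> D" "Vop c a \<noteq> 0" shows "mdeg a \<in> D"
proof (rule ccontr)
  assume "mdeg a \<notin> D"
  then have "cf (mdeg a) c = (\<lambda>_. 0)" 
    by (intro cf_eq_0) (metis assms(1) mem_Collect_eq midx_def)
  then show False using assms(2) by (simp add: Vop_def)
qed

lemma Vop_polys:
  assumes "c \<in> polys" shows "Vop c \<in> polys"
proof -
  obtain N where "\<And>a. c a \<noteq> 0 \<Longrightarrow> mdeg a \<le> N" using polys_bounded_degree[OF assms] by blast
  then have "\<And>a. Vop c a \<noteq> 0 \<Longrightarrow> mdeg a \<in> {..N}" using Vop_degree[of c "{..N}"] by blast
  then show ?thesis by (intro polysI_degree[of _ N]) simp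
qed

lemma Vop_homog: "homog n c \<Longrightarrow> homog n (Vop c)"
  using Vop_degree[of c "{n}"] by (auto simp: homog_midx midx_def)

lemma peval_Vop:
  assumes "\<And>a. c a \<noteq> 0 \<Longrightarrow> mdeg a \<le> N"
  shows "peval (Vop c) (cvec x) = (\<Sum>n\<le>N. U n c x)"
proof -
  have "\<And>a. Vop c a \<noteq> 0 \<Longrightarrow> mdeg a \<in> {..N}" using assms Vop_degree[of c "{..N}"] by blast
  then have "peval (Vop c) (cvec x) = (\<Sum>a\<in>(\<Union>n\<le>N. midx n). Vop c a * mon a (cvec x))"
    by (intro peval_eq_sum) (simp, simp add: midx_def)
  also have "\<dots> = (\<Sum>n\<le>N. \<Sum>a\<in>midx n. Vop c a * mon a (cvec x))"
    by (intro sum.UNION_disjoint) (simp, simp, auto simp: midx_def)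
  also have "\<dots> = (\<Sum>n\<le>N. \<Sum>a\<in>midx n. cf n c a * mon a (cvec x))"
    by (intro sum.cong) (auto simp: midx_def Vop_def)
  also have "\<dots> = (\<Sum>n\<le>N. U n c x)"
    by (simp add: peval_homog[OF cf_homog, symmetric] peval_cf)
  finally show ?thesis .
qed

lemma peval_Vop_homog:
  assumes "homog n c"
  shows "peval (Vop c) (cvec x) = U n c x"
proof -
  have z: "U m c x = 0" if "m \<noteq> n" for m
    using U_cong[of m c "\<lambda>_. 0"] assms that by (force simp: U_zero homog_midx midx_def)
  have "peval (Vop c) (cvec x) = (\<Sum>m\<le>n. U m c x)"
    using assms by (intro peval_Vop) (auto simp: homog_midx midx_def)
  also have "\<dots> = (\<Sum>m\<le>n. if m = n then U n c x else 0)"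
    by (intro sum.cong) (auto simp: z)
  finally show ?thesis by simp
qed

lemma Vop_lincomb: "Vop (\<lambda>a. s * c a + t * d a) = (\<lambda>a. s * Vop c a + t * Vop d a)"
  by (auto simp: Vop_def cf_lincomb)

lemma homog_poly_one: "homog 0 (poly_one :: 'n mpoly_c)"
  by (auto simp: poly_one_def homog_midx midx_0)

lemma Vop_one: "Vop poly_one = poly_one"
proof (rule peval_inject)
  show "Vop poly_one \<in> polys" "(poly_one :: 'n mpoly_c) \<in> polys"
    using homog_poly_one homog_polys Vop_polys by blast+
  show "peval (Vop poly_one) (cvec x) = peval poly_one (cvec x)" for x
    unfolding peval_Vop_homog[OF homog_poly_one] peval_homog[OF homog_poly_one]
    by (simp add: midx_0)
qed

text \<open>Applying Dunkl operators to a vanishing image gives vanishing images of all partial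
  derivatives, first at regular points and then by continuity. Descent to degree 0 leaves the
  coefficient itself, up to a nonzero factor.\<close>

lemma U_eq_0_imp:
  assumes "\<And>x. U n c x = 0" "a \<in> midx n"
  shows "c a = 0"
  using assms
proof (induction n arbitrary: c a)
  case (Suc n)
  then obtain j where j: "a j \<noteq> 0"
    by (metis (mono_tags) mdeg_eq_0_iff mem_Collect_eq midx_def nat.distinct(1))
  have z: "U (Suc n) c = (\<lambda>_. 0)" using Suc.prems(1) by auto
  have "U n (pdc j c) x = 0" for x
  proof (rule regular_dense)
    show "isCont (U n (pdc j c)) x" by (rule hfun_continuous[OF U_hfun])
    show "U n (pdc j c) y = 0" if "regular y" for y
      using Tk_U[OF that, of j n c] by (simp add: z)
  qed
  moreover have "dec j a \<in> midx n"
    using mdeg_inc[of j "dec j a"] Suc.prems(2) inc_dec[of a j] j by (simp add: midx_def)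
  ultimately have "pdc j c (dec j a) = 0" using Suc.IH[of "pdc j c" "dec j a"] by simp
  then have "of_nat (Suc (dec j a j)) * c (inc j (dec j a)) = 0" by (simp only: pdc_inc)
  then have "c (inc j (dec j a)) = 0" by (simp only: mult_eq_0_iff of_nat_eq_0_iff) simp
  then show ?case using inc_dec[of a j] j by metis
qed (simp add: midx_0)

lemma cf_surj:
  assumes "homog n d"
  shows "\<exists>c. homog n c \<and> cf n c = d"
proof -
  have S: "{c :: 'n mpoly_c. homog n c} = {f. \<exists>c. f = (\<lambda>x. \<Sum>a\<in>midx n. c a * unit_at a x)}"
  proof (intro equalityI subsetI)
    fix f :: "'n mpoly_c" assume "f \<in> {c. homog n c}"
    then have "f = (\<lambda>x. \<Sum>a\<in>midx n. f a * unit_at a x)"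
      by (intro ext) (auto simp: homog_midx unit_at_def if_distrib[of "\<lambda>t. _ * t"] cong: if_cong)
    then show "f \<in> {f. \<exists>c. f = (\<lambda>x. \<Sum>a\<in>midx n. c a * unit_at a x)}" by blast
  next
    fix f :: "'n mpoly_c" assume "f \<in> {f. \<exists>c. f = (\<lambda>x. \<Sum>a\<in>midx n. c a * unit_at a x)}"
    then show "f \<in> {c. homog n c}"
      by (auto simp: homog_midx unit_at_def if_distrib[of "\<lambda>t. _ * t"] split: if_splits cong: if_cong)
  qed
  have "\<exists>f\<in>{c. homog n c}. cf n f = d"
  proof (rule linear_inj_imp_surj_fun[OF cf_lincomb finite_midx S])
    fix f assume f: "f \<in> {c. homog n c}" and z: "cf n f = (\<lambda>_. 0)"
    have "U n f x = 0" for x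
      using peval_cf[of n f x] unfolding z by (simp add: peval_def)
    then have "f a = 0" if "a \<in> midx n" for a using U_eq_0_imp that by blast
    with f show "f = (\<lambda>_. 0)" by (auto simp: homog_midx)
  qed (use assms cf_homog in auto)
  then show ?thesis by auto
qed

lemma Vop_bij: "bij_betw Vop polys polys"
proof (rule bij_betwI')
  fix c d :: "'n mpoly_c" assume c: "c \<in> polys" and d: "d \<in> polys"
  show "Vop c = Vop d \<longleftrightarrow> c = d"
  proof
    assume eq: "Vop c = Vop d"
    define e where "e = (\<lambda>a. 1 * c a + (-1) * d a)"
    have Ve: "Vop e = (\<lambda>_. 0)" unfolding e_def Vop_lincomb using eq by simp
    have "e a = 0" for a
    proof (rule U_eq_0_imp[of "mdeg a" e])
      have "cf (mdeg a) e b = 0" for b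
        using fun_cong[OF Ve, of b] cf_homog[of "mdeg a" e]
        by (cases "mdeg b = mdeg a") (auto simp: Vop_def homog_midx midx_def)
      then have "cf (mdeg a) e = (\<lambda>_. 0)" by auto
      then show "U (mdeg a) e x = 0" for x
        using peval_cf[of "mdeg a" e x] by (simp add: peval_def)
    qed (simp add: midx_def)
    then show "c = d" by (auto simp: e_def fun_eq_iff)
  qed simp
next
  fix d :: "'n mpoly_c" assume d: "d \<in> polys"
  obtain N where N: "\<And>a. d a \<noteq> 0 \<Longrightarrow> mdeg a \<le> N" using polys_bounded_degree[OF d] by blast
  define dn where "dn n a = (if mdeg a = n then d a else 0)" for n a
  have "homog n (dn n)" for n by (auto simp: dn_def homog_midx midx_def)
  then have "\<forall>n. \<exists>c. homog n c \<and> cf n c = dn n" using cf_surj by blast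
  then obtain g where g: "\<And>n. homog n (g n)" "\<And>n. cf n (g n) = dn n" by metis
  \<comment> \<open>The preimages of the homogeneous parts are glued; the cut-off at N makes the
    support finite.\<close>
  define c where "c a = (if mdeg a \<le> N then g (mdeg a) a else 0)" for a
  have "c \<in> polys" by (rule polysI_degree[of _ N]) (simp add: c_def split: if_splits)
  moreover have "d a = Vop c a" for a
  proof (cases "mdeg a \<le> N")
    case True
    then have "cf (mdeg a) c = cf (mdeg a) (g (mdeg a))"
      by (intro cf_cong) (auto simp: c_def midx_def)
    then show ?thesis by (simp add: Vop_def g dn_def)
  next
    case False
    then have "cf (mdeg a) c = (\<lambda>_. 0)" by (intro cf_eq_0) (auto simp: c_def midx_def)
    then show ?thesis using False N by (auto simp: Vop_def)
  qed
  ultimately show "\<exists>c\<in>polys. d = Vop c" by blast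
qed (rule Vop_polys)

lemma Tk_Vop:
  assumes c: "c \<in> polys" and x: "regular x"
  shows "Tk j (\<lambda>y. peval (Vop c) (cvec y)) x = peval (Vop (pdc j c)) (cvec x)"
proof -
  obtain N where N: "\<And>a. c a \<noteq> 0 \<Longrightarrow> mdeg a \<le> N" using polys_bounded_degree[OF c] by blast
  \<comment> \<open>The bound \<open>Suc N\<close> instead of N is chosen so that the shift of
    degree by the Dunkl operator leaves exactly the degrees up to N.\<close>
  have "Tk j (\<lambda>y. peval (Vop c) (cvec y)) x = Tk j (\<lambda>y. \<Sum>n\<le>Suc N. U n c y) x"
    by (subst peval_Vop[of c "Suc N"]) (simp_all add: N le_SucI)
  also have "\<dots> = (\<Sum>n\<le>Suc N. Tk j (U n c) x)"
    by (rule Tk_sum) (auto intro: hfun_differentiable_at U_hfun)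
  also have "\<dots> = (\<Sum>n\<le>N. U n (pdc j c) x)"
    by (subst sum.atMost_Suc_shift) (simp add: Tk_U[OF x])
  also have "\<dots> = peval (Vop (pdc j c)) (cvec x)"
    by (rule peval_Vop[symmetric]) (use N in \<open>fastforce simp: pdc_inc\<close>)
  finally show ?thesis .
qed

text \<open>Euler's identity for the Dunkl operators turns the intertwining relation into the
  equation that determines \<open>U\<close>: V c solves it at regular points, hence everywhere by
  continuity, and the solution is unique.\<close>

lemma intertwiner_eq_Vop:
  assumes lin: "\<And>c d s t. c \<in> polys \<Longrightarrow> d \<in> polys \<Longrightarrow>
      V (\<lambda>a. s * c a + t * d a) = (\<lambda>a. s * V c a + t * V d a)"
    and hom: "\<And>n c. c \<in> polys \<Longrightarrow> homog n c \<Longrightarrow> homog n (V c)"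
    and one: "V poly_one = poly_one"
    and T: "\<And>j c x. c \<in> polys \<Longrightarrow> regular x \<Longrightarrow>
      Tk j (\<lambda>y. peval (V c) (cvec y)) x = peval (V (pdc j c)) (cvec x)"
    and c: "c \<in> polys"
  shows "V c = Vop c"
proof -
  have hU: "peval (V c) (cvec x) = U n c x" if "homog n c" for n c x
    using that
  proof (induction n arbitrary: c x)
    case 0
    have "c = (\<lambda>a. c (\<lambda>_. 0) * poly_one a + 0 * poly_one a)"
      using 0 by (intro ext) (auto simp: homog_midx midx_0 poly_one_def)
    then have "V c = (\<lambda>a. c (\<lambda>_. 0) * poly_one a + 0 * poly_one a)"
      using lin[of poly_one poly_one "c (\<lambda>_. 0)" 0] homog_polys[OF homog_poly_one] one by metis
    then have "peval (V c) (cvec x) = peval (\<lambda>a. c (\<lambda>_. 0) * poly_one a + 0 * poly_one a) (cvec x)" by simp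
    also have "\<dots> = c (\<lambda>_. 0) * peval poly_one (cvec x)"
      by (subst peval_lincomb) (auto simp: homog_polys[OF homog_poly_one])
    also have "peval poly_one (cvec x) = 1"
      unfolding peval_homog[OF homog_poly_one] by (simp add: midx_0 poly_one_def)
    finally show ?case by simp
  next
    case (Suc n)
    let ?f = "\<lambda>x. peval (V c) (cvec x)"
    have f: "?f \<in> hfun (Suc n)" using hom[OF homog_polys[OF Suc.prems] Suc.prems] by (auto simp: hfun_iff)
    let ?h = "\<lambda>y. \<Sum>j\<in>UNIV. complex_of_real (y $ j) * U n (pdc j c) y"
    have "Lop (Suc n) ?f y - ?h y = 0" for y
    proof (rule regular_dense[where f = "\<lambda>y. Lop (Suc n) ?f y - ?h y"])
      have h: "?h = Lop (Suc n) (U (Suc n) c)" by (simp add: Lop_U fun_eq_iff)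
      have "isCont ?h y" unfolding h by (rule hfun_continuous[OF Lop_hfun[OF U_hfun]])
      then show "isCont (\<lambda>y. Lop (Suc n) ?f y - ?h y) y"
        by (intro continuous_diff hfun_continuous[OF Lop_hfun[OF f]])
      fix y assume y: "regular y"
      have "Lop (Suc n) ?f y = (\<Sum>j\<in>UNIV. complex_of_real (y $ j) * Tk j ?f y)"
        by (rule Tk_euler[OF f y, symmetric])
      then show "Lop (Suc n) ?f y - ?h y = 0"
        by (simp add: T[OF homog_polys[OF Suc.prems] y] Suc.IH[OF pdc_homog[OF Suc.prems]])
    qed
    then show ?case by (intro U_unique) simp
  qed
  have homV: "V c = Vop c" if "homog n c" for n c
  proof (rule peval_inject)
    show "V c \<in> polys" using homog_polys[OF hom[OF homog_polys[OF that] that]] .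
    show "Vop c \<in> polys" using homog_polys[OF Vop_homog[OF that]] .
  qed (simp add: hU[OF that] peval_Vop_homog[OF that])
  \<comment> \<open>Truncations by degree, built up one homogeneous part at a time, so that
    linearity in two terms is enough.\<close>
  define tr where "tr N a = (if mdeg a < N then c a else 0)" for N a
  define pt where "pt n a = (if mdeg a = n then c a else 0)" for n a
  have hpt: "homog n (pt n)" for n by (auto simp: pt_def homog_midx midx_def)
  have ptr: "tr N \<in> polys" for N
    by (rule polysI_degree[of _ N]) (simp add: tr_def split: if_splits)
  have "V (tr N) = Vop (tr N)" for N
  proof (induction N)
    case 0
    have "homog 0 (tr 0)" by (auto simp: tr_def homog_midx)
    then show ?case by (rule homV)
  next
    case (Suc N)
    have e: "tr (Suc N) = (\<lambda>a. 1 * tr N a + 1 * pt N a)" by (auto simp: tr_def pt_def less_Suc_eq)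
    show ?case
      unfolding e by (simp only: lin ptr homog_polys[OF hpt] Vop_lincomb Suc homV[OF hpt])
  qed
  moreover obtain N where "\<And>a. c a \<noteq> 0 \<Longrightarrow> mdeg a \<le> N" using polys_bounded_degree[OF c] by blast
  then have "tr (Suc N) = c" by (auto simp: tr_def fun_eq_iff less_Suc_eq_le)
  ultimately show ?thesis by metis
qed

subsection \<open>The Dunkl kernel: bounds and symmetry\<close>

text \<open>In Euler's equation for x^a the right side is sum_j a_j y_j V(x^(a - e_j)), by induction
  at most |a| times a power of the norm, which is constant on the orbit. The maximum principle
  divides by |a|.\<close>

lemma norm_U_unit_at: "a \<in> midx n \<Longrightarrow> norm (U n (unit_at a) x) \<le> norm x ^ n"
proof (induction n arbitrary: a x)
  case 0
  then show ?case by (simp add: midx_0 unit_at_def)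
next
  case (Suc n)
  have pd: "pdc j (unit_at a) = (\<lambda>b. of_nat (a j) * unit_at (dec j a) b + 0 * unit_at a b)" for j
  proof
    fix b
    have "inc j b = a \<longleftrightarrow> a j \<noteq> 0 \<and> b = dec j a"
      using inc_dec[of a j] by auto
    then show "pdc j (unit_at a) b = of_nat (a j) * unit_at (dec j a) b + 0 * unit_at a b"
      by (auto simp: pdc_inc unit_at_def dec_def)
  qed
  have bnd: "norm (complex_of_real (y $ j) * U n (pdc j (unit_at a)) y) \<le> real (a j) * norm x ^ Suc n"
    if y: "y \<in> orb x" for y j
  proof (cases "a j = 0")
    case False
    then have "dec j a \<in> midx n"
      using mdeg_inc[of j "dec j a"] inc_dec[of a j] Suc.prems by (simp add: midx_def)
    then have "norm (U n (unit_at (dec j a)) y) \<le> norm x ^ n"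
      using Suc.IH[of "dec j a" y] orb_norm[OF y] by simp
    moreover have "\<bar>y $ j\<bar> \<le> norm x" using component_le_norm_cart[of y j] orb_norm[OF y] by simp
    ultimately have "\<bar>y $ j\<bar> * norm (U n (unit_at (dec j a)) y) \<le> norm x * norm x ^ n"
      by (intro mult_mono) auto
    then have "real (a j) * (\<bar>y $ j\<bar> * norm (U n (unit_at (dec j a)) y)) \<le> real (a j) * (norm x * norm x ^ n)"
      by (intro mult_left_mono) auto
    then show ?thesis
      unfolding pd U_lincomb by (simp add: norm_mult mult_ac)
  qed (simp add: pd U_zero)
  have "norm (U (Suc n) (unit_at a) x) \<le> (real (Suc n) * norm x ^ Suc n) / real (Suc n)"
  proof (rule Lop_bound)
    fix y assume y: "y \<in> orb x"
    have "norm (Lop (Suc n) (U (Suc n) (unit_at a)) y) \<le> (\<Sum>j\<in>UNIV. real (a j) * norm x ^ Suc n)"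
      unfolding Lop_U by (rule sum_norm_le) (rule bnd[OF y])
    also have "\<dots> = real (Suc n) * norm x ^ Suc n"
      using Suc.prems unfolding sum_distrib_right[symmetric] by (simp add: midx_def mdeg_def flip: of_nat_sum)
    finally show "norm (Lop (Suc n) (U (Suc n) (unit_at a)) y) \<le> real (Suc n) * norm x ^ Suc n" .
  qed simp
  then show ?case by simp
qed

end

text \<open>The Taylor coefficients u^a / a! of the exponential of the pairing with u, in all
  degrees at once.\<close>

definition ecoef :: "complex^'n::finite \<Rightarrow> 'n mpoly_c" where
  "ecoef u a = (\<Prod>i\<in>UNIV. (u $ i) ^ a i / fact (a i))"

lemma ecoef_inc: "of_nat (Suc (a j)) * ecoef u (inc j a) = u $ j * ecoef u a"
proof -
  have "ecoef u (inc j a) = ((u $ j) ^ Suc (a j) / fact (Suc (a j))) * (\<Prod>i\<in>UNIV - {j}. (u $ i) ^ inc j a i / fact (inc j a i))"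
    unfolding ecoef_def by (subst prod.remove[of _ j]) auto
  also have "(\<Prod>i\<in>UNIV - {j}. (u $ i) ^ inc j a i / fact (inc j a i)) = (\<Prod>i\<in>UNIV - {j}. (u $ i) ^ a i / fact (a i))"
    by (rule prod.cong) (auto simp: inc_def)
  also have "of_nat (Suc (a j)) * ((u $ j) ^ Suc (a j) / fact (Suc (a j)) * \<dots>)
      = u $ j * ((u $ j) ^ a j / fact (a j) * \<dots>)"
    by (simp add: fact_Suc del: of_nat_Suc)
  also have "(u $ j) ^ a j / fact (a j) * (\<Prod>i\<in>UNIV - {j}. (u $ i) ^ a i / fact (a i)) = ecoef u a"
    unfolding ecoef_def by (subst (2) prod.remove[of _ j]) auto
  finally show ?thesis .
qed

lemma pdc_ecoef: "pdc j (ecoef u) = (\<lambda>a. u $ j * ecoef u a + 0 * ecoef u a)"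
  by (auto simp: pdc_inc ecoef_inc simp del: of_nat_Suc)

lemma ecoef_scale: "ecoef (s *s u) a = s ^ mdeg a * ecoef u a"
  by (simp add: ecoef_def power_mult_distrib prod.distrib mdeg_def power_sum flip: times_divide_eq_right)

lemma multinomial_ecoef:
  "(\<Sum>a\<in>midx n. ecoef u a * mon a x) = (\<Sum>i\<in>UNIV. x $ i * u $ i) ^ n / fact n"
proof (induction n)
  case 0
  then show ?case by (simp add: midx_0 ecoef_def)
next
  case (Suc n)
  have "of_nat (Suc n) * (\<Sum>a\<in>midx (Suc n). ecoef u a * mon a x)
      = (\<Sum>j\<in>UNIV. \<Sum>a\<in>midx n. (of_nat (Suc (a j)) * ecoef u (inc j a)) * mon (inc j a) x)"
    unfolding sum_midx_Suc by (simp add: mult.assoc)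
  also have "\<dots> = (\<Sum>j\<in>UNIV. x $ j * u $ j) * (\<Sum>a\<in>midx n. ecoef u a * mon a x)"
    unfolding ecoef_inc by (simp add: mon_inc sum_product mult_ac)
  also have "\<dots> = (\<Sum>i\<in>UNIV. x $ i * u $ i) ^ Suc n / fact n" by (simp add: Suc)
  finally show ?case by (simp add: field_simps del: of_nat_Suc)
qed

context dunkl begin

text \<open>The homogeneous part of degree n of the Dunkl kernel at real arguments.\<close>

definition En :: "nat \<Rightarrow> real^'n \<Rightarrow> real^'n \<Rightarrow> complex" where
  "En n x u = U n (ecoef (cvec u)) x"

lemma En_0: "En 0 x u = 1"
  by (simp add: En_def ecoef_def)

lemma Lop_En: "Lop (Suc n) (\<lambda>x. En (Suc n) x u) x = complex_of_real (x \<bullet> u) * En n x u"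
  unfolding En_def Lop_U[of n] pdc_ecoef U_lincomb
  by (simp add: inner_vec_def sum_distrib_right mult.assoc)

lemma En_refl: "\<beta> \<in> R \<Longrightarrow> En n (refl_vec \<beta> x) (refl_vec \<beta> u) = En n x u"
proof (induction n arbitrary: x u)
  case (Suc n)
  show ?case
  proof (rule Lop_inject[of "Suc n" x "\<lambda>x. En (Suc n) (refl_vec \<beta> x) (refl_vec \<beta> u)" "\<lambda>x. En (Suc n) x u"])
    fix y
    have "Lop (Suc n) (\<lambda>x. En (Suc n) (refl_vec \<beta> x) (refl_vec \<beta> u)) y
        = Lop (Suc n) (\<lambda>x. En (Suc n) x (refl_vec \<beta> u)) (refl_vec \<beta> y)"
      by (rule Lop_compose_refl[OF Suc.prems])
    then show "Lop (Suc n) (\<lambda>x. En (Suc n) (refl_vec \<beta> x) (refl_vec \<beta> u)) y = Lop (Suc n) (\<lambda>x. En (Suc n) x u) y"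
      by (simp add: Lop_En refl_vec_inner Suc)
  qed simp
qed (simp add: En_0)

text \<open>By \<open>En_refl\<close> a reflection can be moved from one argument to the other, so
  \<open>Lop\<close> gives the same result in either variable. By \<open>Lop_En\<close> that result
  is the symmetric factor x \<bullet> u times the part of one degree less.\<close>

lemma En_sym: "En n x u = En n u x"
proof (induction n arbitrary: x u)
  case (Suc n)
  show ?case
  proof (rule Lop_inject[of "Suc n" u "\<lambda>u. En (Suc n) x u" "\<lambda>u. En (Suc n) u x"])
    fix y
    have "En (Suc n) x (refl_vec \<alpha> y) = En (Suc n) (refl_vec \<alpha> x) y" if "\<alpha> \<in> R" for \<alpha>
      using En_refl[OF that, of "Suc n" "refl_vec \<alpha> x" y] by simp
    then have "Lop (Suc n) (\<lambda>u. En (Suc n) x u) y = Lop (Suc n) (\<lambda>x. En (Suc n) x y) x"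
      unfolding Lop_def by simp
    also have "\<dots> = Lop (Suc n) (\<lambda>u. En (Suc n) u x) y"
      unfolding Lop_En using Suc by (simp add: inner_commute)
    finally show "Lop (Suc n) (\<lambda>u. En (Suc n) x u) y = Lop (Suc n) (\<lambda>u. En (Suc n) u x) y" .
  qed simp
qed (simp add: En_0)

lemma En_expand: "En n x u = (\<Sum>a\<in>midx n. ecoef (cvec x) a * U n (unit_at a) u)"
  unfolding En_sym[of n x u] by (simp add: En_def U_expand[of n "ecoef (cvec x)"])

end

section \<open>The operators and the kernel of the statement in terms of the recursive
  solution\<close>

lemma sum_positive_subsystem:
  fixes h :: "real^'n::finite \<Rightarrow> complex"
  assumes "finite R" "\<And>\<alpha>. \<alpha> \<in> R \<Longrightarrow> - \<alpha> \<in> R" "\<And>\<alpha>. \<alpha> \<in> R \<Longrightarrow> \<alpha> \<bullet> b \<noteq> 0"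
    and "\<And>\<alpha>. \<alpha> \<in> R \<Longrightarrow> h (- \<alpha>) = h \<alpha>"
  shows "(\<Sum>\<alpha>\<in>R. h \<alpha>) = 2 * (\<Sum>\<alpha>\<in>{\<alpha>\<in>R. \<alpha> \<bullet> b > 0}. h \<alpha>)"
proof -
  have R: "R = {\<alpha>\<in>R. \<alpha> \<bullet> b > 0} \<union> {\<alpha>\<in>R. \<alpha> \<bullet> b < 0}"
    using assms(3) by (auto simp: not_less_iff_gr_or_eq)
  have "(\<Sum>\<alpha>\<in>{\<alpha>\<in>R. \<alpha> \<bullet> b < 0}. h \<alpha>) = (\<Sum>\<alpha>\<in>{\<alpha>\<in>R. \<alpha> \<bullet> b > 0}. h \<alpha>)"
    using assms by (intro sum.reindex_bij_witness[of _ uminus uminus]) auto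
  moreover have "(\<Sum>\<alpha>\<in>R. h \<alpha>) = (\<Sum>\<alpha>\<in>{\<alpha>\<in>R. \<alpha> \<bullet> b > 0}. h \<alpha>) + (\<Sum>\<alpha>\<in>{\<alpha>\<in>R. \<alpha> \<bullet> b < 0}. h \<alpha>)"
    by (subst R, rule sum.union_disjoint) (use assms(1) in auto)
  ultimately show ?thesis by simp
qed

lemma dunkl_kernel_coeffs:
  "coeffs_of (\<lambda>x. (\<Sum>i\<in>UNIV. complex_of_real (x $ i) * u $ i) ^ n / of_nat (fact n))
     = (\<lambda>a. if a \<in> midx n then ecoef u a else 0)" (is "_ = ?c")
proof (rule coeffs_of_eq)
  have h: "homog n ?c" by (auto simp: homog_midx)
  show "?c \<in> polys" using homog_polys[OF h] .
  show "(\<Sum>i\<in>UNIV. complex_of_real (x $ i) * u $ i) ^ n / of_nat (fact n) = peval ?c (cvec x)" for x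
    using multinomial_ecoef[where x = "cvec x" and u = u and n = n] unfolding peval_homog[OF h] by simp
qed

text \<open>The number \<open>v a\<close> is the value at \<open>z\<close> of the intertwining operator applied to the
  monomial with exponent \<open>a\<close>. Both kernels below have \<open>z\<close> in the second argument, whereas
  \<open>v\<close> has it in the first: this uses the symmetry of the Dunkl kernel.\<close>

theorem dunkl_kernel_series:
  fixes R Rp :: "(real^'n::finite) set" and z :: "real^'n"
  assumes R: "root_system R" and Rp: "positive_subsystem R Rp" and \<kappa>: "multiplicity R \<kappa>"
  obtains v :: "('n \<Rightarrow> nat) \<Rightarrow> complex"
  where "\<And>a. norm (v a) \<le> norm z ^ mdeg a"
    and "\<And>y. dunkl_kernel R Rp \<kappa> (\<chi> i. \<i> * complex_of_real (y $ i)) (cvec z)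
      = (\<Sum>n. \<Sum>a\<in>midx n. v a * ecoef (\<i> *s cvec y) a)"
    and "\<And>x. dunkl_kernel R Rp \<kappa> (cvec x) (cvec (- z))
      = (\<Sum>n. \<Sum>a\<in>midx n. v a * ecoef (- cvec x) a)"
    and "\<And>c p. c \<in> polys \<Longrightarrow> (\<And>x. p x = peval c (cvec x)) \<Longrightarrow>
      Vfun R Rp \<kappa> p z = (\<Sum>a | c a \<noteq> 0. c a * v a)"
proof -
  obtain b where b: "\<And>\<alpha>. \<alpha> \<in> R \<Longrightarrow> \<alpha> \<bullet> b \<noteq> 0" and Rp_eq: "Rp = {\<alpha>\<in>R. \<alpha> \<bullet> b > 0}"
    using Rp by (auto simp: positive_subsystem_def)
  have kinv: "\<kappa> (refl_vec \<alpha> \<beta>) = \<kappa> \<beta>" if "\<alpha> \<in> R" "\<beta> \<in> R" for \<alpha> \<beta>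
  proof -
    have "refl_vec \<alpha> \<circ> id \<in> refl_group R" using that by (intro refl_group.intros)
    then show ?thesis using \<kappa> that unfolding multiplicity_def by fastforce
  qed
  interpret dunkl R "\<lambda>\<alpha>. \<kappa> \<alpha> / 2" b
    using R \<kappa> b kinv by unfold_locales (auto simp: root_system_def multiplicity_def)
  have neg: "- \<alpha> \<in> R" if "\<alpha> \<in> R" for \<alpha>
    using refl_R[OF that that] by (simp add: refl_vec_self)
  have kneg: "\<kappa> (- \<alpha>) = \<kappa> \<alpha>" if "\<alpha> \<in> R" for \<alpha>
    using kinv[OF that that] by (simp add: refl_vec_self)
  have T: "dunkl_op Rp \<kappa> j f x = Tk j f x" for j f x
  proof -
    define h where "h \<alpha> = complex_of_real (\<kappa> \<alpha> * \<alpha> $ j) * (f x - f (refl_vec \<alpha> x)) / complex_of_real (\<alpha> \<bullet> x)" for \<alpha>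
    \<comment> \<open>The terms for \<alpha> and - \<alpha> agree: the component and the denominator
      both change sign, and the reflection is the same.\<close>
    have "(\<Sum>\<alpha>\<in>R. h \<alpha>) = 2 * (\<Sum>\<alpha>\<in>Rp. h \<alpha>)"
      unfolding Rp_eq by (rule sum_positive_subsystem[OF finite_R neg b])
        (auto simp: h_def kneg refl_vec_uminus)
    moreover have "(\<Sum>\<alpha>\<in>R. complex_of_real (\<kappa> \<alpha> / 2 * \<alpha> $ j) * (f x - f (refl_vec \<alpha> x)) / complex_of_real (\<alpha> \<bullet> x))
        = (\<Sum>\<alpha>\<in>R. h \<alpha>) / 2"
      unfolding sum_divide_distrib by (rule sum.cong) (auto simp: h_def)
    ultimately show ?thesis by (simp add: dunkl_op_def Tk_def h_def)
  qed
  have itw: "intertwiner R Rp \<kappa> Vop"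
    unfolding intertwiner_def
    using Vop_bij Vop_lincomb Vop_homog Vop_one Tk_Vop by (auto simp: T regular_def)
  have Vk: "Vk R Rp \<kappa> c = Vop c" if "c \<in> polys" for c
    unfolding Vk_def
  proof (rule the_equality)
    show "\<exists>V. intertwiner R Rp \<kappa> V \<and> V c = Vop c" using itw by blast
    fix d assume "\<exists>V. intertwiner R Rp \<kappa> V \<and> V c = d"
    then obtain V where V: "intertwiner R Rp \<kappa> V" and d: "V c = d" by blast
    have "V c = Vop c"
      using V that by (intro intertwiner_eq_Vop) (auto simp: intertwiner_def T regular_def)
    with d show "d = Vop c" by simp
  qed
  let ?e = "\<lambda>u n a. if a \<in> midx n then ecoef u a else 0"
  have he: "homog n (?e u n)" for u :: "complex^'n" and n by (auto simp: homog_midx)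
  have E: "peval (Vop (?e u n)) (cvec x) = U n (ecoef u) x" for u n x
    unfolding peval_Vop_homog[OF he] by (rule U_cong) simp
  define v where "v a = U (mdeg a) (unit_at a) z" for a
  have ex: "U n (ecoef (cvec z)) x = (\<Sum>a\<in>midx n. v a * ecoef (cvec x) a)" for n x
    using En_expand[of n x z] by (simp add: En_def v_def midx_def mult.commute)
  show ?thesis
  proof (rule that[of v])
    show "norm (v a) \<le> norm z ^ mdeg a" for a
      unfolding v_def by (rule norm_U_unit_at) (simp add: midx_def)
  next
    fix y
    have "peval (Vk R Rp \<kappa> (?e (cvec z) n)) (\<i> *s cvec y) = (\<Sum>a\<in>midx n. v a * ecoef (\<i> *s cvec y) a)" for n
    proof -
      \<comment> \<open>\<open>E\<close> describes the polynomial only at real points; homogeneity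
        carries it to imaginary ones.\<close>
      have "peval (Vop (?e (cvec z) n)) (\<i> *s cvec y) = \<i> ^ n * peval (Vop (?e (cvec z) n)) (cvec y)"
        unfolding peval_homog[OF Vop_homog[OF he]] mon_scale sum_distrib_left
        by (rule sum.cong) (auto simp: midx_def)
      also have "\<dots> = (\<Sum>a\<in>midx n. v a * ecoef (\<i> *s cvec y) a)"
        unfolding E ex ecoef_scale sum_distrib_left by (rule sum.cong) (auto simp: midx_def)
      finally show ?thesis by (simp add: Vk homog_polys[OF he])
    qed
    moreover have "(\<chi> i. \<i> * complex_of_real (y $ i)) = \<i> *s cvec y" by (simp add: vec_eq_iff)
    ultimately show "dunkl_kernel R Rp \<kappa> (\<chi> i. \<i> * complex_of_real (y $ i)) (cvec z)
      = (\<Sum>n. \<Sum>a\<in>midx n. v a * ecoef (\<i> *s cvec y) a)"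
      unfolding dunkl_kernel_def dunkl_kernel_coeffs by simp
  next
    fix x
    have "peval (Vk R Rp \<kappa> (?e (cvec (- z)) n)) (cvec x) = (\<Sum>a\<in>midx n. v a * ecoef (- cvec x) a)" for n
    proof -
      have m: "- w = (-1) *s w" for w :: "complex^'n" by (simp add: vec_eq_iff)
      have "cvec (- z) = (-1) *s cvec z" by (simp add: vec_eq_iff)
      \<comment> \<open>The sign of - z leaves the second argument as (-1)^n and is then absorbed
        into the first one by homogeneity.\<close>
      then have "U n (ecoef (cvec (- z))) x = U n (\<lambda>a. (-1) ^ n * ecoef (cvec z) a + 0 * ecoef (cvec z) a) x"
        by (intro U_cong) (simp only: ecoef_scale, simp add: midx_def)
      also have "\<dots> = (-1) ^ n * (\<Sum>a\<in>midx n. v a * ecoef (cvec x) a)"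
        unfolding U_lincomb ex by simp
      also have "\<dots> = (\<Sum>a\<in>midx n. v a * ecoef (- cvec x) a)"
        unfolding m[of "cvec x"] ecoef_scale sum_distrib_left by (rule sum.cong) (auto simp: midx_def)
      finally show ?thesis using E by (simp add: Vk homog_polys[OF he])
    qed
    then show "dunkl_kernel R Rp \<kappa> (cvec x) (cvec (- z))
      = (\<Sum>n. \<Sum>a\<in>midx n. v a * ecoef (- cvec x) a)"
      unfolding dunkl_kernel_def dunkl_kernel_coeffs by simp
  next
    fix c :: "'n mpoly_c" and p :: "real^'n \<Rightarrow> complex"
    assume c: "c \<in> polys" and p: "\<And>x. p x = peval c (cvec x)"
    obtain N where N: "\<And>a. c a \<noteq> 0 \<Longrightarrow> mdeg a \<le> N" using polys_bounded_degree[OF c] by blast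
    have "Vfun R Rp \<kappa> p z = peval (Vop c) (cvec z)"
      unfolding Vfun_def coeffs_of_eq[OF c p] by (simp add: Vk[OF c])
    also have "\<dots> = (\<Sum>n\<le>N. U n c z)" by (rule peval_Vop) (rule N)
    also have "\<dots> = (\<Sum>n\<le>N. \<Sum>a\<in>midx n. c a * v a)"
      unfolding U_expand[of _ c] by (auto simp: v_def midx_def intro!: sum.cong)
    also have "\<dots> = (\<Sum>a\<in>(\<Union>n\<le>N. midx n). c a * v a)"
      by (intro sum.UNION_disjoint[symmetric]) (simp, simp, auto simp: midx_def)
    also have "\<dots> = (\<Sum>a | c a \<noteq> 0. c a * v a)"
      by (rule sum.mono_neutral_right) (simp, auto simp: midx_def N)
    finally show "Vfun R Rp \<kappa> p z = (\<Sum>a | c a \<noteq> 0. c a * v a)" .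
  qed
qed

subsection \<open>Hermite polynomials and Gaussian integrals in one variable\<close>

definition gexp :: "real \<Rightarrow> real \<Rightarrow> complex" where
  "gexp y x = exp (- \<i> * of_real y * of_real x - (of_real x)\<^sup>2 / 2)"

lemma norm_gexp: "norm (gexp y x) = exp (- (x\<^sup>2 / 2))"
proof -
  have "Re (- \<i> * of_real y * of_real x - (of_real x)\<^sup>2 / 2) = - (x\<^sup>2 / 2)"
    by (simp add: power2_eq_square)
  then show ?thesis unfolding gexp_def norm_exp_eq_Re by simp
qed

lemma gexp_measurable [measurable]: "gexp y \<in> borel_measurable borel"
  unfolding gexp_def by measurable

text \<open>Completing the square gives s |x| \<le> x^2/4 + s^2, so half of the Gaussian exponent
  absorbs the exponential. The remaining exp(-x^2/4) is sqrt(4 pi) times the normal density of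
  variance 2.\<close>

lemma integrable_moment_exp_gauss:
  "integrable lborel (\<lambda>x::real. \<bar>x\<bar> ^ k * exp (s * \<bar>x\<bar>) * exp (- (x\<^sup>2 / 2)))"
proof (rule Bochner_Integration.integrable_bound)
  show "integrable lborel (\<lambda>x. exp (s\<^sup>2) * sqrt (4 * pi) * (normal_density 0 (sqrt 2) x * \<bar>x - 0\<bar> ^ k))"
    by (intro integrable_mult_right integrable_normal_moment_abs) simp
  have "exp (s * \<bar>x\<bar>) * exp (- (x\<^sup>2 / 2)) \<le> exp (s\<^sup>2) * exp (- (x\<^sup>2 / 4))" for x :: real
  proof -
    have "0 \<le> (\<bar>x\<bar> / 2 - s)\<^sup>2" by simp
    also have "\<dots> = x\<^sup>2 / 4 - s * \<bar>x\<bar> + s\<^sup>2" by (simp add: power2_diff power_divide)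
    finally show ?thesis unfolding exp_add[symmetric] by simp
  qed
  then have "\<bar>x\<bar> ^ k * (exp (s * \<bar>x\<bar>) * exp (- (x\<^sup>2 / 2))) \<le> \<bar>x\<bar> ^ k * (exp (s\<^sup>2) * exp (- (x\<^sup>2 / 4)))" for x :: real
    by (intro mult_left_mono) auto
  then show "AE x in lborel. norm (\<bar>x\<bar> ^ k * exp (s * \<bar>x\<bar>) * exp (- (x\<^sup>2 / 2)))
      \<le> norm (exp (s\<^sup>2) * sqrt (4 * pi) * (normal_density 0 (sqrt 2) x * \<bar>x - 0\<bar> ^ k))"
    by (intro AE_I2) (simp add: normal_density_def abs_mult mult_ac)
qed simp

lemma integrable_poly_gexp: "integrable lborel (\<lambda>x. poly Q (of_real x) * gexp y x)"
proof -
  have "integrable lborel (\<lambda>x. coeff Q i * ((of_real x) ^ i * gexp y x))" for i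
  proof (intro integrable_mult_right, rule Bochner_Integration.integrable_bound)
    show "integrable lborel (\<lambda>x::real. \<bar>x\<bar> ^ i * exp (0 * \<bar>x\<bar>) * exp (- (x\<^sup>2 / 2)))"
      by (rule integrable_moment_exp_gauss)
  qed (auto simp: norm_mult norm_power norm_gexp)
  then have "integrable lborel (\<lambda>x. \<Sum>i\<le>degree Q. coeff Q i * ((of_real x) ^ i * gexp y x))"
    by (intro Bochner_Integration.integrable_sum) auto
  then show ?thesis by (simp add: poly_altdef sum_distrib_right mult.assoc)
qed

lemma power_gexp_tendsto_0:
  assumes "F = at_top \<or> F = at_bot"
  shows "((\<lambda>x. (of_real x) ^ k * gexp y x) \<longlongrightarrow> 0) F"
proof (rule Lim_null_comparison)
  have "filterlim (\<lambda>x::real. \<bar>x\<bar>) at_top F"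
    using assms filterlim_abs_real filterlim_at_infinity_imp_norm_at_top[OF filterlim_at_bot_imp_at_infinity[OF filterlim_ident]]
    by auto
  then have "((\<lambda>x. \<bar>x\<bar> ^ k / exp \<bar>x\<bar>) \<longlongrightarrow> (0::real)) F"
    by (rule filterlim_compose[OF tendsto_power_div_exp_0])
  then show "((\<lambda>x. exp (1/2) * (\<bar>x\<bar> ^ k / exp \<bar>x\<bar>)) \<longlongrightarrow> (0::real)) F"
    by (rule tendsto_mult_right_zero)
  \<comment> \<open>A decay rate exp(- |x|) suffices against powers; the constant comes from (|x| -
    1)^2 \<ge> 0.\<close>
  have "exp (- (x\<^sup>2 / 2)) \<le> exp (1/2) / exp \<bar>x\<bar>" for x :: real
  proof -
    have "0 \<le> (\<bar>x\<bar> - 1)\<^sup>2" by simp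
    also have "\<dots> = x\<^sup>2 - 2 * \<bar>x\<bar> + 1" by (simp add: power2_diff)
    finally show ?thesis unfolding exp_diff[symmetric] by simp
  qed
  then have "\<bar>x\<bar> ^ k * exp (- (x\<^sup>2 / 2)) \<le> \<bar>x\<bar> ^ k * (exp (1/2) / exp \<bar>x\<bar>)" for x :: real
    by (intro mult_left_mono) auto
  then show "\<forall>\<^sub>F x in F. norm ((of_real x) ^ k * gexp y x) \<le> exp (1/2) * (\<bar>x\<bar> ^ k / exp \<bar>x\<bar>)"
    by (intro always_eventually allI) (simp add: norm_mult norm_power norm_gexp mult_ac)
qed

lemma poly_gexp_tendsto_0:
  assumes "F = at_top \<or> F = at_bot"
  shows "((\<lambda>x. poly Q (of_real x) * gexp y x) \<longlongrightarrow> 0) F"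
proof -
  have "((\<lambda>x. \<Sum>i\<le>degree Q. coeff Q i * ((of_real x) ^ i * gexp y x)) \<longlongrightarrow> (\<Sum>i\<le>degree Q. coeff Q i * 0)) F"
    by (intro tendsto_sum tendsto_mult tendsto_const power_gexp_tendsto_0[OF assms])
  then show ?thesis by (simp add: poly_altdef sum_distrib_right mult.assoc)
qed

text \<open>The integrand is the derivative of Q times \<open>gexp y\<close>, which vanishes at both
  ends of the line. Both the recurrence for the moments and the orthogonality below are instances of
  this integration by parts.\<close>

lemma integral_deriv_poly_gexp:
  "(\<integral>x. poly (pderiv Q - smult (\<i> * of_real y) Q - pCons 0 Q) (of_real x) * gexp y x \<partial>lborel) = 0"
proof -
  let ?Q' = "pderiv Q - smult (\<i> * of_real y) Q - pCons 0 Q"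
  have D: "((\<lambda>x. poly Q (of_real x) * gexp y x) has_vector_derivative poly ?Q' (of_real x) * gexp y x) (at x)" for x
  proof -
    have "((\<lambda>w. poly Q w * exp (- \<i> * of_real y * w - w\<^sup>2 / 2)) has_field_derivative
       poly ?Q' w * exp (- \<i> * of_real y * w - w\<^sup>2 / 2)) (at w)" for w
      by (auto intro!: derivative_eq_intros poly_DERIV simp: algebra_simps)
    from has_vector_derivative_real_field[OF this] show ?thesis
      unfolding gexp_def by simp
  qed
  have cont: "isCont (\<lambda>x. poly ?Q' (of_real x) * gexp y x) x" for x :: real
    unfolding gexp_def by (intro continuous_intros) auto
  have "(LBINT x=-\<infinity>..\<infinity>. poly ?Q' (of_real x) * gexp y x) = 0 - 0"
  proof (rule interval_integral_FTC_integrable)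
    show "set_integrable lborel (einterval (- \<infinity>) \<infinity>) (\<lambda>x. poly ?Q' (of_real x) * gexp y x)"
      using integrable_poly_gexp[of ?Q' y] by (simp add: set_integrable_def)
    show "(((\<lambda>x. poly Q (of_real x) * gexp y x) \<circ> real_of_ereal) \<longlongrightarrow> 0) (at_right (- \<infinity>))"
      by (simp only: ereal_tendsto_simps) (simp add: poly_gexp_tendsto_0)
    show "(((\<lambda>x. poly Q (of_real x) * gexp y x) \<circ> real_of_ereal) \<longlongrightarrow> 0) (at_left \<infinity>)"
      by (simp only: ereal_tendsto_simps) (simp add: poly_gexp_tendsto_0)
  qed (use D cont in auto)
  then show ?thesis
    by (simp add: interval_lebesgue_integral_def set_lebesgue_integral_def)
qed

lemma integral_gexp: "(\<integral>x. gexp y x \<partial>lborel) = of_real (sqrt (2 * pi) * exp (- (y\<^sup>2 / 2)))"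
proof -
  have "of_real (exp (- (y\<^sup>2) / 2)) = char std_normal_distribution (- y)"
    by (simp add: char_std_normal_distribution)
  also have "\<dots> = (\<integral>x. std_normal_density x *\<^sub>R iexp (- y * x) \<partial>lborel)"
    unfolding char_def by (subst integral_density) auto
  also have "\<dots> = (\<integral>x. of_real (1 / sqrt (2 * pi)) * gexp y x \<partial>lborel)"
  proof (rule Bochner_Integration.integral_cong[OF refl])
    fix x
    have "gexp y x = exp (\<i> * of_real (- y * x)) * of_real (exp (- x\<^sup>2 / 2))"
      unfolding gexp_def exp_of_real[symmetric] exp_add[symmetric]
      by (rule arg_cong[where f = exp]) (simp add: algebra_simps)
    then show "std_normal_density x *\<^sub>R iexp (- y * x) = of_real (1 / sqrt (2 * pi)) * gexp y x"
      by (simp add: std_normal_density_def scaleR_conv_of_real)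
  qed
  also have "\<dots> = of_real (1 / sqrt (2 * pi)) * (\<integral>x. gexp y x \<partial>lborel)" by simp
  finally show ?thesis by (simp add: field_simps)
qed

text \<open>Coefficients of \<open>exp (t\<^sup>2 / 2)\<close>; the polynomial \<open>hp k\<close> is the coefficient of \<open>t\<^sup>k\<close> in
  \<open>exp (t\<^sup>2 / 2 + \<i> x t)\<close>.\<close>

definition dco :: "nat \<Rightarrow> complex" where
  "dco j = (if even j then (1/2) ^ (j div 2) / fact (j div 2) else 0)"

definition hp :: "nat \<Rightarrow> complex poly" where
  "hp k = (\<Sum>n\<le>k. monom (dco (k - n) * \<i> ^ n / fact n) n)"

lemma dco_0 [simp]: "dco 0 = 1" and dco_1 [simp]: "dco (Suc 0) = 0"
  by (simp_all add: dco_def)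

text \<open>The coefficient form of the differential equation g' = t g for g = exp(t^2/2).\<close>

lemma dco_rec: "of_nat (j + 2) * dco (j + 2) = dco j"
proof (cases "even j")
  case True
  then obtain i where j: "j = 2 * i" by blast
  have "(of_nat (Suc i) :: complex) \<noteq> 0" by (rule of_nat_neq_0)
  then have "2 * of_nat (Suc i) * ((1/2) ^ Suc i / (of_nat (Suc i) * fact i)) = ((1/2) ^ i / fact i :: complex)"
    by (simp del: of_nat_Suc)
  moreover have "of_nat (2 * i + 2) = (2 * of_nat (Suc i) :: complex)" by simp
  moreover have "(2 * i + 2) div 2 = Suc i" by simp
  ultimately show ?thesis
    unfolding dco_def j by (simp add: fact_Suc del: of_nat_Suc)
qed (simp add: dco_def)

lemma coeff_hp: "coeff (hp k) n = (if n \<le> k then dco (k - n) * \<i> ^ n / fact n else 0)"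
  by (simp add: hp_def coeff_sum coeff_monom)

lemma poly_hp: "poly (hp k) x = (\<Sum>n\<le>k. dco (k - n) * ((\<i> * x) ^ n / fact n))"
  by (simp add: hp_def poly_sum poly_monom power_mult_distrib mult.assoc)

lemma hp_0: "hp 0 = 1"
  by (simp add: hp_def)

lemma hp_1: "hp (Suc 0) = [:0, \<i>:]"
  by (simp add: hp_def monom_Suc monom_0)

lemma pderiv_hp: "pderiv (hp (Suc k)) = smult \<i> (hp k)"
proof (rule poly_eqI)
  fix n
  have "(of_nat (Suc n) :: complex) \<noteq> 0" by (rule of_nat_neq_0)
  then show "coeff (pderiv (hp (Suc k))) n = coeff (smult \<i> (hp k)) n"
    by (simp add: coeff_pderiv coeff_hp fact_Suc del: of_nat_Suc)
qed

text \<open>The t-derivative of exp(t^2/2 + i x t) is (t + i x) times the function itself. In terms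
  of the probabilists' Hermite polynomials, \<open>hp k\<close> is i^k He_k / k!.\<close>

lemma hp_rec: "smult (of_nat (k + 2)) (hp (k + 2)) = smult \<i> (pCons 0 (hp (k + 1))) + hp k"
proof (rule poly_eqI)
  fix n
  show "coeff (smult (of_nat (k + 2)) (hp (k + 2))) n = coeff (smult \<i> (pCons 0 (hp (k + 1))) + hp k) n"
  proof (cases n)
    case 0
    then show ?thesis using dco_rec[of k] by (simp add: coeff_hp)
  next
    case (Suc m)
    consider "m + 1 \<le> k" | "m = k" | "m = k + 1" | "m > k + 1" by linarith
    then show ?thesis
    proof cases
      case 1
      then obtain j where k: "k = m + 1 + j" using le_Suc_ex by blast
      have m: "(of_nat (Suc m) :: complex) \<noteq> 0" by (rule of_nat_neq_0)
      have e: "(of_nat (k + 2) :: complex) = of_nat (Suc m) + of_nat (j + 2)" by (simp add: k)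
      have "coeff (smult (of_nat (k + 2)) (hp (k + 2))) n
          = (of_nat (Suc m) * dco (j + 2) + of_nat (j + 2) * dco (j + 2)) * \<i> ^ Suc m / (of_nat (Suc m) * fact m)"
        unfolding coeff_smult coeff_hp e by (simp add: Suc k distrib_right fact_Suc del: of_nat_Suc of_nat_add)
      also have "\<dots> = (of_nat (Suc m) * dco (j + 2) + dco j) * \<i> ^ Suc m / (of_nat (Suc m) * fact m)"
        unfolding dco_rec ..
      also have "\<dots> = coeff (smult \<i> (pCons 0 (hp (k + 1))) + hp k) n"
        using m by (simp add: Suc k coeff_hp fact_Suc distrib_right add_divide_distrib del: of_nat_Suc)
      finally show ?thesis .
    qed (auto simp: Suc coeff_hp fact_Suc divide_simps simp del: of_nat_Suc)
  qed
qed

lemma hp_raise: "pderiv (hp l) - pCons 0 (hp l) = smult (\<i> * of_nat (Suc l)) (hp (Suc l))"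
proof (cases l)
  case 0
  then show ?thesis by (simp add: hp_0 hp_1 pderiv_1 one_pCons)
next
  case (Suc k)
  have "smult \<i> (smult (of_nat (k + 2)) (hp (k + 2))) = smult \<i> (smult \<i> (pCons 0 (hp (k + 1))) + hp k)"
    by (simp only: hp_rec)
  then show ?thesis by (simp add: Suc pderiv_hp smult_add_right)
qed

text \<open>Both sides satisfy the same three-term recurrence. Behind it is the Gaussian integral of
  exp(- t x) \<open>gexp y x\<close>, equal to sqrt(2 pi) exp((t + i y)^2 / 2), whose coefficient of
  t^k is compared.\<close>

lemma integral_power_gexp:
  "(\<integral>x. ((- of_real x) ^ k / fact k) * gexp y x \<partial>lborel)
     = of_real (sqrt (2 * pi)) * (poly (hp k) (of_real y) * of_real (exp (- (y\<^sup>2 / 2))))"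
proof -
  define c :: "nat \<Rightarrow> complex poly" where "c k = monom ((- 1) ^ k / fact k) k" for k
  define J where "J k = (\<integral>x. poly (c k) (of_real x) * gexp y x \<partial>lborel)" for k
  have J: "J k = (\<integral>x. ((- of_real x) ^ k / fact k) * gexp y x \<partial>lborel)" for k
    unfolding J_def c_def poly_monom
    by (intro Bochner_Integration.integral_cong) (auto simp: power_minus[of "of_real _"])
  note int = integrable_poly_gexp
  have pd: "pderiv (c (Suc k)) = - c k" for k
  proof -
    have "(of_nat (Suc k) :: complex) \<noteq> 0" by (rule of_nat_neq_0)
    then show ?thesis by (simp add: c_def pderiv_monom fact_Suc minus_monom del: of_nat_Suc)
  qed
  have pX: "pCons 0 (c k) = - smult (of_nat (Suc k)) (c (Suc k))" for k
  proof -
    have "(of_nat (Suc k) :: complex) \<noteq> 0" by (rule of_nat_neq_0)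
    then show ?thesis
      by (simp add: c_def smult_monom fact_Suc minus_monom monom_Suc[symmetric] del: of_nat_Suc)
  qed
  define I where "I Q = (\<integral>x. poly Q (of_real x) * gexp y x \<partial>lborel)" for Q
  have JI: "J k = I (c k)" for k by (simp add: J_def I_def)
  have split: "I (P + smult s Q + smult t T) = I P + s * I Q + t * I T" for P Q T s t
    unfolding I_def by (simp add: distrib_right mult.assoc int)
  have Iuminus: "I (- P) = - I P" for P unfolding I_def by simp
  have D: "I (pderiv Q - smult (\<i> * of_real y) Q - pCons 0 Q) = 0" for Q
    unfolding I_def by (rule integral_deriv_poly_gexp)
  have rec: "of_nat (k + 2) * J (k + 2) = \<i> * of_real y * J (k + 1) + J k" for k
  proof -
    have "pderiv (c (k + 1)) - smult (\<i> * of_real y) (c (k + 1)) - pCons 0 (c (k + 1))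
        = - c k + smult (- (\<i> * of_real y)) (c (k + 1)) + smult (of_nat (k + 2)) (c (k + 2))"
      using pd[of k] pX[of "k + 1"] by simp
    then have "- J k + (- (\<i> * of_real y)) * J (k + 1) + of_nat (k + 2) * J (k + 2) = 0"
      using D[of "c (k + 1)"] by (simp only: split JI Iuminus)
    then show ?thesis by (simp add: algebra_simps)
  qed
  have J0: "J 0 = of_real (sqrt (2 * pi) * exp (- (y\<^sup>2 / 2)))"
    by (simp add: J integral_gexp)
  have J1: "J 1 = \<i> * of_real y * J 0"
  proof -
    have "pderiv (c 0) - smult (\<i> * of_real y) (c 0) - pCons 0 (c 0)
        = 0 + smult (- (\<i> * of_real y)) (c 0) + smult 1 (c 1)"
      using pX[of 0] by (simp add: c_def pderiv_monom)
    then have "I 0 + (- (\<i> * of_real y)) * J 0 + 1 * J 1 = 0"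
      using D[of "c 0"] by (simp only: split JI)
    moreover have "I 0 = 0" by (simp add: I_def)
    ultimately show ?thesis by (simp add: algebra_simps)
  qed
  \<comment> \<open>The recurrence has order two, so the induction carries two consecutive
    indices.\<close>
  have "J k = of_real (sqrt (2 * pi)) * (poly (hp k) (of_real y) * of_real (exp (- (y\<^sup>2 / 2))))
     \<and> J (k + 1) = of_real (sqrt (2 * pi)) * (poly (hp (k + 1)) (of_real y) * of_real (exp (- (y\<^sup>2 / 2))))"
  proof (induction k)
    case 0
    then show ?case by (simp add: J0 J1[simplified] hp_0 hp_1)
  next
    case (Suc k)
    have "poly (smult (of_nat (k + 2)) (hp (k + 2))) (of_real y)
      = poly (smult \<i> (pCons 0 (hp (k + 1))) + hp k) (of_real y)" by (simp only: hp_rec)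
    then have p: "of_nat (k + 2) * poly (hp (k + 2)) (of_real y)
      = \<i> * of_real y * poly (hp (k + 1)) (of_real y) + poly (hp k) (of_real y)" by simp
    let ?g = "of_real (sqrt (2 * pi)) * of_real (exp (- (y\<^sup>2 / 2))) :: complex"
    have "of_nat (k + 2) * J (k + 2) = (\<i> * of_real y * poly (hp (k + 1)) (of_real y) + poly (hp k) (of_real y)) * ?g"
      unfolding rec using Suc by (simp add: algebra_simps)
    then have "of_nat (k + 2) * J (k + 2) = of_nat (k + 2) * (poly (hp (k + 2)) (of_real y) * ?g)"
      unfolding p[symmetric] by (simp only: mult.assoc)
    moreover have "(of_nat (k + 2) :: complex) \<noteq> 0" by (simp only: of_nat_eq_0_iff)
    ultimately have "J (k + 2) = poly (hp (k + 2)) (of_real y) * ?g"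
      using mult_left_cancel by blast
    then show ?case using Suc by (simp add: mult_ac)
  qed
  then show ?thesis by (simp add: J)
qed

text \<open>Integration by parts moves the raising operator from one factor to a derivative of the
  other. This lowers both indices by one with the factor -1/(l + 1), until one of them is 0.\<close>

lemma integral_hp_hp:
  "(\<integral>x. poly (hp k) (of_real x) * poly (hp l) (of_real x) * gexp 0 x \<partial>lborel)
     = (if k = l then of_real (sqrt (2 * pi)) * (- 1) ^ l / fact l else 0)"
proof -
  define A where "A k l = (\<integral>x. poly (hp k * hp l) (of_real x) * gexp 0 x \<partial>lborel)" for k l
  have sym: "A k l = A l k" for k l by (simp add: A_def mult.commute)
  have step: "(\<integral>x. poly (pderiv (hp k) * hp l) (of_real x) * gexp 0 x \<partial>lborel)
      + \<i> * of_nat (Suc l) * A k (Suc l) = 0" for k l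
  proof -
    have e: "pderiv (hp k * hp l) - smult (\<i> * of_real 0) (hp k * hp l) - pCons 0 (hp k * hp l)
      = pderiv (hp k) * hp l + smult (\<i> * of_nat (Suc l)) (hp k * hp (Suc l))"
    proof -
      have "pderiv (hp k * hp l) - smult (\<i> * of_real 0) (hp k * hp l) - pCons 0 (hp k * hp l)
        = pderiv (hp k) * hp l + hp k * (pderiv (hp l) - pCons 0 (hp l))"
        by (simp add: pderiv_mult algebra_simps)
      then show ?thesis unfolding hp_raise by simp
    qed
    have "(\<integral>x. poly (pderiv (hp k) * hp l) (of_real x) * gexp 0 x
        + \<i> * of_nat (Suc l) * (poly (hp k * hp (Suc l)) (of_real x) * gexp 0 x) \<partial>lborel) = 0"
      using integral_deriv_poly_gexp[of "hp k * hp l" 0] unfolding e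
      by (simp only: poly_add poly_smult distrib_right mult.assoc)
    then show ?thesis
      unfolding A_def
      by (subst (asm) Bochner_Integration.integral_add)
        (intro integrable_poly_gexp integrable_mult_right | simp only: integral_mult_right_zero)+
  qed
  have nz: "\<i> * (of_nat (Suc l) :: complex) \<noteq> 0" for l
    by (simp only: mult_eq_0_iff of_nat_eq_0_iff) simp
  have A0: "A 0 (Suc l) = 0" for l
    using step[of 0 l] nz[of l] by (simp add: hp_0 pderiv_1 del: of_nat_Suc)
  have AS: "A (Suc k) (Suc l) = - A k l / of_nat (Suc l)" for k l
  proof -
    have "(\<integral>x. poly (pderiv (hp (Suc k)) * hp l) (of_real x) * gexp 0 x \<partial>lborel) = \<i> * A k l"
      unfolding A_def pderiv_hp by (simp add: mult.assoc)
    then have "\<i> * (A k l + of_nat (Suc l) * A (Suc k) (Suc l)) = 0"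
      using step[of "Suc k" l] by (simp add: algebra_simps)
    then have "of_nat (Suc l) * A (Suc k) (Suc l) = - A k l"
      by (simp add: eq_neg_iff_add_eq_0 add.commute)
    then show ?thesis using nz[of l] by (simp add: field_simps del: of_nat_Suc)
  qed
  have "A k l = (if k = l then of_real (sqrt (2 * pi)) * (- 1) ^ l / fact l else 0)"
  proof (induction l arbitrary: k)
    case 0
    show ?case
    proof (cases k)
      case 0
      then show ?thesis by (simp add: A_def hp_0 integral_gexp)
    next
      case (Suc j)
      then show ?thesis using A0[of j] sym[of k 0] by simp
    qed
  next
    case (Suc l)
    then show ?case by (cases k) (auto simp: A0 AS fact_Suc field_simps simp del: of_nat_Suc)
  qed
  then show ?thesis by (simp add: A_def)
qed

section \<open>Majorants for the Hermite series\<close>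

lemma sum_power_fact_le_exp: "0 \<le> x \<Longrightarrow> (\<Sum>i<M. x ^ i / fact i) \<le> exp (x::real)"
proof -
  assume x: "0 \<le> x"
  have "(\<lambda>i. x ^ i / fact i) sums exp x"
    using exp_converges[of x] by (simp add: divide_inverse mult.commute)
  then show ?thesis
    using sum_le_suminf[of "\<lambda>i. x ^ i / fact i" "{..<M}"] x by (auto simp: sums_iff)
qed

text \<open>All \<open>dco j\<close> are nonnegative reals and the odd ones vanish, so the even
  terms are a partial sum of the series of exp(r^2/2).\<close>

lemma sum_norm_dco_le:
  assumes "0 \<le> r" shows "(\<Sum>j\<le>N. r ^ j * norm (dco j)) \<le> exp (r\<^sup>2 / 2)"
proof -
  have e: "(\<Sum>j<2 * M. r ^ j * norm (dco j)) = (\<Sum>i<M. (r\<^sup>2 / 2) ^ i / fact i)" for M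
  proof (induction M)
    case (Suc M)
    have "(\<Sum>j<2 * Suc M. r ^ j * norm (dco j))
      = (\<Sum>j<2 * M. r ^ j * norm (dco j)) + r ^ (2 * M) * norm (dco (2 * M)) + r ^ (2 * M + 1) * norm (dco (2 * M + 1))"
      by simp
    also have "dco (2 * M + 1) = 0" by (simp add: dco_def)
    also have "norm (dco (2 * M)) = (1 / 2) ^ M / fact M" by (simp add: dco_def norm_divide norm_power)
    finally show ?case unfolding Suc by (simp add: power_mult power_divide)
  qed simp
  have "(\<Sum>j\<le>N. r ^ j * norm (dco j)) \<le> (\<Sum>j<2 * (N + 1). r ^ j * norm (dco j))"
    using assms by (intro sum_mono2) auto
  also have "\<dots> \<le> exp (r\<^sup>2 / 2)" unfolding e by (rule sum_power_fact_le_exp) simp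
  finally show ?thesis .
qed

text \<open>With absolute values taken, the coefficients of exp(s^2/2 + i t s) are bounded by those
  of the product of two series with nonnegative terms. Enlarging the triangle of index pairs to a
  square separates the two factors.\<close>

lemma sum_norm_hp_le:
  assumes "0 \<le> r"
  shows "(\<Sum>k\<le>N. r ^ k * norm (poly (hp k) (of_real t))) \<le> exp (r\<^sup>2 / 2) * exp (r * \<bar>t\<bar>)"
proof -
  let ?f = "\<lambda>n j. (r * \<bar>t\<bar>) ^ n / fact n * (r ^ j * norm (dco j))"
  have "r ^ k * norm (poly (hp k) (of_real t)) \<le> (\<Sum>n\<le>k. ?f n (k - n))" for k
  proof -
    have "norm (poly (hp k) (of_real t)) \<le> (\<Sum>n\<le>k. norm (dco (k - n)) * (\<bar>t\<bar> ^ n / fact n))"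
      unfolding poly_hp by (rule sum_norm_le) (simp add: norm_mult norm_divide norm_power)
    then have "r ^ k * norm (poly (hp k) (of_real t)) \<le> r ^ k * (\<Sum>n\<le>k. norm (dco (k - n)) * (\<bar>t\<bar> ^ n / fact n))"
      using assms by (intro mult_left_mono) auto
    also have "\<dots> = (\<Sum>n\<le>k. ?f n (k - n))"
      unfolding sum_distrib_left
    proof (rule sum.cong[OF refl])
      fix n assume "n \<in> {..k}"
      then have "r ^ k = r ^ n * r ^ (k - n)" by (simp flip: power_add)
      then show "r ^ k * (norm (dco (k - n)) * (\<bar>t\<bar> ^ n / fact n)) = ?f n (k - n)"
        by (simp add: power_mult_distrib)
    qed
    finally show ?thesis .
  qed
  then have "(\<Sum>k\<le>N. r ^ k * norm (poly (hp k) (of_real t))) \<le> (\<Sum>k\<le>N. \<Sum>n\<le>k. ?f n (k - n))"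
    by (rule sum_mono)
  also have "\<dots> = (\<Sum>(n, j)\<in>{(n, j). n + j \<le> N}. ?f n j)"
    by (rule sum.triangle_reindex_eq[symmetric])
  also have "\<dots> \<le> (\<Sum>(n, j)\<in>{..N} \<times> {..N}. ?f n j)"
    using assms by (intro sum_mono2) auto
  also have "\<dots> = (\<Sum>n\<le>N. (r * \<bar>t\<bar>) ^ n / fact n) * (\<Sum>j\<le>N. r ^ j * norm (dco j))"
    by (simp add: sum_product sum.cartesian_product)
  also have "\<dots> \<le> exp (r * \<bar>t\<bar>) * exp (r\<^sup>2 / 2)"
    using assms sum_power_fact_le_exp[of "r * \<bar>t\<bar>" "Suc N"]
    by (intro mult_mono sum_norm_dco_le sum_nonneg) (auto simp: lessThan_Suc_atMost)
  finally show ?thesis by (simp add: mult.commute)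
qed

subsection \<open>Integrals of products of functions of one variable\<close>

text \<open>Lebesgue measure on the vectors is the image of the product measure indexed by the basis
  vectors; the coordinates are matched with them through \<open>axis\<close>, and Fubini's theorem
  applies.\<close>

lemma
  fixes f :: "'n::finite \<Rightarrow> real \<Rightarrow> 'b::{real_normed_field,banach,second_countable_topology}"
  assumes int: "\<And>i. integrable lborel (f i)"
  shows integrable_prod_vec: "integrable lborel (\<lambda>x::real^'n. \<Prod>i\<in>UNIV. f i (x $ i))" (is ?I)
    and integral_prod_vec: "(\<integral>x. (\<Prod>i\<in>UNIV. f i (x $ i)) \<partial>lborel) = (\<Prod>i\<in>UNIV. \<integral>t. f i t \<partial>lborel)" (is ?E)
proof -
  define ax :: "'n \<Rightarrow> real^'n" where "ax i = axis i 1" for i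
  have inj: "inj ax" by (auto simp: inj_def ax_def axis_eq_axis)
  have B: "Basis = range ax" by (auto simp: ax_def Basis_vec_def)
  define h where "h b = f (inv ax b)" for b
  have hax: "h (ax i) = f i" for i by (simp add: h_def inv_f_f[OF inj])
  interpret product_sigma_finite "\<lambda>_::real^'n. lborel :: real measure" ..
  let ?M = "\<Pi>\<^sub>M b\<in>(Basis :: (real^'n) set). (lborel :: real measure)"
  let ?T = "\<lambda>g. \<Sum>b\<in>(Basis :: (real^'n) set). g b *\<^sub>R b"
  have T: "?T \<in> measurable ?M borel" by measurable
  have nth: "?T g $ i = g (ax i)" for g i
  proof -
    have "?T g $ i = ?T g \<bullet> ax i" by (simp add: ax_def inner_axis)
    also have "\<dots> = g (ax i)" by (rule inner_sum_left_Basis) (simp add: B)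
    finally show ?thesis .
  qed
  have fm: "(\<lambda>x::real^'n. \<Prod>i\<in>UNIV. f i (x $ i)) \<in> borel_measurable borel"
  proof -
    have [measurable]: "f i \<in> borel_measurable borel" for i
      using borel_measurable_integrable[OF int] by simp
    show ?thesis by measurable
  qed
  have pr: "(\<Prod>i\<in>UNIV. f i (?T g $ i)) = (\<Prod>b\<in>Basis. h b (g b))" for g
    by (simp only: nth) (simp add: B prod.reindex hax inj)
  have hint: "\<And>b. b \<in> Basis \<Longrightarrow> integrable lborel (h b)" unfolding B using int by (auto simp: hax)
  show ?I
    by (subst lborel_eq, subst integrable_distr_eq[OF T fm], unfold pr)
      (rule product_integrable_prod[OF finite_Basis hint])
  have "(\<integral>x. (\<Prod>i\<in>UNIV. f i (x $ i)) \<partial>lborel) = (\<integral>g. (\<Prod>b\<in>Basis. h b (g b)) \<partial>?M)"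
    by (subst lborel_eq, subst integral_distr[OF T fm], unfold pr) (rule refl)
  also have "\<dots> = (\<Prod>b\<in>Basis. \<integral>t. h b t \<partial>lborel)"
    by (rule product_integral_prod[OF finite_Basis hint])
  also have "\<dots> = (\<Prod>i\<in>UNIV. \<integral>t. f i t \<partial>lborel)"
    unfolding B by (subst prod.reindex) (auto simp: hax inj)
  finally show ?E .
qed

text \<open>The indices of degree at most N lie in a box, where the sum of products factors into
  one-dimensional sums.\<close>

lemma sum_midx_prod_le:
  fixes q :: "'n::finite \<Rightarrow> nat \<Rightarrow> real"
  assumes "\<And>j k. 0 \<le> q j k" "\<And>j. (\<Sum>k\<le>N. q j k) \<le> Q j"
  shows "(\<Sum>n\<le>N. \<Sum>a\<in>midx n. \<Prod>j\<in>UNIV. q j (a j)) \<le> (\<Prod>j\<in>UNIV. Q j)"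
proof -
  have "(\<Sum>n\<le>N. \<Sum>a\<in>midx n. \<Prod>j\<in>UNIV. q j (a j)) = (\<Sum>a\<in>(\<Union>n\<le>N. midx n). \<Prod>j\<in>UNIV. q j (a j))"
    by (intro sum.UNION_disjoint[symmetric]) (simp, simp, auto simp: midx_def)
  also have "\<dots> \<le> (\<Sum>a\<in>PiE UNIV (\<lambda>_. {..N}). \<Prod>j\<in>UNIV. q j (a j))"
  proof (rule sum_mono2)
    show "(\<Union>n\<le>N. midx n) \<subseteq> PiE UNIV (\<lambda>_::'n. {..N})"
      using le_mdeg order_trans by (fastforce simp: midx_def PiE_UNIV_domain)
  qed (auto intro!: finite_PiE prod_nonneg assms)
  also have "\<dots> = (\<Prod>j\<in>UNIV. \<Sum>k\<le>N. q j k)"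
    by (rule prod_sum_PiE[symmetric]) auto
  also have "\<dots> \<le> (\<Prod>j\<in>UNIV. Q j)"
    using assms by (intro prod_mono) (auto intro: sum_nonneg)
  finally show ?thesis .
qed

lemma power_mdeg: "r ^ mdeg a = (\<Prod>j\<in>UNIV. r ^ a j)"
  by (simp add: mdeg_def power_sum)

text \<open>All partial sums of the norms stay below the integrable product of the
  \<open>G j\<close>, which gives summability at every point and of the integrals of the norms. This
  exchange serves both the Fourier transform of the kernel and the final integral.\<close>

lemma series_product_integral:
  fixes v :: "('n::finite \<Rightarrow> nat) \<Rightarrow> complex" and g :: "'n \<Rightarrow> nat \<Rightarrow> real \<Rightarrow> complex"
  assumes r: "0 \<le> r" and v: "\<And>a. norm (v a) \<le> r ^ mdeg a"
    and int: "\<And>j k. integrable lborel (g j k)" and G: "\<And>j. integrable lborel (G j)"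
    and bnd: "\<And>j N t. (\<Sum>k\<le>N. r ^ k * norm (g j k t)) \<le> G j t"
  shows "integrable lborel (\<lambda>x::real^'n. \<Sum>n. \<Sum>a\<in>midx n. v a * (\<Prod>j\<in>UNIV. g j (a j) (x $ j)))"
    and "(\<integral>x. (\<Sum>n. \<Sum>a\<in>midx n. v a * (\<Prod>j\<in>UNIV. g j (a j) (x $ j))) \<partial>lborel)
      = (\<Sum>n. \<Sum>a\<in>midx n. v a * (\<Prod>j\<in>UNIV. \<integral>t. g j (a j) t \<partial>lborel))"
    and "\<And>x::real^'n. summable (\<lambda>n. \<Sum>a\<in>midx n. v a * (\<Prod>j\<in>UNIV. g j (a j) (x $ j)))"
proof -
  define f where "f n x = (\<Sum>a\<in>midx n. v a * (\<Prod>j\<in>UNIV. g j (a j) (x $ j)))" for n and x :: "real^'n"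
  have fint: "integrable lborel (f n)" for n
    unfolding f_def by (intro Bochner_Integration.integrable_sum integrable_mult_right integrable_prod_vec int)
  have GG: "integrable lborel (\<lambda>x::real^'n. \<Prod>j\<in>UNIV. G j (x $ j))"
    by (intro integrable_prod_vec G)
  have le: "(\<Sum>n\<le>N. norm (f n x)) \<le> (\<Prod>j\<in>UNIV. G j (x $ j))" for N x
  proof -
    have "norm (f n x) \<le> (\<Sum>a\<in>midx n. \<Prod>j\<in>UNIV. r ^ a j * norm (g j (a j) (x $ j)))" for n
      unfolding f_def
    proof (rule sum_norm_le)
      fix a
      have "norm (v a * (\<Prod>j\<in>UNIV. g j (a j) (x $ j))) \<le> r ^ mdeg a * norm (\<Prod>j\<in>UNIV. g j (a j) (x $ j))"
        unfolding norm_mult by (intro mult_right_mono v) simp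
      also have "\<dots> = (\<Prod>j\<in>UNIV. r ^ a j * norm (g j (a j) (x $ j)))"
        by (simp add: power_mdeg prod_norm prod.distrib)
      finally show "norm (v a * (\<Prod>j\<in>UNIV. g j (a j) (x $ j))) \<le> (\<Prod>j\<in>UNIV. r ^ a j * norm (g j (a j) (x $ j)))" .
    qed
    then have "(\<Sum>n\<le>N. norm (f n x)) \<le> (\<Sum>n\<le>N. \<Sum>a\<in>midx n. \<Prod>j\<in>UNIV. r ^ a j * norm (g j (a j) (x $ j)))"
      by (rule sum_mono)
    also have "\<dots> \<le> (\<Prod>j\<in>UNIV. G j (x $ j))"
      using r by (intro sum_midx_prod_le bnd) auto
    finally show ?thesis .
  qed
  have le': "(\<Sum>n<N. norm (f n x)) \<le> (\<Prod>j\<in>UNIV. G j (x $ j))" for N x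
    using le[where N = N and x = x] sum_mono2[of "{..N}" "{..<N}" "\<lambda>n. norm (f n x)"] by fastforce
  have sn: "summable (\<lambda>n. norm (f n x))" for x
    by (rule summableI_nonneg_bounded[OF _ le']) simp
  have si: "summable (\<lambda>n. \<integral>x. norm (f n x) \<partial>lborel)"
  proof (rule summableI_nonneg_bounded)
    fix N
    have "(\<Sum>n<N. \<integral>x. norm (f n x) \<partial>lborel) = (\<integral>x. (\<Sum>n<N. norm (f n x)) \<partial>lborel)"
      by (rule Bochner_Integration.integral_sum[symmetric]) (intro integrable_norm fint)
    also have "\<dots> \<le> (\<integral>x. (\<Prod>j\<in>UNIV. G j (x $ j)) \<partial>lborel)"
      by (rule integral_mono[OF _ GG le']) (intro Bochner_Integration.integrable_sum integrable_norm fint)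
    finally show "(\<Sum>n<N. \<integral>x. norm (f n x) \<partial>lborel) \<le> (\<integral>x. (\<Prod>j\<in>UNIV. G j (x $ j)) \<partial>lborel)" .
  qed simp
  show "integrable lborel (\<lambda>x::real^'n. \<Sum>n. \<Sum>a\<in>midx n. v a * (\<Prod>j\<in>UNIV. g j (a j) (x $ j)))"
    using integrable_suminf[OF fint _ si] sn unfolding f_def by simp
  have "(\<integral>x. f n x \<partial>lborel) = (\<Sum>a\<in>midx n. v a * (\<Prod>j\<in>UNIV. \<integral>t. g j (a j) t \<partial>lborel))" for n
    unfolding f_def
    by (subst Bochner_Integration.integral_sum)
      (auto intro!: integrable_mult_right integrable_prod_vec int simp: integral_prod_vec[OF int])
  moreover have "(\<integral>x. (\<Sum>n. f n x) \<partial>lborel) = (\<Sum>n. \<integral>x. f n x \<partial>lborel)"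
    using integral_suminf[OF fint _ si] sn by simp
  ultimately show "(\<integral>x. (\<Sum>n. \<Sum>a\<in>midx n. v a * (\<Prod>j\<in>UNIV. g j (a j) (x $ j))) \<partial>lborel)
      = (\<Sum>n. \<Sum>a\<in>midx n. v a * (\<Prod>j\<in>UNIV. \<integral>t. g j (a j) t \<partial>lborel))"
    by (simp only:) (simp only: f_def)
  show "summable (\<lambda>n. \<Sum>a\<in>midx n. v a * (\<Prod>j\<in>UNIV. g j (a j) (x $ j)))" for x :: "real^'n"
    using summable_norm_cancel[OF sn[of x]] unfolding f_def .
qed

subsection \<open>Differentiating the kernel series\<close>

definition Pn :: "(('n::finite \<Rightarrow> nat) \<Rightarrow> complex) \<Rightarrow> nat \<Rightarrow> real^'n \<Rightarrow> complex" where
  "Pn v n y = (\<Sum>a\<in>midx n. v a * ecoef (\<i> *s cvec y) a)"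

definition Ser :: "(('n::finite \<Rightarrow> nat) \<Rightarrow> complex) \<Rightarrow> real^'n \<Rightarrow> complex" where
  "Ser v y = (\<Sum>n. Pn v n y)"

text \<open>Geometric growth is preserved by index shifts, and differentiation of the exponential
  series acts on its coefficients as a shift.\<close>

definition adm :: "real \<Rightarrow> real \<Rightarrow> (('n::finite \<Rightarrow> nat) \<Rightarrow> complex) \<Rightarrow> bool" where
  "adm C r v \<longleftrightarrow> (\<forall>a. norm (v a) \<le> C * r ^ mdeg a)"

text \<open>The multinomial theorem for the absolute values, at the point with all coordinates
  1.\<close>

lemma sum_norm_ecoef: "(\<Sum>a\<in>midx n. norm (ecoef u a)) = (\<Sum>i\<in>UNIV. norm (u $ i)) ^ n / fact n"
proof -
  have "complex_of_real (norm (ecoef u a)) = ecoef (cvec (\<chi> i. norm (u $ i))) a" for a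
    by (simp add: ecoef_def prod_norm[symmetric] norm_divide norm_power)
  moreover have "mon a (\<chi> i. 1) = 1" for a :: "'a \<Rightarrow> nat" by (simp add: mon_def)
  ultimately have "complex_of_real (\<Sum>a\<in>midx n. norm (ecoef u a))
      = (\<Sum>a\<in>midx n. ecoef (cvec (\<chi> i. norm (u $ i))) a * mon a (\<chi> i. 1))" by simp
  also have "\<dots> = complex_of_real ((\<Sum>i\<in>UNIV. norm (u $ i)) ^ n / fact n)"
    unfolding multinomial_ecoef by simp
  finally show ?thesis using of_real_eq_iff by blast
qed

lemma norm_sum_ecoef_le:
  fixes v :: "('n::finite \<Rightarrow> nat) \<Rightarrow> complex"
  assumes "adm C r v"
  shows "norm (\<Sum>a\<in>midx n. v a * ecoef u a) \<le> C * ((r * (\<Sum>i\<in>UNIV. norm (u $ i))) ^ n / fact n)"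
proof -
  have "norm (\<Sum>a\<in>midx n. v a * ecoef u a) \<le> (\<Sum>a\<in>midx n. C * r ^ n * norm (ecoef u a))"
  proof (rule sum_norm_le)
    fix a :: "'n \<Rightarrow> nat" assume "a \<in> midx n"
    then have "norm (v a) \<le> C * r ^ n" using assms by (auto simp: adm_def midx_def)
    then show "norm (v a * ecoef u a) \<le> C * r ^ n * norm (ecoef u a)"
      unfolding norm_mult by (rule mult_right_mono) simp
  qed
  also have "\<dots> = C * ((r * (\<Sum>i\<in>UNIV. norm (u $ i))) ^ n / fact n)"
    unfolding sum_distrib_left[symmetric] sum_norm_ecoef by (simp add: power_mult_distrib)
  finally show ?thesis .
qed

lemma summable_exp_real: "summable (\<lambda>n. x ^ n / fact n :: real)"
  using summable_exp[of x] by (simp add: divide_inverse mult.commute)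

lemma summable_sum_ecoef:
  "adm C r v \<Longrightarrow> summable (\<lambda>n. \<Sum>a\<in>midx n. v a * ecoef u a)"
  by (rule summable_comparison_test'[of "\<lambda>n. C * ((r * (\<Sum>i\<in>UNIV. norm (u $ i))) ^ n / fact n)" 0])
    (rule summable_mult[OF summable_exp_real], rule norm_sum_ecoef_le)

lemma norm_Pn_le:
  assumes "adm C r v"
  shows "norm (Pn v n y) \<le> C * ((r * (\<Sum>i\<in>UNIV. \<bar>y $ i\<bar>)) ^ n / fact n)"
  using norm_sum_ecoef_le[OF assms, where u = "\<i> *s cvec y" and n = n] by (simp add: Pn_def norm_mult)

lemma summable_Pn: "adm C r v \<Longrightarrow> summable (\<lambda>n. Pn v n y)"
  unfolding Pn_def by (rule summable_sum_ecoef)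

lemma adm_inc:
  assumes "adm C r v" shows "adm (C * r) r (\<lambda>a. \<i> * v (inc j a))"
  unfolding adm_def
proof
  fix a
  show "norm (\<i> * v (inc j a)) \<le> C * r * r ^ mdeg a"
    using assms[unfolded adm_def, rule_format, of "inc j a"] by (simp add: norm_mult mult_ac)
qed

lemma ecoef_i_cvec: "ecoef (\<i> *s cvec y) a = ecoef (\<chi> i. \<i>) a * mon a (cvec y)"
  by (simp add: ecoef_def mon_def power_mult_distrib prod.distrib[symmetric])

lemma has_vector_derivative_Pn:
  "((\<lambda>t. Pn v (Suc n) (y + t *\<^sub>R axis j 1)) has_vector_derivative
      Pn (\<lambda>a. \<i> * v (inc j a)) n (y + t *\<^sub>R axis j 1)) (at t)"
proof -
  define c where "c w m a = (if a \<in> midx m then w a * ecoef (\<chi> i. \<i>) a else 0)"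
    for w :: "('a \<Rightarrow> nat) \<Rightarrow> complex" and m a
  have h: "homog m (c w m)" for w m by (auto simp: c_def homog_midx)
  have P: "Pn w m x = peval (c w m) (cvec x)" for w m x
    unfolding peval_homog[OF h] Pn_def ecoef_i_cvec by (simp add: c_def mult.assoc)
  have pd: "pdc j (c v (Suc n)) = c (\<lambda>a. \<i> * v (inc j a)) n"
  proof
    fix a
    have "of_nat (Suc (a j)) * ecoef (\<chi> i. \<i>) (inc j a) = \<i> * ecoef (\<chi> i. \<i>) a"
      using ecoef_inc[of a j "\<chi> i. \<i>"] by simp
    then show "pdc j (c v (Suc n)) a = c (\<lambda>a. \<i> * v (inc j a)) n a"
      by (simp add: pdc_inc c_def midx_def algebra_simps del: of_nat_Suc)
  qed
  let ?x = "y + t *\<^sub>R axis j 1"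
  let ?f' = "\<lambda>h. \<Sum>i\<in>UNIV. complex_of_real (h $ i) * peval (pdc i (c v (Suc n))) (cvec ?x)"
  have f': "((\<lambda>x. peval (c v (Suc n)) (cvec x)) has_derivative ?f') (at ?x)"
    by (rule has_derivative_peval[OF homog_polys[OF h]])
  have "((\<lambda>t. y + t *\<^sub>R axis j 1) has_derivative (\<lambda>t. t *\<^sub>R axis j 1)) (at t)"
    by (auto intro!: derivative_eq_intros)
  from has_derivative_compose[OF this f']
  have "((\<lambda>t. peval (c v (Suc n)) (cvec (y + t *\<^sub>R axis j 1))) has_derivative (\<lambda>t. ?f' (t *\<^sub>R axis j 1))) (at t)" .
  moreover have "?f' (s *\<^sub>R axis j 1) = s *\<^sub>R peval (pdc j (c v (Suc n))) (cvec ?x)" for s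
  proof -
    have "?f' (s *\<^sub>R axis j 1) = s *\<^sub>R ?f' (axis j 1)"
      by (simp only: linear_scale[OF has_derivative_linear[OF f']])
    then show ?thesis by (simp only: sum_axis_mult)
  qed
  ultimately show ?thesis
    unfolding has_vector_derivative_def P pd by simp
qed

text \<open>Termwise differentiation along a segment, justified by the Weierstrass test: on it the
  derivatives are dominated by the terms of an exponential series.\<close>

lemma partial_dir_Ser:
  fixes v :: "('n::finite \<Rightarrow> nat) \<Rightarrow> complex"
  assumes v: "adm C r v" and r: "0 \<le> r" and C: "0 \<le> C"
  shows "partial_dir j (Ser v) y = Ser (\<lambda>a. \<i> * v (inc j a)) y"
proof -
  let ?v = "\<lambda>a. \<i> * v (inc j a)"
  let ?l = "\<lambda>t. y + t *\<^sub>R axis j (1::real)"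
  \<comment> \<open>The derivative of the term of degree \<open>Suc m\<close> is a term of degree m;
    the constant term contributes 0.\<close>
  define d where "d n t = (case n of 0 \<Rightarrow> 0 | Suc m \<Rightarrow> Pn ?v m (?l t))" for n t
  \<comment> \<open>The summand 1 is the radius of the ball in which t varies.\<close>
  define B where "B = (\<Sum>i\<in>UNIV. \<bar>y $ i\<bar>) + 1"
  define M where "M n = (case n of 0 \<Rightarrow> 0 | Suc m \<Rightarrow> C * r * ((r * B) ^ m / fact m))" for n
  let ?S = "ball (0::real) 1"
  have l1: "(\<Sum>i\<in>UNIV. \<bar>?l t $ i\<bar>) \<le> B" if "t \<in> ?S" for t
  proof -
    have "(\<Sum>i\<in>UNIV. \<bar>?l t $ i\<bar>) \<le> (\<Sum>i\<in>UNIV. \<bar>y $ i\<bar> + (if i = j then \<bar>t\<bar> else 0))"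
      by (rule sum_mono) (auto simp: axis_def)
    also have "\<dots> \<le> B" using that by (simp add: sum.distrib B_def)
    finally show ?thesis .
  qed
  have dM: "norm (d n t) \<le> M n" if "t \<in> ?S" for n t
  proof (cases n)
    case (Suc m)
    have "norm (Pn ?v m (?l t)) \<le> C * r * ((r * (\<Sum>i\<in>UNIV. \<bar>?l t $ i\<bar>)) ^ m / fact m)"
      by (rule norm_Pn_le[OF adm_inc[OF v]])
    also have "\<dots> \<le> C * r * ((r * B) ^ m / fact m)"
      using l1[OF that] r C by (intro mult_left_mono divide_right_mono power_mono) (auto intro: sum_nonneg)
    finally show ?thesis by (simp add: d_def M_def Suc)
  qed (simp add: d_def M_def)
  have sM: "summable M"
    by (subst summable_Suc_iff[symmetric]) (simp only: M_def nat.case, rule summable_mult[OF summable_exp_real])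
  have ul: "uniform_limit ?S (\<lambda>n t. \<Sum>i<n. d i t) (\<lambda>t. \<Sum>i. d i t) sequentially"
    by (rule Weierstrass_m_test[OF dM sM])
  have "\<exists>g. \<forall>t\<in>?S. (\<lambda>n. Pn v n (?l t)) sums g t \<and> (g has_derivative (\<lambda>h. h *\<^sub>R (\<Sum>i. d i t))) (at t within ?S)"
  proof (rule has_derivative_series[where f' = "\<lambda>n t h. h *\<^sub>R d n t" and x = 0])
    show "((\<lambda>t. Pn v n (?l t)) has_derivative (\<lambda>h. h *\<^sub>R d n t)) (at t within ?S)" for n t
    proof (cases n)
      case 0
      then show ?thesis by (simp add: Pn_def midx_0 ecoef_def d_def)
    next
      case (Suc m)
      have "((\<lambda>t. Pn v (Suc m) (?l t)) has_derivative (\<lambda>h. h *\<^sub>R Pn ?v m (?l t))) (at t)"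
        using has_vector_derivative_Pn[of v m y j t] unfolding has_vector_derivative_def .
      then show ?thesis unfolding Suc d_def nat.case by (rule has_derivative_at_withinI)
    qed
    show "\<forall>\<^sub>F n in sequentially. \<forall>t\<in>?S. \<forall>h. norm ((\<Sum>i<n. h *\<^sub>R d i t) - h *\<^sub>R (\<Sum>i. d i t)) \<le> e * norm h"
      if "0 < e" for e
    proof (rule eventually_mono[OF uniform_limitD[OF ul that]], intro ballI allI)
      fix n t h assume "\<forall>t\<in>?S. dist (\<Sum>i<n. d i t) (\<Sum>i. d i t) < e" "t \<in> ?S"
      then have "norm ((\<Sum>i<n. d i t) - (\<Sum>i. d i t)) \<le> e" by (auto simp: dist_norm less_imp_le)
      then have "\<bar>h\<bar> * norm ((\<Sum>i<n. d i t) - (\<Sum>i. d i t)) \<le> \<bar>h\<bar> * e" by (rule mult_left_mono) simp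
      moreover have "(\<Sum>i<n. h *\<^sub>R d i t) - h *\<^sub>R (\<Sum>i. d i t) = h *\<^sub>R ((\<Sum>i<n. d i t) - (\<Sum>i. d i t))"
        by (simp add: scaleR_sum_right scaleR_diff_right)
      ultimately show "norm ((\<Sum>i<n. h *\<^sub>R d i t) - h *\<^sub>R (\<Sum>i. d i t)) \<le> e * norm h"
        by (simp add: mult.commute)
    qed
    show "(\<lambda>n. Pn v n (?l 0)) sums Ser v (?l 0)"
      unfolding Ser_def by (rule summable_sums[OF summable_Pn[OF v]])
  qed auto
  then obtain g where g': "\<forall>t\<in>?S. (\<lambda>n. Pn v n (?l t)) sums g t
      \<and> (g has_derivative (\<lambda>h. h *\<^sub>R (\<Sum>i. d i t))) (at t within ?S)" ..
  have g: "\<And>t. t \<in> ?S \<Longrightarrow> (\<lambda>n. Pn v n (?l t)) sums g t"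
    "(g has_derivative (\<lambda>h. h *\<^sub>R (\<Sum>i. d i 0))) (at 0 within ?S)"
    using g' by (blast, simp)
  have "(g has_derivative (\<lambda>h. h *\<^sub>R (\<Sum>i. d i 0))) (at 0)"
    using g(2) by (simp add: at_within_open[of 0 ?S])
  then have "((\<lambda>t. Ser v (?l t)) has_derivative (\<lambda>h. h *\<^sub>R (\<Sum>i. d i 0))) (at 0)"
  proof (rule has_derivative_transform_within_open[where s = ?S])
    show "g t = Ser v (?l t)" if "t \<in> ?S" for t
      using g(1)[OF that] by (simp add: Ser_def sums_iff)
  qed auto
  then have "partial_dir j (Ser v) y = (\<Sum>i. d i 0)"
    unfolding partial_dir_def by (intro vector_derivative_at) (simp add: has_vector_derivative_def)
  also have "\<dots> = (\<Sum>i. d (Suc i) 0) + d 0 0"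
  proof -
    have "summable (\<lambda>i. d i 0)"
      by (rule summable_comparison_test'[OF sM]) (auto intro: dM)
    from suminf_split_head[OF this] show ?thesis by simp
  qed
  also have "\<dots> = Ser ?v y" by (simp add: d_def Ser_def)
  finally show ?thesis .
qed

text \<open>The Laplacian acting on coefficients: two shifts in each direction, with the sign from
  the square of the imaginary unit.\<close>

definition lap :: "(('n::finite \<Rightarrow> nat) \<Rightarrow> complex) \<Rightarrow> ('n \<Rightarrow> nat) \<Rightarrow> complex" where
  "lap v a = - (\<Sum>j\<in>UNIV. v (inc j (inc j a)))"

lemma adm_lap:
  fixes v :: "('n::finite \<Rightarrow> nat) \<Rightarrow> complex"
  assumes "adm C r v"
  shows "adm (C * (real CARD('n) * r\<^sup>2)) r (lap v)"
  unfolding adm_def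
proof
  fix a
  have "norm (lap v a) \<le> (\<Sum>j\<in>(UNIV::'n set). C * r ^ (mdeg a + 2))"
    unfolding lap_def norm_minus_cancel
    using assms by (intro sum_norm_le) (auto simp: adm_def dest: spec[of _ "inc _ (inc _ a)"])
  then show "norm (lap v a) \<le> C * (real CARD('n) * r\<^sup>2) * r ^ mdeg a"
    by (simp add: power_add power2_eq_square mult_ac)
qed

lemma laplacian_Ser:
  fixes v :: "('n::finite \<Rightarrow> nat) \<Rightarrow> complex"
  assumes v: "adm C r v" and r: "0 \<le> r" and C: "0 \<le> C"
  shows "laplacian (Ser v) = Ser (lap v)"
proof
  fix y
  let ?v = "\<lambda>i a. \<i> * v (inc i a)"
  let ?w = "\<lambda>i a. \<i> * (\<i> * v (inc i (inc i a)))"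
  have 1: "partial_dir i (Ser v) = Ser (?v i)" for i
    by (rule ext) (rule partial_dir_Ser[OF v r C])
  have v1: "adm (C * r) r (?v i)" for i by (rule adm_inc[OF v])
  have 2: "partial_dir i (Ser (?v i)) y = Ser (?w i) y" for i
    using partial_dir_Ser[OF v1 r] r C by simp
  have v2: "adm (C * r * r) r (?w i)" for i using adm_inc[OF v1, of i i] by simp
  have "laplacian (Ser v) y = (\<Sum>i\<in>UNIV. \<Sum>n. Pn (?w i) n y)"
    by (simp add: laplacian_def 1 2 Ser_def)
  also have "\<dots> = (\<Sum>n. \<Sum>i\<in>UNIV. Pn (?w i) n y)"
    by (rule suminf_sum[symmetric]) (rule summable_Pn[OF v2])
  also have "(\<lambda>n. \<Sum>i\<in>UNIV. Pn (?w i) n y) = (\<lambda>n. Pn (lap v) n y)"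
  proof
    fix n
    have "(\<Sum>i\<in>UNIV. Pn (?w i) n y) = (\<Sum>a\<in>midx n. (\<Sum>i\<in>UNIV. ?w i a) * ecoef (\<i> *s cvec y) a)"
      unfolding Pn_def sum_distrib_right by (rule sum.swap)
    also have "\<dots> = Pn (lap v) n y"
      unfolding Pn_def by (rule sum.cong) (auto simp: lap_def mult.assoc[symmetric] sum_negf)
    finally show "(\<Sum>i\<in>UNIV. Pn (?w i) n y) = Pn (lap v) n y" .
  qed
  finally show "laplacian (Ser v) y = Ser (lap v) y" unfolding Ser_def[of "lap v"] .
qed

lemma laplacian_power_Ser:
  fixes v :: "('n::finite \<Rightarrow> nat) \<Rightarrow> complex"
  assumes v: "adm C r v" and r: "0 \<le> r" and C: "0 \<le> C"
  shows "(laplacian ^^ k) (Ser v) = Ser ((lap ^^ k) v)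
    \<and> adm (C * (real CARD('n) * r\<^sup>2) ^ k) r ((lap ^^ k) v)"
proof (induction k)
  case (Suc k)
  then show ?case
    using laplacian_Ser[of "C * (real CARD('n) * r\<^sup>2) ^ k" r "(lap ^^ k) v"]
      adm_lap[of "C * (real CARD('n) * r\<^sup>2) ^ k" r "(lap ^^ k) v"] r C
    by (simp add: mult_ac)
qed (simp add: v)

subsection \<open>The heat semigroup applied to the kernel series\<close>

text \<open>A product majorant makes the family absolutely summable on pairs, so any grouping gives
  the same sum. The heat operator sums over powers of the Laplacian first, whereas the integrals
  need the grouping by total degree of the original coefficients.\<close>

lemma double_series_diagonal:
  fixes f :: "nat \<Rightarrow> nat \<Rightarrow> complex"
  assumes f: "\<And>m n. norm (f m n) \<le> A m * B n"
    and A: "summable A" "\<And>m. 0 \<le> A m" and B: "summable B" "\<And>n. 0 \<le> B n"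
  shows "(\<lambda>N. \<Sum>m\<le>N. f m (N - m)) sums (\<Sum>m. \<Sum>n. f m n)"
proof -
  have Bs: "B summable_on UNIV" using B by (simp add: summable_on_UNIV_nonneg_real_iff)
  have As: "A summable_on UNIV" using A by (simp add: summable_on_UNIV_nonneg_real_iff)
  have "(\<lambda>x. norm ((\<lambda>(m, n). A m * B n) x)) summable_on UNIV \<times> UNIV"
  proof (subst Infinite_Sum.abs_summable_on_Sigma_iff, intro conjI ballI)
    have n: "norm (A m * B n) = A m * B n" for m n using A B by simp
    show "(\<lambda>n. norm ((\<lambda>(m, n). A m * B n) (m, n))) summable_on UNIV" for m
      by (simp only: prod.case n) (rule summable_on_cmult_right[OF Bs])
    have "0 \<le> infsum B UNIV" using B by (intro infsum_nonneg) auto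
    then have n': "norm (A m * infsum B UNIV) = A m * infsum B UNIV" for m using A by simp
    have "(\<Sum>\<^sub>\<infinity>n. norm ((\<lambda>(m, n). A m * B n) (m, n))) = A m * infsum B UNIV" for m
      by (simp only: prod.case n infsum_cmult_right[OF Bs])
    then show "(\<lambda>m. norm (\<Sum>\<^sub>\<infinity>n. norm ((\<lambda>(m, n). A m * B n) (m, n)))) summable_on UNIV"
      by (simp only: n') (rule summable_on_cmult_left[OF As])
  qed
  then have "(\<lambda>x. norm ((\<lambda>(m, n). f m n) x)) summable_on UNIV \<times> UNIV"
    by (rule Infinite_Sum.abs_summable_on_comparison_test) (auto simp: A B intro!: order_trans[OF f])
  then have F: "(\<lambda>(m, n). f m n) summable_on UNIV \<times> UNIV"
    by (rule abs_summable_summable)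
  have fs: "summable (\<lambda>n. norm (f m n))" for m
    by (rule summable_comparison_test'[OF summable_mult[OF B(1), of "A m"], of 0]) (simp add: f)
  have inner: "infsum (f m) UNIV = (\<Sum>n. f m n)" for m
    by (intro infsumI norm_summable_imp_has_sum fs summable_sums summable_norm_cancel[OF fs])
  have "norm (\<Sum>n. f m n) \<le> A m * suminf B" for m
  proof -
    have "norm (\<Sum>n. f m n) \<le> (\<Sum>n. norm (f m n))" by (rule summable_norm[OF fs])
    also have "\<dots> \<le> (\<Sum>n. A m * B n)" by (rule suminf_le[OF f fs summable_mult[OF B(1)]])
    also have "\<dots> = A m * suminf B" by (rule suminf_mult[OF B(1)])
    finally show ?thesis .
  qed
  then have os: "summable (\<lambda>m. norm (\<Sum>n. f m n))"
    by (intro summable_comparison_test'[OF summable_mult2[OF A(1), of "suminf B"], of 0]) simp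
  have outer: "infsum (\<lambda>m. \<Sum>n. f m n) UNIV = (\<Sum>m. \<Sum>n. f m n)"
    by (intro infsumI norm_summable_imp_has_sum os summable_sums summable_norm_cancel[OF os])
  have S: "infsum (\<lambda>(m, n). f m n) (UNIV \<times> UNIV) = (\<Sum>m. \<Sum>n. f m n)"
    using infsum_Sigma'_banach[OF F] by (simp only: inner outer)
  let ?T = "Sigma (UNIV :: nat set) (\<lambda>N. {..N})"
  have bij: "bij_betw (\<lambda>(N, m). (m, N - m)) ?T (UNIV \<times> UNIV)"
    by (rule bij_betwI[where g = "\<lambda>(m, n). (m + n, m)"]) auto
  have eq: "(\<lambda>x. (\<lambda>(m, n). f m n) ((\<lambda>(N, m). (m, N - m)) x)) = (\<lambda>(N, m). f m (N - m))"
    by (auto simp: fun_eq_iff)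
  have T: "(\<lambda>(N, m). f m (N - m)) summable_on ?T"
    using summable_on_reindex_bij_betw[OF bij, of "\<lambda>(m, n). f m n"] F unfolding eq by simp
  have "infsum (\<lambda>(N, m). f m (N - m)) ?T = (\<Sum>m. \<Sum>n. f m n)"
    using infsum_reindex_bij_betw[OF bij, of "\<lambda>(m, n). f m n"] S unfolding eq by simp
  then have "infsum (\<lambda>N. \<Sum>m\<le>N. f m (N - m)) UNIV = (\<Sum>m. \<Sum>n. f m n)"
    using infsum_Sigma'_banach[OF T] by simp
  moreover have "(\<lambda>N. \<Sum>m\<le>N. f m (N - m)) summable_on UNIV"
    using summable_on_Sigma_banach[OF T] by simp
  ultimately show ?thesis
    by (metis has_sum_imp_sums has_sum_infsum)
qed

section \<open>Powers of the Laplacian through the coefficients of a Gaussian\<close>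

text \<open>The coefficients of exp(|t|^2 / 2) in several variables.\<close>

definition dd :: "('n::finite \<Rightarrow> nat) \<Rightarrow> complex" where
  "dd b = (\<Prod>i\<in>UNIV. dco (b i))"

text \<open>Up to the factor \<open>(- 2) ^ k * fact k\<close> this is the \<open>k\<close>-th iterate of \<open>lap\<close> for \<open>m = 2 * k\<close>,
  and it vanishes for odd \<open>m\<close>.\<close>

definition Dm :: "(('n::finite \<Rightarrow> nat) \<Rightarrow> complex) \<Rightarrow> nat \<Rightarrow> ('n \<Rightarrow> nat) \<Rightarrow> complex" where
  "Dm v m a = (\<Sum>b\<in>midx m. v (\<lambda>i. a i + b i) * dd b)"

lemma dd_split: "dd b = dco (b j) * (\<Prod>i\<in>UNIV - {j}. dco (b i))"
  unfolding dd_def by (rule prod.remove) auto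

lemma dd_inc_0: "b j = 0 \<Longrightarrow> dd (inc j b) = 0"
  by (subst dd_split[of _ j]) simp

lemma dd_inc_inc: "of_nat (Suc (Suc (b j))) * dd (inc j (inc j b)) = dd b"
proof -
  have "(\<Prod>i\<in>UNIV - {j}. dco (inc j (inc j b) i)) = (\<Prod>i\<in>UNIV - {j}. dco (b i))"
    by (rule prod.cong) (auto simp: inc_def)
  then have "of_nat (Suc (Suc (b j))) * dd (inc j (inc j b))
      = (of_nat (b j + 2) * dco (b j + 2)) * (\<Prod>i\<in>UNIV - {j}. dco (b i))"
    by (subst dd_split[of _ j]) (simp add: mult.assoc)
  then show ?thesis unfolding dco_rec by (simp only: dd_split[of b j])
qed

lemma sum_midx_dd_inc:
  fixes u :: "('n::finite \<Rightarrow> nat) \<Rightarrow> complex"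
  shows "(\<Sum>b\<in>midx (Suc m). of_nat (Suc (b j)) * (u (inc j b) * dd (inc j b)))
    = (\<Sum>b\<in>midx m. u (inc j (inc j b)) * dd b)"
proof -
  \<comment> \<open>At \<open>b j = 0\<close> the quotient is 0 by convention, which agrees with the
    original term because \<open>dd (inc j b)\<close> vanishes there.\<close>
  define G where "G b = of_nat (Suc (b j)) * (u (inc j b) * dd (inc j b)) / of_nat (b j)" for b
  have "(\<Sum>b\<in>midx (Suc m). of_nat (Suc (b j)) * (u (inc j b) * dd (inc j b)))
      = (\<Sum>b\<in>midx (Suc m). of_nat (b j) * G b)"
    by (intro sum.cong) (auto simp: G_def dd_inc_0)
  also have "\<dots> = (\<Sum>b\<in>midx m. of_nat (Suc (b j)) * G (inc j b))"
    by (rule sum_midx_Suc_shift)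
  also have "\<dots> = (\<Sum>b\<in>midx m. u (inc j (inc j b)) * dd b)"
  proof (intro sum.cong refl)
    fix b :: "'n \<Rightarrow> nat"
    have "of_nat (Suc (b j)) * G (inc j b) = u (inc j (inc j b)) * (of_nat (Suc (Suc (b j))) * dd (inc j (inc j b)))"
      using of_nat_neq_0[of "b j", where 'a = complex] by (simp add: G_def del: of_nat_Suc)
    then show "of_nat (Suc (b j)) * G (inc j b) = u (inc j (inc j b)) * dd b"
      unfolding dd_inc_inc .
  qed
  finally show ?thesis .
qed

lemma Dm_0: "Dm v 0 a = v a"
  by (simp add: Dm_def midx_0 dd_def)

lemma Dm_1: "Dm v (Suc 0) a = 0"
proof -
  have "of_nat (Suc 0) * Dm v (Suc 0) a = 0"
    unfolding Dm_def sum_midx_Suc by (simp add: midx_0 dd_inc_0)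
  then show ?thesis by simp
qed

text \<open>The degree operator sum_j t_j \<partial>_j multiplies exp(|t|^2 / 2) by |t|^2. On
  coefficients this trades two degrees of b for a double shift of a.\<close>

lemma Dm_rec: "of_nat (m + 2) * Dm v (m + 2) a = (\<Sum>j\<in>UNIV. Dm v m (inc j (inc j a)))"
proof -
  have "of_nat (Suc (Suc m)) * Dm v (Suc (Suc m)) a
      = (\<Sum>j\<in>UNIV. \<Sum>b\<in>midx m. v (\<lambda>i. a i + inc j (inc j b) i) * dd b)"
    unfolding Dm_def sum_midx_Suc sum_midx_dd_inc[where u = "\<lambda>b. v (\<lambda>i. a i + b i)"] ..
  moreover have "(\<lambda>i. a i + inc j (inc j b) i) = (\<lambda>i. inc j (inc j a) i + b i)" for j b
    by (auto simp: inc_def)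
  ultimately show ?thesis by (simp add: Dm_def)
qed

lemma Dm_odd: "Dm v (2 * k + 1) a = 0"
proof (induction k arbitrary: a)
  case 0
  then show ?case by (simp add: Dm_1)
next
  case (Suc k)
  have "of_nat (2 * k + 1 + 2) * Dm v (2 * k + 1 + 2) a = 0"
    unfolding Dm_rec using Suc by simp
  then show ?case by (simp only: mult_eq_0_iff of_nat_eq_0_iff) (simp add: add.commute)
qed

text \<open>Each application of \<open>lap\<close> contributes the factor -(2 k + 2) from
  \<open>Dm_rec\<close>, and these factors multiply to (-2)^k k!.\<close>

lemma lap_power: "(lap ^^ k) v a = (- 2) ^ k * fact k * Dm v (2 * k) a"
proof (induction k arbitrary: a)
  case 0
  then show ?case by (simp add: Dm_0)
next
  case (Suc k)
  have "(lap ^^ Suc k) v a = - (\<Sum>j\<in>UNIV. (- 2) ^ k * fact k * Dm v (2 * k) (inc j (inc j a)))"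
    by (simp add: lap_def Suc)
  also have "\<dots> = - ((- 2) ^ k * fact k * (of_nat (2 * k + 2) * Dm v (2 * k + 2) a))"
    unfolding Dm_rec by (simp add: sum_distrib_left)
  also have "\<dots> = (- 2) ^ Suc k * fact (Suc k) * Dm v (2 * Suc k) a"
    by (simp add: fact_Suc algebra_simps)
  finally show ?case .
qed

text \<open>The absolute mass of the Gaussian coefficients of degree m; the type argument only
  carries the number of variables.\<close>

definition del :: "'n::finite itself \<Rightarrow> nat \<Rightarrow> real" where
  "del _ m = (\<Sum>b\<in>(midx m :: ('n \<Rightarrow> nat) set). norm (dd b))"

lemma adm_Dm:
  fixes v :: "('n::finite \<Rightarrow> nat) \<Rightarrow> complex"
  assumes "adm 1 r v"
  shows "adm (r ^ m * del TYPE('n) m) r (Dm v m)"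
  unfolding adm_def
proof
  fix a :: "'n \<Rightarrow> nat"
  have "norm (Dm v m a) \<le> (\<Sum>b\<in>(midx m :: ('n \<Rightarrow> nat) set). r ^ mdeg a * r ^ m * norm (dd b))"
    unfolding Dm_def
  proof (rule sum_norm_le)
    fix b :: "'n \<Rightarrow> nat" assume b: "b \<in> midx m"
    have "norm (v (\<lambda>i. a i + b i)) \<le> 1 * r ^ mdeg (\<lambda>i. a i + b i)"
      using assms unfolding adm_def by blast
    also have "\<dots> = r ^ mdeg a * r ^ m"
      using b by (simp add: midx_def mdeg_def sum.distrib power_add)
    finally show "norm (v (\<lambda>i. a i + b i) * dd b) \<le> r ^ mdeg a * r ^ m * norm (dd b)"
      unfolding norm_mult by (rule mult_right_mono) simp
  qed
  also have "\<dots> = r ^ m * del TYPE('n) m * r ^ mdeg a"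
    by (simp add: del_def sum_distrib_left mult_ac)
  finally show "norm (Dm v m a) \<le> r ^ m * del TYPE('n) m * r ^ mdeg a" .
qed

lemma summable_del: "0 \<le> r \<Longrightarrow> summable (\<lambda>m. r ^ m * del TYPE('n::finite) m)"
proof (rule summableI_nonneg_bounded)
  assume r: "0 \<le> r"
  show "0 \<le> r ^ m * del TYPE('n) m" for m using r by (simp add: del_def sum_nonneg)
  fix M
  have "(\<Sum>m<M. r ^ m * del TYPE('n) m) \<le> (\<Sum>m\<le>M. r ^ m * del TYPE('n) m)"
    using r by (intro sum_mono2) (auto simp: del_def sum_nonneg)
  also have "\<dots> = (\<Sum>m\<le>M. \<Sum>b\<in>(midx m :: ('n \<Rightarrow> nat) set). \<Prod>j\<in>UNIV. r ^ b j * norm (dco (b j)))"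
    unfolding del_def sum_distrib_left
    by (intro sum.cong refl) (auto simp: midx_def dd_def prod.distrib prod_norm power_mdeg[symmetric])
  also have "\<dots> \<le> (\<Prod>j\<in>(UNIV::'n set). exp (r\<^sup>2 / 2))"
    using r by (intro sum_midx_prod_le sum_norm_dco_le) auto
  finally show "(\<Sum>m<M. r ^ m * del TYPE('n) m) \<le> (\<Prod>j\<in>(UNIV::'n set). exp (r\<^sup>2 / 2))" .
qed

text \<open>Both sides group the product of exp(|t|^2 / 2) and exp(i y \<bullet> t) by total degree.
  Triples (m, a, b) correspond to pairs (c, a) with c = a + b, and for fixed c the sum over a
  factors over the coordinates into the polynomials \<open>hp\<close>.\<close>

lemma sum_Dm_eq_hp:
  fixes v :: "('n::finite \<Rightarrow> nat) \<Rightarrow> complex"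
  shows "(\<Sum>m\<le>N. Pn (Dm v m) (N - m) y) = (\<Sum>c\<in>midx N. v c * (\<Prod>j\<in>UNIV. poly (hp (c j)) (of_real (y $ j))))"
proof -
  let ?e = "\<lambda>a. ecoef (\<i> *s cvec y) a"
  let ?S = "Sigma {..N} (\<lambda>m. midx (N - m) \<times> (midx m :: ('n \<Rightarrow> nat) set))"
  let ?T = "Sigma (midx N) (\<lambda>c. PiE UNIV (\<lambda>j::'n. {..c j}))"
  have "(\<Sum>m\<le>N. Pn (Dm v m) (N - m) y)
      = (\<Sum>m\<le>N. \<Sum>(a, b)\<in>midx (N - m) \<times> midx m. v (\<lambda>i. a i + b i) * dd b * ?e a)"
    unfolding Pn_def Dm_def sum_distrib_right by (simp add: sum.cartesian_product)
  also have "\<dots> = (\<Sum>(m, ab)\<in>?S. case ab of (a, b) \<Rightarrow> v (\<lambda>i. a i + b i) * dd b * ?e a)"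
    by (rule sum.Sigma) auto
  also have "\<dots> = (\<Sum>(c, a)\<in>?T. v c * (dd (\<lambda>j. c j - a j) * ?e a))"
  proof (rule sum.reindex_bij_witness[where
        i = "\<lambda>(c, a). (mdeg (\<lambda>j. c j - a j), a, (\<lambda>j. c j - a j))" and
        j = "\<lambda>(m, a, b). ((\<lambda>i. a i + b i), a)"], goal_cases)
    case (4 x)
    then obtain c a where x: "x = (c, a)" and c: "mdeg c = N" and a: "\<And>j. a j \<le> c j"
      by (auto simp: midx_def)
    have "mdeg (\<lambda>j. c j - a j) + mdeg a = N"
      using a c by (simp add: mdeg_def sum.distrib[symmetric])
    then show ?case using x by (auto simp: midx_def)
  qed (auto simp: midx_def mdeg_def sum.distrib fun_eq_iff PiE_iff)
  also have "\<dots> = (\<Sum>c\<in>midx N. \<Sum>a\<in>PiE UNIV (\<lambda>j::'n. {..c j}). v c * (dd (\<lambda>j. c j - a j) * ?e a))"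
    by (rule sum.Sigma[symmetric]) (auto intro: finite_PiE)
  also have "\<dots> = (\<Sum>c\<in>midx N. v c * (\<Prod>j\<in>UNIV. poly (hp (c j)) (of_real (y $ j))))"
  proof (intro sum.cong refl)
    fix c :: "'n \<Rightarrow> nat"
    have "(\<Prod>j\<in>UNIV. poly (hp (c j)) (of_real (y $ j)))
        = (\<Sum>a\<in>PiE UNIV (\<lambda>j::'n. {..c j}). \<Prod>j\<in>UNIV. dco (c j - a j) * ((\<i> * of_real (y $ j)) ^ a j / fact (a j)))"
      unfolding poly_hp by (rule prod_sum_PiE) auto
    also have "\<dots> = (\<Sum>a\<in>PiE UNIV (\<lambda>j::'n. {..c j}). dd (\<lambda>j. c j - a j) * ?e a)"
      by (simp add: dd_def ecoef_def prod.distrib[symmetric])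
    finally show "(\<Sum>a\<in>PiE UNIV (\<lambda>j::'n. {..c j}). v c * (dd (\<lambda>j. c j - a j) * ?e a))
        = v c * (\<Prod>j\<in>UNIV. poly (hp (c j)) (of_real (y $ j)))"
      by (simp add: sum_distrib_left)
  qed
  finally show ?thesis .
qed

lemma Ser_scale:
  assumes "adm C r v" shows "Ser (\<lambda>a. s * v a) y = s * Ser v y"
proof -
  have "Pn (\<lambda>a. s * v a) n y = s * Pn v n y" for n
    by (simp add: Pn_def sum_distrib_left mult.assoc)
  then show ?thesis
    unfolding Ser_def using suminf_mult[OF summable_Pn[OF assms]] by simp
qed

text \<open>The scalar of the k-th term is the inverse of the factor (-2)^k k! in
  \<open>lap_power\<close>, so only \<open>Dm v (2 * k)\<close> remains. Inserting the vanishing odd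
  indices gives a full double series, which is regrouped by total degree.\<close>

lemma heat_Ser:
  fixes v :: "('n::finite \<Rightarrow> nat) \<Rightarrow> complex"
  assumes v: "adm 1 r v" and r: "0 \<le> r"
  shows "(\<lambda>N. \<Sum>c\<in>midx N. v c * (\<Prod>j\<in>UNIV. poly (hp (c j)) (of_real (y $ j))))
    sums (\<Sum>k. complex_of_real ((- 1) ^ k / (2 ^ k * fact k)) * (laplacian ^^ k) (Ser v) y)"
proof -
  have "complex_of_real ((- 1) ^ k / (2 ^ k * fact k)) * (laplacian ^^ k) (Ser v) y = Ser (Dm v (2 * k)) y" for k
  proof -
    have "(laplacian ^^ k) (Ser v) y = Ser ((lap ^^ k) v) y"
      using laplacian_power_Ser[OF v r] by simp
    also have "(lap ^^ k) v = (\<lambda>a. (- 2) ^ k * fact k * Dm v (2 * k) a)"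
      by (rule ext) (rule lap_power)
    also have "Ser \<dots> y = (- 2) ^ k * fact k * Ser (Dm v (2 * k)) y"
      by (rule Ser_scale[OF adm_Dm[OF v]])
    also have "complex_of_real ((- 1) ^ k / (2 ^ k * fact k)) * \<dots> = Ser (Dm v (2 * k)) y"
    proof -
      have "complex_of_real ((- 1) ^ k / (2 ^ k * fact k)) * ((- 2) ^ k * fact k) = 1"
      proof -
        have "(- 1) ^ k * (- 2) ^ k = (2 :: complex) ^ k" by (simp flip: power_mult_distrib)
        then have "((- 1) ^ k / (2 ^ k * fact k)) * ((- 2) ^ k * fact k) = (1 :: complex)"
          by (simp add: divide_simps)
        then show ?thesis by simp
      qed
      then show ?thesis by (simp only: mult.assoc[symmetric]) simp
    qed
    finally show ?thesis .
  qed
  then have "(\<Sum>k. complex_of_real ((- 1) ^ k / (2 ^ k * fact k)) * (laplacian ^^ k) (Ser v) y)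
      = (\<Sum>k. Ser (Dm v (2 * k)) y)" by simp
  also have "\<dots> = (\<Sum>m. Ser (Dm v m) y)"
  proof (rule suminf_mono_reindex[of "\<lambda>k. 2 * k" "\<lambda>m. Ser (Dm v m) y"])
    fix m :: nat assume "m \<notin> range (\<lambda>k. 2 * k)"
    then have "odd m" by auto
    then obtain k where m: "m = 2 * k + 1" using oddE by blast
    show "Ser (Dm v m) y = 0" unfolding m Ser_def Pn_def Dm_odd by simp
  qed (auto simp: strict_mono_def)
  also have "\<dots> = (\<Sum>m. \<Sum>n. Pn (Dm v m) n y)" by (simp add: Ser_def)
  finally have e: "(\<Sum>k. complex_of_real ((- 1) ^ k / (2 ^ k * fact k)) * (laplacian ^^ k) (Ser v) y) = \<dots>" .
  show ?thesis
    unfolding e sum_Dm_eq_hp[symmetric]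
  proof (rule double_series_diagonal)
    show "norm (Pn (Dm v m) n y) \<le> (r ^ m * del TYPE('n) m) * ((r * (\<Sum>i\<in>UNIV. \<bar>y $ i\<bar>)) ^ n / fact n)" for m n
      by (rule norm_Pn_le[OF adm_Dm[OF v]])
    show "summable (\<lambda>m. r ^ m * del TYPE('n) m)" by (rule summable_del[OF r])
    show "summable (\<lambda>n. (r * (\<Sum>i\<in>UNIV. \<bar>y $ i\<bar>)) ^ n / fact n)" by (rule summable_exp_real)
  qed (use r in \<open>auto simp: del_def intro!: sum_nonneg mult_nonneg_nonneg\<close>)
qed

subsection \<open>The integral representation\<close>

lemma prod_gexp:
  "(\<Prod>j\<in>UNIV. gexp (y $ j) (x $ j))
     = exp (- \<i> * complex_of_real (x \<bullet> y)) * exp (- complex_of_real (norm x ^ 2 / 2))"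
proof -
  have "(\<Prod>j\<in>UNIV. gexp (y $ j) (x $ j))
      = exp (\<Sum>j\<in>UNIV. - \<i> * of_real (y $ j) * of_real (x $ j) - (of_real (x $ j))\<^sup>2 / 2)"
    unfolding gexp_def by (simp add: exp_sum)
  also have "(\<Sum>j\<in>UNIV. - \<i> * of_real (y $ j) * of_real (x $ j) - (of_real (x $ j))\<^sup>2 / 2)
      = - \<i> * complex_of_real (x \<bullet> y) + - complex_of_real (norm x ^ 2 / 2)"
  proof -
    have "norm x ^ 2 = (\<Sum>j\<in>UNIV. (x $ j)\<^sup>2)"
      unfolding power2_norm_eq_inner inner_vec_def by (simp add: power2_eq_square)
    then show ?thesis
      by (simp add: inner_vec_def sum_subtractf sum_distrib_left sum_divide_distrib sum_negf mult_ac)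
  qed
  finally show ?thesis by (simp only: exp_add)
qed

lemma gexp_0: "gexp 0 t = of_real (exp (- (t\<^sup>2 / 2)))"
  unfolding gexp_def by (simp flip: exp_of_real)

lemma prod_gexp_0: "(\<Prod>j\<in>UNIV. gexp 0 (y $ j)) = exp (- complex_of_real (norm y ^ 2 / 2))"
  using prod_gexp[of 0 y] by simp

lemma fourier_constant:
  "complex_of_real ((2 * pi) powr (- real CARD('n::finite) / 2)) * (\<Prod>j\<in>(UNIV::'n set). complex_of_real (sqrt (2 * pi))) = 1"
proof -
  have "sqrt (2 * pi) ^ CARD('n) = (2 * pi) powr (real CARD('n) / 2)"
    by (simp add: powr_half_sqrt[symmetric] powr_powr flip: powr_realpow)
  then have "(2 * pi) powr (- real CARD('n) / 2) * sqrt (2 * pi) ^ CARD('n) = 1"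
    by (simp flip: powr_add)
  then have "complex_of_real ((2 * pi) powr (- real CARD('n) / 2) * sqrt (2 * pi) ^ CARD('n)) = 1"
    by (simp only: of_real_1)
  then show ?thesis by simp
qed

lemma integrable_norm_poly_exp_gauss:
  fixes Q :: "complex poly"
  shows "integrable lborel (\<lambda>x. norm (poly Q (of_real x)) * exp (s * \<bar>x\<bar>) * exp (- (x\<^sup>2 / 2)))"
proof -
  have "integrable lborel (\<lambda>x. coeff Q i * ((of_real x) ^ i * complex_of_real (exp (s * \<bar>x\<bar>) * exp (- (x\<^sup>2 / 2)))))" for i
    by (intro integrable_mult_right, rule Bochner_Integration.integrable_bound[OF integrable_moment_exp_gauss[of i s]])
      (auto simp: norm_mult norm_power)
  then have "integrable lborel (\<lambda>x. \<Sum>i\<le>degree Q. coeff Q i * ((of_real x) ^ i * complex_of_real (exp (s * \<bar>x\<bar>) * exp (- (x\<^sup>2 / 2)))))"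
    by (intro Bochner_Integration.integrable_sum) auto
  then have "integrable lborel (\<lambda>x. poly Q (of_real x) * complex_of_real (exp (s * \<bar>x\<bar>) * exp (- (x\<^sup>2 / 2))))"
    by (simp add: poly_altdef sum_distrib_right mult.assoc)
  from integrable_norm[OF this] show ?thesis by (simp add: norm_mult mult.assoc)
qed

lemma integrable_power_gexp: "integrable lborel (\<lambda>t. ((- of_real t) ^ k / fact k) * gexp y t)"
  using integrable_poly_gexp[of "monom ((- 1) ^ k / fact k) k" y]
  by (simp add: poly_monom power_minus[of "of_real _"])

theorem mainTheorem2:
  fixes R Rp :: "(real^'n::finite) set" and \<kappa> :: "real^'n \<Rightarrow> real"
    and p :: "real^'n \<Rightarrow> complex" and z :: "real^'n"
  assumes "root_system R" and "positive_subsystem R Rp" and "multiplicity R \<kappa>"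
    and "poly_fun p"
  shows "integrable lborel (\<lambda>y. Kfun R Rp \<kappa> y z *
            fourier (\<lambda>x. p x * exp (- complex_of_real (norm x ^ 2 / 2))) y)
    \<and> integrable lborel (\<lambda>y.
            fourier (\<lambda>x. exp (- complex_of_real (norm x ^ 2 / 2)) *
                        dunkl_kernel R Rp \<kappa> (cvec x) (cvec (- z))) y *
            fourier (\<lambda>x. exp (- complex_of_real (norm x ^ 2 / 2)) * p x) y *
            exp (complex_of_real (norm y ^ 2 / 2)))
    \<and> Vfun R Rp \<kappa> p z = complex_of_real ((2 * pi) powr (- real CARD('n) / 2)) *
        (\<integral>y. Kfun R Rp \<kappa> y z *
            fourier (\<lambda>x. p x * exp (- complex_of_real (norm x ^ 2 / 2))) y \<partial>lborel)
    \<and> Vfun R Rp \<kappa> p z = complex_of_real ((2 * pi) powr (- real CARD('n) / 2)) *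
        (\<integral>y. fourier (\<lambda>x. exp (- complex_of_real (norm x ^ 2 / 2)) *
                        dunkl_kernel R Rp \<kappa> (cvec x) (cvec (- z))) y *
            fourier (\<lambda>x. exp (- complex_of_real (norm x ^ 2 / 2)) * p x) y *
            exp (complex_of_real (norm y ^ 2 / 2)) \<partial>lborel)"
proof -
  obtain v :: "('n \<Rightarrow> nat) \<Rightarrow> complex"
    where v: "\<And>a. norm (v a) \<le> norm z ^ mdeg a"
    and E1: "\<And>y. dunkl_kernel R Rp \<kappa> (\<chi> i. \<i> * complex_of_real (y $ i)) (cvec z)
      = (\<Sum>n. \<Sum>a\<in>midx n. v a * ecoef (\<i> *s cvec y) a)"
    and E2: "\<And>x. dunkl_kernel R Rp \<kappa> (cvec x) (cvec (- z))
      = (\<Sum>n. \<Sum>a\<in>midx n. v a * ecoef (- cvec x) a)"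
    and Vf: "\<And>c p. c \<in> polys \<Longrightarrow> (\<And>x. p x = peval c (cvec x)) \<Longrightarrow>
      Vfun R Rp \<kappa> p z = (\<Sum>a | c a \<noteq> 0. c a * v a)"
    by (rule dunkl_kernel_series[OF assms(1-3), where z = z]) blast
  obtain c where c: "c \<in> polys" and p: "\<And>x. p x = peval c (cvec x)"
    using assms(4) by (auto simp: poly_fun_def)
  define r where "r = norm z"
  have r: "0 \<le> r" and v: "\<And>a. norm (v a) \<le> r ^ mdeg a" using v by (auto simp: r_def)
  have adm: "adm 1 r v" using v by (simp add: adm_def)
  let ?B = "{a. c a \<noteq> 0}"
  have finB: "finite ?B" using c by (simp add: polys_def)
  let ?c0 = "complex_of_real ((2 * pi) powr (- real CARD('n) / 2))"
  let ?s = "complex_of_real (sqrt (2 * pi))"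
  define H where "H a y = (\<Prod>j\<in>UNIV. poly (hp (a j)) (of_real (y $ j)))" for a and y :: "real^'n"
  define K where "K y = (\<Sum>n. \<Sum>a\<in>midx n. v a * H a y)" for y
  have Ksums: "(\<lambda>n. \<Sum>a\<in>midx n. v a * H a y) sums Kfun R Rp \<kappa> y z" for y
  proof -
    have "(\<lambda>y'. dunkl_kernel R Rp \<kappa> (\<chi> i. \<i> * complex_of_real (y' $ i)) (cvec z)) = Ser v"
      unfolding E1 Ser_def Pn_def ..
    then show ?thesis
      using heat_Ser[OF adm r, of y] unfolding Kfun_def H_def by simp
  qed
  have Kfun: "Kfun R Rp \<kappa> y z = K y" for y
    using Ksums[of y] by (simp add: K_def sums_iff)
  have Ksummable: "summable (\<lambda>n. \<Sum>a\<in>midx n. v a * H a y)" for y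
    using Ksums by (rule sums_summable)
  \<comment> \<open>The sign in - z has become a sign of x, so each monomial produces the moments
    whose transforms are Hermite polynomials times a Gaussian; the series of these is the heat
    series \<open>K\<close>.\<close>
  have f1: "fourier (\<lambda>x. exp (- complex_of_real (norm x ^ 2 / 2)) *
      dunkl_kernel R Rp \<kappa> (cvec x) (cvec (- z))) y = K y * exp (- complex_of_real (norm y ^ 2 / 2))" for y
  proof -
    define g where "g j k t = ((- of_real t) ^ k / fact k) * gexp (y $ j) t" for j k and t :: real
    have "exp (- \<i> * complex_of_real (x \<bullet> y)) * (exp (- complex_of_real (norm x ^ 2 / 2)) *
        dunkl_kernel R Rp \<kappa> (cvec x) (cvec (- z)))
      = (\<Sum>n. \<Sum>a\<in>midx n. v a * (\<Prod>j\<in>UNIV. g j (a j) (x $ j)))" for x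
    proof -
      have "(\<Prod>j\<in>UNIV. g j (a j) (x $ j)) = (\<Prod>j\<in>UNIV. gexp (y $ j) (x $ j)) * ecoef (- cvec x) a" for a
        unfolding g_def ecoef_def prod.distrib[symmetric] by (intro prod.cong refl) (simp add: mult.commute)
      then have "(\<Sum>a\<in>midx n. v a * (\<Prod>j\<in>UNIV. g j (a j) (x $ j)))
          = (\<Prod>j\<in>UNIV. gexp (y $ j) (x $ j)) * (\<Sum>a\<in>midx n. v a * ecoef (- cvec x) a)" for n
        unfolding sum_distrib_left by (intro sum.cong) (auto simp: mult_ac)
      then show ?thesis
        unfolding E2 prod_gexp by (simp add: suminf_mult summable_sum_ecoef[OF adm] mult.assoc)
    qed
    then have "fourier (\<lambda>x. exp (- complex_of_real (norm x ^ 2 / 2)) * dunkl_kernel R Rp \<kappa> (cvec x) (cvec (- z))) y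
        = ?c0 * (\<integral>x. (\<Sum>n. \<Sum>a\<in>midx n. v a * (\<Prod>j\<in>UNIV. g j (a j) (x $ j))) \<partial>lborel)"
      unfolding fourier_def by simp
    also have "(\<integral>x. (\<Sum>n. \<Sum>a\<in>midx n. v a * (\<Prod>j\<in>UNIV. g j (a j) (x $ j))) \<partial>lborel)
        = (\<Sum>n. \<Sum>a\<in>midx n. v a * (\<Prod>j\<in>UNIV. \<integral>t. g j (a j) t \<partial>lborel))"
    proof (rule series_product_integral(2)[OF r v])
      show "integrable lborel (g j k)" for j k
        unfolding g_def by (rule integrable_power_gexp)
      show "integrable lborel (\<lambda>t::real. \<bar>t\<bar> ^ 0 * exp (r * \<bar>t\<bar>) * exp (- (t\<^sup>2 / 2)))" for j :: 'n
        by (rule integrable_moment_exp_gauss)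
      show "(\<Sum>k\<le>N. r ^ k * norm (g j k t)) \<le> \<bar>t\<bar> ^ 0 * exp (r * \<bar>t\<bar>) * exp (- (t\<^sup>2 / 2))" for j N t
      proof -
        have "(\<Sum>k\<le>N. r ^ k * norm (g j k t)) = (\<Sum>k<Suc N. (r * \<bar>t\<bar>) ^ k / fact k) * exp (- (t\<^sup>2 / 2))"
          unfolding sum_distrib_right lessThan_Suc_atMost
          by (intro sum.cong) (auto simp: g_def norm_mult norm_divide norm_power norm_gexp power_mult_distrib)
        also have "\<dots> \<le> exp (r * \<bar>t\<bar>) * exp (- (t\<^sup>2 / 2))"
          using r by (intro mult_right_mono sum_power_fact_le_exp) auto
        finally show ?thesis by simp
      qed
    qed
    also have "(\<lambda>n. \<Sum>a\<in>midx n. v a * (\<Prod>j\<in>UNIV. \<integral>t. g j (a j) t \<partial>lborel))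
        = (\<lambda>n. (\<Prod>j\<in>(UNIV::'n set). ?s) * (\<Prod>j\<in>UNIV. gexp 0 (y $ j)) * (\<Sum>a\<in>midx n. v a * H a y))"
      unfolding sum_distrib_left g_def integral_power_gexp gexp_0[symmetric]
      by (intro ext sum.cong) (auto simp: H_def prod.distrib mult_ac)
    also have "(\<Sum>n. (\<Prod>j\<in>(UNIV::'n set). ?s) * (\<Prod>j\<in>UNIV. gexp 0 (y $ j)) * (\<Sum>a\<in>midx n. v a * H a y))
        = (\<Prod>j\<in>(UNIV::'n set). ?s) * (\<Prod>j\<in>UNIV. gexp 0 (y $ j)) * K y"
      unfolding K_def by (rule suminf_mult[OF Ksummable])
    also have "?c0 * ((\<Prod>j\<in>(UNIV::'n set). ?s) * (\<Prod>j\<in>UNIV. gexp 0 (y $ j)) * K y)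
        = (?c0 * (\<Prod>j\<in>(UNIV::'n set). ?s)) * (K y * (\<Prod>j\<in>UNIV. gexp 0 (y $ j)))"
      by (simp only: mult_ac)
    finally show ?thesis unfolding fourier_constant prod_gexp_0 by simp
  qed
  \<comment> \<open>This is the Fourier transform of x^b times the Gaussian: the factor (-1)^|b| b!
    undoes the normalisation (- x)^b / b! of the moments.\<close>
  define \<Phi> where "\<Phi> b y = (\<Prod>j\<in>UNIV. (- 1) ^ b j * fact (b j) * poly (hp (b j)) (of_real (y $ j)) * gexp 0 (y $ j))"
    for b and y :: "real^'n"
  have f2: "fourier (\<lambda>x. p x * exp (- complex_of_real (norm x ^ 2 / 2))) y = (\<Sum>b\<in>?B. c b * \<Phi> b y)" for y
  proof -
    define g where "g b j t = (- 1) ^ b j * fact (b j) * (((- of_real t) ^ b j / fact (b j)) * gexp (y $ j) t)"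
      for b and j :: 'n and t :: real
    have gint: "integrable lborel (g b j)" for b j
      unfolding g_def by (intro integrable_mult_right integrable_power_gexp)
    have "exp (- \<i> * complex_of_real (x \<bullet> y)) * (p x * exp (- complex_of_real (norm x ^ 2 / 2)))
        = (\<Sum>b\<in>?B. c b * (\<Prod>j\<in>UNIV. g b j (x $ j)))" for x
    proof -
      have "mon b (cvec x) * (\<Prod>j\<in>UNIV. gexp (y $ j) (x $ j)) = (\<Prod>j\<in>UNIV. g b j (x $ j))" for b
        unfolding mon_def prod.distrib[symmetric]
        by (intro prod.cong refl) (simp add: g_def flip: power_mult_distrib)
      then have "p x * (\<Prod>j\<in>UNIV. gexp (y $ j) (x $ j)) = (\<Sum>b\<in>?B. c b * (\<Prod>j\<in>UNIV. g b j (x $ j)))"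
        unfolding p by (subst peval_eq_sum[OF finB]) (auto simp: sum_distrib_right mult.assoc)
      then show ?thesis unfolding prod_gexp by (simp add: mult_ac)
    qed
    then have "fourier (\<lambda>x. p x * exp (- complex_of_real (norm x ^ 2 / 2))) y
        = ?c0 * (\<integral>x. (\<Sum>b\<in>?B. c b * (\<Prod>j\<in>UNIV. g b j (x $ j))) \<partial>lborel)"
      unfolding fourier_def by simp
    also have "\<dots> = ?c0 * (\<Sum>b\<in>?B. c b * (\<Prod>j\<in>UNIV. \<integral>t. g b j t \<partial>lborel))"
      by (subst Bochner_Integration.integral_sum)
        (auto intro!: integrable_mult_right integrable_prod_vec gint simp: integral_prod_vec[OF gint])
    also have "\<dots> = ?c0 * (\<Sum>b\<in>?B. c b * ((\<Prod>j\<in>(UNIV::'n set). ?s) * \<Phi> b y))"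
    proof -
      have "(\<integral>t. g b j t \<partial>lborel)
          = ?s * ((- 1) ^ b j * fact (b j) * poly (hp (b j)) (of_real (y $ j)) * gexp 0 (y $ j))" for b j
        unfolding g_def integral_mult_right_zero integral_power_gexp gexp_0 by (simp only: mult_ac)
      then show ?thesis by (simp only: \<Phi>_def prod.distrib)
    qed
    also have "\<dots> = (?c0 * (\<Prod>j\<in>(UNIV::'n set). ?s)) * (\<Sum>b\<in>?B. c b * \<Phi> b y)"
      by (simp only: sum_distrib_left) (simp only: mult_ac)
    finally show ?thesis unfolding fourier_constant by simp
  qed
  have KPhi: "integrable lborel (\<lambda>y. K y * \<Phi> b y)"
      "(\<integral>y. K y * \<Phi> b y \<partial>lborel) = (\<Prod>j\<in>(UNIV::'n set). ?s) * v b" for b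
  proof -
    \<comment> \<open>The whole j-th factor of \<Phi> is absorbed into the one-variable functions,
      so that the series with \<Phi> is again one of products.\<close>
    define g where "g j k t = poly (hp k) (of_real t) * ((- 1) ^ b j * fact (b j) * poly (hp (b j)) (of_real t) * gexp 0 t)"
      for j k and t :: real
    have g': "g j k t = (- 1) ^ b j * fact (b j) * (poly (hp k) (of_real t) * poly (hp (b j)) (of_real t) * gexp 0 t)" for j k t
      by (simp add: g_def mult_ac)
    have eq: "K y * \<Phi> b y = (\<Sum>n. \<Sum>a\<in>midx n. v a * (\<Prod>j\<in>UNIV. g j (a j) (y $ j)))" for y
    proof -
      have "(\<Sum>a\<in>midx n. v a * (\<Prod>j\<in>UNIV. g j (a j) (y $ j))) = (\<Sum>a\<in>midx n. v a * H a y) * \<Phi> b y" for n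
        unfolding sum_distrib_right by (intro sum.cong) (auto simp: g_def H_def \<Phi>_def prod.distrib mult_ac)
      then show ?thesis unfolding K_def by (simp add: suminf_mult2[OF Ksummable])
    qed
    have gint: "integrable lborel (g j k)" for j k
      using integrable_mult_right[OF integrable_poly_gexp[of "hp k * hp (b j)" 0], of "(- 1) ^ b j * fact (b j)"]
      unfolding g' by simp
    \<comment> \<open>The bound of \<open>sum_norm_hp_le\<close> times the polynomial and the
      Gaussian from \<Phi>, which keeps it integrable.\<close>
    define G where "G j t = exp (r\<^sup>2 / 2) * fact (b j)
        * (norm (poly (hp (b j)) (of_real t)) * exp (r * \<bar>t\<bar>) * exp (- (t\<^sup>2 / 2)))" for j t
    have Gint: "integrable lborel (G j)" for j
      unfolding G_def by (intro integrable_mult_right integrable_norm_poly_exp_gauss)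
    have bnd: "(\<Sum>k\<le>N. r ^ k * norm (g j k t)) \<le> G j t" for j N t
    proof -
      have "(\<Sum>k\<le>N. r ^ k * norm (g j k t)) = (\<Sum>k\<le>N. r ^ k * norm (poly (hp k) (of_real t)))
          * (fact (b j) * norm (poly (hp (b j)) (of_real t)) * exp (- (t\<^sup>2 / 2)))"
        unfolding sum_distrib_right
        by (intro sum.cong) (auto simp: g_def norm_mult norm_power norm_gexp)
      also have "\<dots> \<le> (exp (r\<^sup>2 / 2) * exp (r * \<bar>t\<bar>)) * (fact (b j) * norm (poly (hp (b j)) (of_real t)) * exp (- (t\<^sup>2 / 2)))"
        by (intro mult_right_mono sum_norm_hp_le[OF r]) auto
      finally show ?thesis by (simp add: G_def mult_ac)
    qed
    show "integrable lborel (\<lambda>y. K y * \<Phi> b y)"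
      unfolding eq by (rule series_product_integral(1)[OF r v gint Gint bnd])
    \<comment> \<open>The constants (-1)^l / l! of the orthogonality relation cancel against the
      normalisation in \<Phi>.\<close>
    have gi: "(\<integral>t. g j k t \<partial>lborel) = (if k = b j then ?s else 0)" for j k
    proof -
      have "(- 1) ^ b j * (- 1) ^ b j = (1 :: complex)" by (simp flip: power_mult_distrib)
      then show ?thesis unfolding g' by (simp add: integral_hp_hp)
    qed
    have pr: "(\<Prod>j\<in>UNIV. if a j = b j then ?s else 0) = (if a = b then (\<Prod>j\<in>(UNIV::'n set). ?s) else 0)" for a
    proof (cases "a = b")
      case False
      then obtain j where "a j \<noteq> b j" by auto
      then show ?thesis using False by (auto intro!: prod_zero)
    qed simp
    have "(\<integral>y. K y * \<Phi> b y \<partial>lborel) = (\<Sum>n. \<Sum>a\<in>midx n. v a * (\<Prod>j\<in>UNIV. \<integral>t. g j (a j) t \<partial>lborel))"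
      unfolding eq by (rule series_product_integral(2)[OF r v gint Gint bnd])
    \<comment> \<open>Orthogonality in every coordinate leaves only a = b, which occurs in the
      single degree \<open>mdeg b\<close>.\<close>
    also have "\<dots> = (\<Sum>n. if n = mdeg b then (\<Prod>j\<in>(UNIV::'n set). ?s) * v b else 0)"
    proof (intro suminf_cong)
      fix n
      have "(\<Sum>a\<in>midx n. v a * (\<Prod>j\<in>UNIV. \<integral>t. g j (a j) t \<partial>lborel))
          = (\<Sum>a\<in>midx n. if a = b then (\<Prod>j\<in>(UNIV::'n set). ?s) * v b else 0)"
        unfolding gi pr by (intro sum.cong) auto
      also have "\<dots> = (if n = mdeg b then (\<Prod>j\<in>(UNIV::'n set). ?s) * v b else 0)"
        by (subst sum.delta) (auto simp: midx_def[symmetric], auto simp: midx_def)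
      finally show "(\<Sum>a\<in>midx n. v a * (\<Prod>j\<in>UNIV. \<integral>t. g j (a j) t \<partial>lborel))
          = (if n = mdeg b then (\<Prod>j\<in>(UNIV::'n set). ?s) * v b else 0)" .
    qed
    also have "\<dots> = (\<Prod>j\<in>(UNIV::'n set). ?s) * v b"
      using sums_single[of "mdeg b" "\<lambda>_. (\<Prod>j\<in>(UNIV::'n set). ?s) * v b"] by (rule sums_unique[symmetric])
    finally show "(\<integral>y. K y * \<Phi> b y \<partial>lborel) = (\<Prod>j\<in>(UNIV::'n set). ?s) * v b" .
  qed
  have KF: "Kfun R Rp \<kappa> y z * fourier (\<lambda>x. p x * exp (- complex_of_real (norm x ^ 2 / 2))) y
      = (\<Sum>b\<in>?B. c b * (K y * \<Phi> b y))" for y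
    unfolding Kfun f2 by (simp add: sum_distrib_left mult_ac)
  have I1: "integrable lborel (\<lambda>y. Kfun R Rp \<kappa> y z * fourier (\<lambda>x. p x * exp (- complex_of_real (norm x ^ 2 / 2))) y)"
    unfolding KF by (intro Bochner_Integration.integrable_sum integrable_mult_right KPhi)
  have "(\<integral>y. Kfun R Rp \<kappa> y z * fourier (\<lambda>x. p x * exp (- complex_of_real (norm x ^ 2 / 2))) y \<partial>lborel)
      = (\<Sum>b\<in>?B. c b * ((\<Prod>j\<in>(UNIV::'n set). ?s) * v b))"
    unfolding KF
    by (subst Bochner_Integration.integral_sum) (auto intro!: integrable_mult_right simp: KPhi)
  then have "?c0 * (\<integral>y. Kfun R Rp \<kappa> y z * fourier (\<lambda>x. p x * exp (- complex_of_real (norm x ^ 2 / 2))) y \<partial>lborel)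
      = (?c0 * (\<Prod>j\<in>(UNIV::'n set). ?s)) * (\<Sum>b\<in>?B. c b * v b)"
    by (simp only: sum_distrib_left) (simp only: mult_ac)
  then have V1: "Vfun R Rp \<kappa> p z = ?c0 * (\<integral>y. Kfun R Rp \<kappa> y z *
      fourier (\<lambda>x. p x * exp (- complex_of_real (norm x ^ 2 / 2))) y \<partial>lborel)"
    unfolding fourier_constant Vf[OF c p] by simp
  \<comment> \<open>The two integrands agree at every y: by \<open>f1\<close> the transformed kernel
    carries the Gaussian that the weight exp(|y|^2 / 2) removes.\<close>
  have "fourier (\<lambda>x. exp (- complex_of_real (norm x ^ 2 / 2)) * dunkl_kernel R Rp \<kappa> (cvec x) (cvec (- z))) y *
      fourier (\<lambda>x. exp (- complex_of_real (norm x ^ 2 / 2)) * p x) y * exp (complex_of_real (norm y ^ 2 / 2))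
    = Kfun R Rp \<kappa> y z * fourier (\<lambda>x. p x * exp (- complex_of_real (norm x ^ 2 / 2))) y" for y
  proof -
    have 1: "exp (- complex_of_real (norm y ^ 2 / 2)) * exp (complex_of_real (norm y ^ 2 / 2)) = 1"
      by (simp only: exp_add[symmetric]) simp
    have 2: "(\<lambda>x. exp (- complex_of_real (norm x ^ 2 / 2)) * p x) = (\<lambda>x. p x * exp (- complex_of_real (norm x ^ 2 / 2)))"
      by (rule ext) (rule mult.commute)
    have 3: "k * e * f * e' = k * f * (e * e')" for k e f e' :: complex
      by (simp only: mult_ac)
    show ?thesis unfolding f1 Kfun 2 3 1 by (rule mult_1_right)
  qed
  then show ?thesis using I1 V1 by simp
qed

end
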